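(* Let $n\ge 2$ and let $G$ be a complete multipartite graph with partition $V_1\sqcup\cdots\sqcup V_n$ of its vertex set, where $|V_i|=w_i\geq 1$ and $w_i\le w_{i+1}$ for all $1\le i<n$. Let $S$ be the polynomial ring over a field $\mathsf{k}$ in variables indexed by the vertices of $G$ (standard grading), and let $J(G)\subset S$ be the cover ideal of $G$. Then for all $s\ge 1$, $$\operatorname{reg}(S/J(G)^s)=\begin{cases} s\sum_{l=1}^{n}w_l-(s+1) & \text{if } s<n-1,\\ s\sum_{l=1}^{n}w_l-w_1(s-n+1)-n & \text{otherwise.}\end{cases}$$
   Context: In the complete multipartite graph with parts $V_1,\dots,V_n$ (nonempty), two vertices are adjacent if and only if they lie in different parts. A set $C$ of vertices is a cover set of $G$ if it meets every edge of $G$; it is minimal if no proper subset obtained by deleting one element is a cover set. The cover ideal $J(G)$ is generated by the monomials $\prod_{v\in C}X_v$, $C$ running over the minimal cover sets of $G$. For a finitely generated graded $S$-module $M$, $\operatorname{reg}(M)=\max\{j-i:\beta^S_{i,j}(M)\ne 0\}$, where $\beta^S_{i,j}(M)=\dim_{\mathsf{k}}\operatorname{Tor}_i^S(M,\mathsf{k})_j$. *)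

theory Defs
  imports
    "HOL-Algebra.Ideal_Product"
    "HOL-Library.Poly_Mapping"
    "HOL-Library.Disjoint_Sets"
    "Jordan_Normal_Form.Matrix_Kernel"
begin

section \<open>Polynomial rings, standard grading\<close>

type_synonym ('v, 'k) mpoly = "('v \<Rightarrow>\<^sub>0 nat) \<Rightarrow>\<^sub>0 'k"

definition var :: "'v \<Rightarrow> ('v, 'k::field) mpoly" where
  "var v = Poly_Mapping.single (Poly_Mapping.single v 1) 1"

definition mdegree :: "('v \<Rightarrow>\<^sub>0 nat) \<Rightarrow> nat" where
  "mdegree m = (\<Sum>v\<in>Poly_Mapping.keys m. Poly_Mapping.lookup m v)"

text \<open>The homogeneous component of degree \<open>j\<close>; it is zero for \<open>j < 0\<close>.\<close>
definition forms :: "int \<Rightarrow> ('v, 'k::field) mpoly set" where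
  "forms j = {f. \<forall>m\<in>Poly_Mapping.keys f. int (mdegree m) = j}"


section \<open>Quotient modules\<close>

text \<open>The fields \<open>mult\<close> and \<open>one\<close> that a module record inherits from rings carry no meaning.
  Scalar multiplication sends a coset \<open>X\<close> to the coset \<open>a X + N\<close>.\<close>
definition quotient_module :: "('a, 'm) module \<Rightarrow> 'm set \<Rightarrow> ('a, 'm set) module" where
  "quotient_module M N =
     \<lparr> carrier = a_rcosets\<^bsub>M\<^esub> N, mult = undefined, one = undefined,
       zero = N, add = (\<lambda>X Y. X <+>\<^bsub>M\<^esub> Y),
       smult = (\<lambda>a X. \<Union>x\<in>X. N +>\<^bsub>M\<^esub> (a \<odot>\<^bsub>M\<^esub> x)) \<rparr>"

definition regular_module :: "('a::comm_ring_1, 'a) module" where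
  "regular_module =
     \<lparr> carrier = UNIV, mult = (*), one = 1, zero = 0, add = (+), smult = (*) \<rparr>"

text \<open>The module \<open>S/I\<close>; its degree \<open>j\<close> component consists of the classes of forms of degree \<open>j\<close>.\<close>
definition cyclic_module ::
    "('v, 'k::field) mpoly set \<Rightarrow> (('v, 'k) mpoly, ('v, 'k) mpoly set) module" where
  "cyclic_module I = quotient_module regular_module I"

definition cyclic_grading ::
    "('v, 'k::field) mpoly set \<Rightarrow> int \<Rightarrow> ('v, 'k) mpoly set set" where
  "cyclic_grading I j = (\<lambda>f. I +>\<^bsub>class_ring\<^esub> f) ` forms j"


section \<open>Graded free resolutions, Tor, Betti numbers, regularity\<close>

text \<open>
  A graded module is a module record \<open>M\<close> over the polynomial ring \<open>S\<close> together with the family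
  \<open>gr\<close> of its homogeneous components. In a resolution, the free module \<open>F\<^sub>i\<close> is \<open>S\<^sup>r\<close> with
  \<open>r = rk F i\<close>, its \<open>p\<close>-th basis vector has degree \<open>shift F i p\<close> (so that \<open>F\<^sub>i\<close> is the direct sum
  of the twists \<open>S(- shift F i p)\<close>), the differential from \<open>F\<^sub>i\<^sub>+\<^sub>1\<close> to \<open>F\<^sub>i\<close> is the matrix
  \<open>bd F i\<close>, and \<open>aug F\<close> is the augmentation from \<open>F\<^sub>0\<close> to \<open>M\<close>.
\<close>
record ('s, 'm) free_complex =
  rk :: "nat \<Rightarrow> nat"
  shift :: "nat \<Rightarrow> nat \<Rightarrow> int"
  bd :: "nat \<Rightarrow> 's mat"
  aug :: "'s vec \<Rightarrow> 'm"

definition graded_free_resolution ::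
    "(('v, 'k::field) mpoly, 'm) module \<Rightarrow> (int \<Rightarrow> 'm set)
      \<Rightarrow> (('v, 'k) mpoly, 'm) free_complex \<Rightarrow> bool" where
  "graded_free_resolution M gr F \<longleftrightarrow>
     (\<forall>i. bd F i \<in> carrier_mat (rk F i) (rk F (Suc i))) \<and>
     (\<forall>i. \<forall>p<rk F i. \<forall>q<rk F (Suc i).
        bd F i $$ (p, q) \<in> forms (shift F (Suc i) q - shift F i p)) \<and>
     aug F \<in> LinearCombinations.module_hom class_ring (module_vec TYPE(('v, 'k) mpoly) (rk F 0)) M \<and>
     (\<forall>p<rk F 0. aug F (unit_vec (rk F 0) p) \<in> gr (shift F 0 p)) \<and>
     aug F ` carrier_vec (rk F 0) = carrier M \<and>
     {x \<in> carrier_vec (rk F 0). aug F x = \<zero>\<^bsub>M\<^esub>}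
       = (\<lambda>x. bd F 0 *\<^sub>v x) ` carrier_vec (rk F 1) \<and>
     (\<forall>i. mat_kernel (bd F i)
       = (\<lambda>x. bd F (Suc i) *\<^sub>v x) ` carrier_vec (rk F (Suc (Suc i))))"

text \<open>
  The residue field \<open>k\<close> is \<open>S\<close> modulo the ideal generated by the variables. Hence tensoring
  \<open>S\<^sup>r\<close> with \<open>k\<close> gives \<open>k\<^sup>r\<close>, and a matrix over \<open>S\<close> becomes the matrix of the constant
  coefficients of its entries.
\<close>
definition bd_k :: "(('v, 'k::field) mpoly, 'm) free_complex \<Rightarrow> nat \<Rightarrow> 'k mat" where
  "bd_k F i = map_mat (\<lambda>f. Poly_Mapping.lookup f 0) (bd F i)"

definition chains_k ::
    "(('v, 'k::field) mpoly, 'm) free_complex \<Rightarrow> nat \<Rightarrow> int \<Rightarrow> 'k vec set" where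
  "chains_k F i j =
     {x \<in> carrier_vec (rk F i). \<forall>p<rk F i. x $ p \<noteq> 0 \<longrightarrow> shift F i p = j}"

text \<open>In homological degree \<open>0\<close> every chain is a cycle.\<close>
definition cycles_k ::
    "(('v, 'k::field) mpoly, 'm) free_complex \<Rightarrow> nat \<Rightarrow> int \<Rightarrow> 'k vec set" where
  "cycles_k F i j =
     {x \<in> chains_k F i j. \<forall>h. i = Suc h \<longrightarrow> bd_k F h *\<^sub>v x = 0\<^sub>v (rk F h)}"

definition boundaries_k ::
    "(('v, 'k::field) mpoly, 'm) free_complex \<Rightarrow> nat \<Rightarrow> int \<Rightarrow> 'k vec set" where
  "boundaries_k F i j = (\<lambda>x. bd_k F i *\<^sub>v x) ` chains_k F (Suc i) j"

definition homology_k ::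
    "(('v, 'k::field) mpoly, 'm) free_complex \<Rightarrow> nat \<Rightarrow> int \<Rightarrow> ('k, 'k vec set) module" where
  "homology_k F i j =
     quotient_module (module_vec TYPE('k) (rk F i)\<lparr>carrier := cycles_k F i j\<rparr>)
       (boundaries_k F i j)"

text \<open>
  The degree \<open>j\<close> component of the \<open>i\<close>-th Tor module of \<open>M\<close> and \<open>k\<close>, computed from a chosen
  graded free resolution of \<open>M\<close> (by finitely generated free modules, as suffices for finitely
  generated \<open>M\<close>); up to isomorphism it does not depend on the choice.
\<close>
definition Tor_k ::
    "(('v, 'k::field) mpoly, 'm) module \<Rightarrow> (int \<Rightarrow> 'm set) \<Rightarrow> nat \<Rightarrow> int
      \<Rightarrow> ('k, 'k vec set) module" where
  "Tor_k M gr = homology_k (SOME F. graded_free_resolution M gr F)"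

definition betti ::
    "(('v, 'k::field) mpoly, 'm) module \<Rightarrow> (int \<Rightarrow> 'm set) \<Rightarrow> nat \<Rightarrow> int \<Rightarrow> nat" where
  "betti M gr i j = vectorspace.dim class_ring (Tor_k M gr i j)"

text \<open>The set below is finite and nonempty for nonzero finitely generated graded modules.\<close>
definition regularity ::
    "(('v, 'k::field) mpoly, 'm) module \<Rightarrow> (int \<Rightarrow> 'm set) \<Rightarrow> int" where
  "regularity M gr = Max {j - int i | i j. betti M gr i j \<noteq> 0}"


section \<open>Complete multipartite graphs and cover ideals\<close>

text \<open>A graph with vertex set the whole type \<open>'v\<close> is given by its set of two-element edges.\<close>
definition complete_multipartite :: "nat \<Rightarrow> (nat \<Rightarrow> 'v set) \<Rightarrow> 'v set set \<Rightarrow> bool" where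
  "complete_multipartite n V E \<longleftrightarrow>
     (\<forall>i\<in>{1..n}. V i \<noteq> {}) \<and>
     disjoint_family_on V {1..n} \<and>
     (\<Union>i\<in>{1..n}. V i) = UNIV \<and>
     E = {{u, v} | u v. \<exists>i\<in>{1..n}. \<exists>j\<in>{1..n}. i \<noteq> j \<and> u \<in> V i \<and> v \<in> V j}"

definition cover_set :: "'v set set \<Rightarrow> 'v set \<Rightarrow> bool" where
  "cover_set E C \<longleftrightarrow> (\<forall>e\<in>E. e \<inter> C \<noteq> {})"

definition minimal_cover_set :: "'v set set \<Rightarrow> 'v set \<Rightarrow> bool" where
  "minimal_cover_set E C \<longleftrightarrow> cover_set E C \<and> (\<forall>v\<in>C. \<not> cover_set E (C - {v}))"

definition cover_ideal :: "'v::finite set set \<Rightarrow> ('v, 'k::field) mpoly set" where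
  "cover_ideal E = Idl\<^bsub>class_ring\<^esub> {\<Prod>v\<in>C. var v | C. minimal_cover_set E C}"

definition ideal_power :: "('v, 'k::field) mpoly set \<Rightarrow> nat \<Rightarrow> ('v, 'k) mpoly set" where
  "ideal_power I s = I [^]\<^bsub>ideals_set class_ring\<^esub> s"

end

theory Submission
  imports Defs
begin

text \<open>
  Write \<open>y\<^sub>i\<close> for the product of the variables in the part \<open>V\<^sub>i\<close>. The minimal covers are the complements
  of the parts, so \<open>J\<close> is generated by \<open>m\<^sub>i = \<Prod>\<^bsub>j \<noteq> i\<^esub> y\<^sub>j\<close>. This ideal is of linear type: its Rees algebra is
  \<open>S[T\<^sub>1,\<dots>,T\<^sub>n]\<close> modulo the complete intersection \<open>y\<^sub>j T\<^sub>j - y\<^sub>n T\<^sub>n\<close> (\<open>j < n\<close>). The strand of \<open>T\<close>-degree \<open>s\<close> of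
  the Koszul complex on these elements is therefore a free resolution of \<open>J\<^sup>s\<close>. It is minimal, and
  with \<open>W = \<Sum> w\<^sub>l\<close> the basis element \<open>T\<^sup>b e\<^sub>I\<close>, where \<open>|b| + |I| = s\<close>, has degree
  \<open>s W - \<Sum>\<^bsub>j \<in> b\<^esub> w\<^sub>j\<close> and contributes to \<open>Tor\<close> of \<open>S/J\<^sup>s\<close> in homological degree \<open>|I| + 1\<close>. The maximum
  of \<open>s W - (s - i) w\<^sub>1 - i - 1\<close> over \<open>i \<le> min s (n - 1)\<close> is attained at the largest \<open>i\<close>.

  Exactness is proved monomial by monomial. Keeping only the terms \<open>y\<^sub>j T\<^sub>j\<close> of the differential
  leaves a complex with an explicit contraction on monomials; the remaining terms raise the
  exponent of \<open>T\<^sub>n\<close>, which is at most \<open>s\<close>, so the contraction can be corrected in finitely many steps.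
\<close>


section \<open>Dimension of quotient spaces\<close>

text \<open>\<open>Tor_k\<close> takes its resolution from \<open>SOME\<close>, so nothing can be
  read off the Koszul strand until the answer is known not to depend on that choice. The comparison
  goes only as far as regularity needs: what is carried from one resolution to another is whether
  cycles and boundaries differ, not a dimension. Matrices are lifted column by column and cut down
  to homogeneous parts; the strand itself shows that a resolution exists. The index \<open>n\<close>
  is set apart because the contraction divides only by \<open>y_m T_m\<close> with
  \<open>m < n\<close>, hence never changes the exponent of \<open>T_n\<close>, while each trailing
  term raises it. Once that exponent would have to exceed \<open>s\<close>, only terms with empty
  index set and nothing to divide by are left. In positive homological degree there are none; in
  degree 0 their images in the ideal are distinct monomials, so a cycle made of them is zero. The
  maximum sits at the largest \<open>i\<close> because one more index in \<open>I\<close> removes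
  one factor \<open>T_1\<close> and so changes the value by \<open>w_1 - 1\<close>, which is not
  negative. The two cases of the formula tell which of \<open>s\<close> and \<open>n - 1\<close>
  stops \<open>i\<close>.\<close>

lemma abelian_subgroup_of_submodule:
  assumes "Module.module R M" "submodule R N M"
  shows "abelian_subgroup N M"
proof (rule abelian_subgroupI3)
  interpret M: Module.module R M by fact
  interpret N: submodule R N M by fact
  show "abelian_group M" by (rule M.abelian_group_axioms)
  show "additive_subgroup N M"
  proof (rule additive_subgroup.intro)
    show "subgroup N (add_monoid M)"
    proof (rule subgroup.intro)
      fix x assume x: "x \<in> N"
      then have "inv\<^bsub>add_monoid M\<^esub> x = (\<ominus>\<^bsub>R\<^esub> \<one>\<^bsub>R\<^esub>) \<odot>\<^bsub>M\<^esub> x"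
        using N.subset by (subst M.smult_minus_1) (auto simp: a_inv_def)
      then show "inv\<^bsub>add_monoid M\<^esub> x \<in> N" using x by auto
    qed (use N.subset in auto)
  qed
qed

locale quotient = Module.module R M + submodule R N M
  for R and M :: "('a, 'c) module" (structure) and N
begin

sublocale abelian_subgroup N M
  using abelian_subgroup_of_submodule[of R M N] module_axioms submodule_axioms by blast

abbreviation "Q \<equiv> quotient_module M N"

lemma coset_of_mem: "x \<in> N \<Longrightarrow> N +> x = N"
  using a_coset_join2[of x N] a_subgroup subset by blast

lemma carrier_Q: "carrier Q = (\<lambda>x. N +> x) ` carrier M"
  by (auto simp: quotient_module_def A_RCOSETS_def' )

lemma add_Q: "x \<in> carrier M \<Longrightarrow> y \<in> carrier M \<Longrightarrow> (N +> x) \<oplus>\<^bsub>Q\<^esub> (N +> y) = N +> (x \<oplus> y)"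
  by (simp add: quotient_module_def a_rcos_sum)

lemma zero_Q: "\<zero>\<^bsub>Q\<^esub> = N +> \<zero>"
  using coset_of_mem[of \<zero>] by (simp add: quotient_module_def)

text \<open>All cosets in the union that defines the scalar product agree, because \<open>N\<close>
  is closed under multiplication by \<open>c\<close>; the union collapses to one of them.\<close>

lemma smult_Q:
  assumes c: "c \<in> carrier R" and x: "x \<in> carrier M"
  shows "c \<odot>\<^bsub>Q\<^esub> (N +> x) = N +> (c \<odot> x)"
proof -
  have "N +> (c \<odot> y) = N +> (c \<odot> x)" if "y \<in> N +> x" for y
  proof -
    from that obtain z where z: "z \<in> N" "y = z \<oplus> x" by (auto simp: a_r_coset_def')
    then have "c \<odot> y = (c \<odot> z) \<oplus> (c \<odot> x)"
      using c x subset by (auto simp: smult_r_distr)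
    then have "c \<odot> y \<in> N +> (c \<odot> x)"
      using z c by (auto simp: a_r_coset_def')
    then show ?thesis using c x a_subgroup by (intro a_repr_independence[symmetric]) auto
  qed
  then have "(\<Union>y\<in>N +> x. N +> (c \<odot> y)) = N +> (c \<odot> x)"
    using a_rcos_self[OF x] by (intro SUP_eq_const) blast+
  then show ?thesis by (simp add: quotient_module_def)
qed

lemma module_Q: "Module.module R Q"
proof (rule module_criteria)
  show "cring R" by (rule R.is_cring)
  show "\<forall>v\<in>carrier Q. \<exists>neg_v\<in>carrier Q. v \<oplus>\<^bsub>Q\<^esub> neg_v = \<zero>\<^bsub>Q\<^esub>"
  proof
    fix v assume "v \<in> carrier Q"
    then obtain x where x: "x \<in> carrier M" "v = N +> x" by (auto simp: carrier_Q)
    then show "\<exists>neg_v\<in>carrier Q. v \<oplus>\<^bsub>Q\<^esub> neg_v = \<zero>\<^bsub>Q\<^esub>"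
      by (auto simp: carrier_Q add_Q zero_Q M.r_neg intro!: bexI[of _ "\<ominus> x"])
  qed
  show "\<forall>v w. v \<in> carrier Q \<and> w \<in> carrier Q \<longrightarrow> v \<oplus>\<^bsub>Q\<^esub> w = w \<oplus>\<^bsub>Q\<^esub> v"
    by (clarsimp simp: carrier_Q add_Q) (simp add: M.a_comm)
  show "\<forall>v w x. v \<in> carrier Q \<and> w \<in> carrier Q \<and> x \<in> carrier Q \<longrightarrow>
      v \<oplus>\<^bsub>Q\<^esub> w \<oplus>\<^bsub>Q\<^esub> x = v \<oplus>\<^bsub>Q\<^esub> (w \<oplus>\<^bsub>Q\<^esub> x)"
    by (clarsimp simp: carrier_Q add_Q) (simp add: M.a_assoc)
  show "\<zero>\<^bsub>Q\<^esub> \<in> carrier Q"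
    by (auto simp: carrier_Q zero_Q)
  show "\<forall>v w. v \<in> carrier Q \<and> w \<in> carrier Q \<longrightarrow> v \<oplus>\<^bsub>Q\<^esub> w \<in> carrier Q"
    by (clarsimp simp: carrier_Q add_Q)
  show "\<forall>c v. c \<in> carrier R \<and> v \<in> carrier Q \<longrightarrow> c \<odot>\<^bsub>Q\<^esub> v \<in> carrier Q"
    by (clarsimp simp: carrier_Q smult_Q)
  show "\<forall>v\<in>carrier Q. v \<oplus>\<^bsub>Q\<^esub> \<zero>\<^bsub>Q\<^esub> = v"
    by (clarsimp simp: carrier_Q add_Q zero_Q)
  show "\<forall>a b v. a \<in> carrier R \<and> b \<in> carrier R \<and> v \<in> carrier Q \<longrightarrow>
      (a \<otimes>\<^bsub>R\<^esub> b) \<odot>\<^bsub>Q\<^esub> v = a \<odot>\<^bsub>Q\<^esub> (b \<odot>\<^bsub>Q\<^esub> v)"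
    by (clarsimp simp: carrier_Q smult_Q smult_assoc1)
  show "\<forall>v\<in>carrier Q. \<one>\<^bsub>R\<^esub> \<odot>\<^bsub>Q\<^esub> v = v"
    by (clarsimp simp: carrier_Q smult_Q)
  show "\<forall>a b v. a \<in> carrier R \<and> b \<in> carrier R \<and> v \<in> carrier Q \<longrightarrow>
      (a \<oplus>\<^bsub>R\<^esub> b) \<odot>\<^bsub>Q\<^esub> v = a \<odot>\<^bsub>Q\<^esub> v \<oplus>\<^bsub>Q\<^esub> b \<odot>\<^bsub>Q\<^esub> v"
    by (clarsimp simp: carrier_Q smult_Q smult_l_distr add_Q)
  show "\<forall>a v w. a \<in> carrier R \<and> v \<in> carrier Q \<and> w \<in> carrier Q \<longrightarrow>
      a \<odot>\<^bsub>Q\<^esub> (v \<oplus>\<^bsub>Q\<^esub> w) = a \<odot>\<^bsub>Q\<^esub> v \<oplus>\<^bsub>Q\<^esub> a \<odot>\<^bsub>Q\<^esub> w"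
    by (clarsimp simp: carrier_Q smult_Q smult_r_distr add_Q)
qed

lemma proj_hom: "(\<lambda>x. N +> x) \<in> LinearCombinations.module_hom R M Q"
  by (auto simp: LinearCombinations.module_hom_def carrier_Q add_Q smult_Q)

end

text \<open>A linearly independent subset of \<open>W\<close> stays independent in \<open>V\<close>,
  which bounds its size by \<open>dim\<close>; a maximal one is then a finite basis of
  \<open>W\<close>.\<close>

lemma (in vectorspace) subspace_fin_dim:
  assumes W: "subspace K W V" and fin: "fin_dim"
  shows "vectorspace.fin_dim K (vs W)"
proof -
  interpret W: vectorspace K "vs W" by (rule subspace_is_vs[OF W])
  have sub: "submodule K W V" using W by simp
  then have WV: "W \<subseteq> carrier V" by (simp add: submodule_def)
  have "\<exists>A. finite A \<and> maximal A (\<lambda>S. S \<subseteq> carrier (vs W) \<and> W.lin_indpt S)"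
  proof (rule maximal_exists)
    fix A assume "A \<subseteq> carrier (vs W) \<and> W.lin_indpt A"
    then have A: "A \<subseteq> W" "W.lin_indpt A" by auto
    have "lin_indpt A" using span_li_not_depend(2)[OF A(1) sub] A(2) by simp
    then show "finite A \<and> card A \<le> dim" using li_le_dim[OF fin] A WV by auto
  next
    show "{} \<subseteq> carrier (vs W) \<and> W.lin_indpt {}"
      by (auto simp: W.lin_dep_def)
  qed
  then obtain A where "finite A" "maximal A (\<lambda>S. S \<subseteq> carrier (vs W) \<and> W.lin_indpt S)" by blast
  then show ?thesis
    using W.max_li_is_basis[of A] unfolding W.fin_dim_def W.basis_def by blast
qed

lemma (in vectorspace) dim_eq_0_iff:
  assumes "fin_dim"
  shows "dim = 0 \<longleftrightarrow> carrier V = {\<zero>\<^bsub>V\<^esub>}"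
proof -
  obtain A where A: "finite A" "basis A" using finite_basis_exists[OF assms] by blast
  have span_empty: "span {} = {\<zero>\<^bsub>V\<^esub>}"
    by (auto simp: span_def lincomb_def)
  show ?thesis
  proof
    assume "dim = 0"
    then have "A = {}" using dim_basis[OF A] A(1) by simp
    then show "carrier V = {\<zero>\<^bsub>V\<^esub>}" using A(2) span_empty by (simp add: basis_def)
  next
    assume *: "carrier V = {\<zero>\<^bsub>V\<^esub>}"
    have "basis {}" using * span_empty by (auto simp: basis_def lin_dep_def)
    then show "dim = 0" using dim_basis[of "{}"] by simp
  qed
qed

text \<open>Regularity asks only which Betti numbers vanish, so this is all that has to be known
  about the dimension of a homology space.\<close>

lemma dim_quotient_eq_0_iff:
  assumes V: "vectorspace K V" and fin: "vectorspace.fin_dim K V"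
    and Z: "submodule K Z V" and B: "submodule K B V" and BZ: "B \<subseteq> Z"
  shows "vectorspace.dim K (quotient_module (V\<lparr>carrier := Z\<rparr>) B) = 0 \<longleftrightarrow> Z = B"
proof -
  interpret V: vectorspace K V by fact
  have subZ: "subspace K Z V" using V Z by (simp add: subspace_def)
  interpret Z: vectorspace K "V\<lparr>carrier := Z\<rparr>" by (rule V.subspace_is_vs[OF subZ])
  have "submodule K B (V\<lparr>carrier := Z\<rparr>)"
    using B BZ Z.module_axioms by (simp add: submodule_def)
  then interpret quotient K "V\<lparr>carrier := Z\<rparr>" B
    by (simp add: quotient_def Z.module_axioms)
  interpret Q: vectorspace K Q
    using module_Q V by (simp add: vectorspace_def)
  interpret linear_map K "V\<lparr>carrier := Z\<rparr>" Q "\<lambda>x. B +>\<^bsub>V\<lparr>carrier := Z\<rparr>\<^esub> x"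
    by (intro linear_map.intro mod_hom.intro mod_hom_axioms.intro proj_hom
        Z.vectorspace_axioms Q.vectorspace_axioms Z.module_axioms Q.module_axioms)
  \<comment> \<open>\<open>Q\<close> is the image of the projection, so finiteness comes from
    rank-nullity.\<close>
  have "Q.fin_dim"
    using rank_nullity_main(2)[OF V.subspace_fin_dim[OF subZ fin]] carrier_Q by simp
  then have "Q.dim = 0 \<longleftrightarrow> carrier Q = {\<zero>\<^bsub>Q\<^esub>}" by (rule Q.dim_eq_0_iff)
  also have "\<dots> \<longleftrightarrow> Z = B"
  proof
    assume *: "carrier Q = {\<zero>\<^bsub>Q\<^esub>}"
    have "x \<in> B" if "x \<in> Z" for x
    proof -
      have "B +>\<^bsub>V\<lparr>carrier := Z\<rparr>\<^esub> x = B"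
        using * that by (auto simp: carrier_Q) (auto simp: quotient_module_def)
      then show "x \<in> B" using a_rcos_self[of x] that by simp
    qed
    with BZ show "Z = B" by auto
  next
    assume *: "Z = B"
    have "B +>\<^bsub>V\<lparr>carrier := Z\<rparr>\<^esub> x = B" if "x \<in> Z" for x
      using coset_of_mem that * by simp
    moreover have "Z \<noteq> {}" using Z by (auto simp: submodule_def)
    ultimately show "carrier Q = {\<zero>\<^bsub>Q\<^esub>}"
      by (auto simp: carrier_Q) (auto simp: quotient_module_def)
  qed
  finally show ?thesis .
qed

section \<open>Graded matrices\<close>

lemma mdegree_eq_sum:
  assumes "finite A" "Poly_Mapping.keys m \<subseteq> A"
  shows "mdegree m = (\<Sum>v\<in>A. Poly_Mapping.lookup m v)"
  unfolding mdegree_def using assms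
  by (intro sum.mono_neutral_left) (auto simp: in_keys_iff)

lemma mdegree_add: "mdegree (m + m') = mdegree m + mdegree m'"
proof -
  define A where "A = Poly_Mapping.keys m \<union> Poly_Mapping.keys m'"
  have A: "finite A" "Poly_Mapping.keys (m + m') \<subseteq> A"
    using keys_add[of m m'] by (auto simp: A_def)
  show ?thesis
    using mdegree_eq_sum[OF A] mdegree_eq_sum[OF A(1), of m] mdegree_eq_sum[OF A(1), of m']
    by (auto simp: A_def lookup_add sum.distrib)
qed

lemma forms_0 [simp]: "0 \<in> forms j"
  by (simp add: forms_def)

lemma forms_uminus: "f \<in> forms j \<Longrightarrow> - f \<in> forms j"
  by (auto simp: forms_def in_keys_iff)

lemma forms_add: "f \<in> forms j \<Longrightarrow> g \<in> forms j \<Longrightarrow> f + g \<in> forms j"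
  using keys_add[of f g] by (fastforce simp: forms_def)

lemma forms_diff: "f \<in> forms j \<Longrightarrow> g \<in> forms j \<Longrightarrow> f - g \<in> forms j"
  using forms_add[OF _ forms_uminus, of f j g] by simp

lemma forms_sum: "(\<And>x. x \<in> A \<Longrightarrow> f x \<in> forms j) \<Longrightarrow> sum f A \<in> forms j"
  by (induction A rule: infinite_finite_induct) (auto intro: forms_add)

lemma forms_mult: "f \<in> forms i \<Longrightarrow> g \<in> forms j \<Longrightarrow> f * g \<in> forms (i + j)"
  using keys_mult[of f g] by (fastforce simp: forms_def mdegree_add)

lemma forms_const_zero: "f \<in> forms j \<Longrightarrow> j \<noteq> 0 \<Longrightarrow> Poly_Mapping.lookup f 0 = 0"
  by (force simp: forms_def mdegree_def in_keys_iff)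

section \<open>Homogeneous components\<close>

lift_definition hom_comp :: "int \<Rightarrow> ('v, 'k::field) mpoly \<Rightarrow> ('v, 'k) mpoly"
  is "\<lambda>j f m. f m when int (mdegree m) = j"
  by (erule finite_subset[rotated]) auto

lemma hom_comp_forms [simp]: "hom_comp j f \<in> forms j"
  by (auto simp: forms_def in_keys_iff hom_comp.rep_eq when_def split: if_splits)

lemma hom_comp_of_forms: "f \<in> forms j \<Longrightarrow> hom_comp i f = (if i = j then f else 0)"
  by (intro poly_mapping_eqI) (auto simp: forms_def in_keys_iff hom_comp.rep_eq when_def)

lemma hom_comp_add: "hom_comp j (f + g) = hom_comp j f + hom_comp j g"
  by (intro poly_mapping_eqI) (auto simp: hom_comp.rep_eq when_def lookup_add)

lemma hom_comp_0 [simp]: "hom_comp j 0 = 0"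
  by (intro poly_mapping_eqI) (auto simp: hom_comp.rep_eq)

lemma hom_comp_diff: "hom_comp j (f - g) = hom_comp j f - hom_comp j g"
  by (intro poly_mapping_eqI) (auto simp: hom_comp.rep_eq when_def lookup_minus)

lemma hom_comp_sum: "hom_comp j (sum f A) = (\<Sum>x\<in>A. hom_comp j (f x))"
  by (induction A rule: infinite_finite_induct) (auto simp: hom_comp_add)

lemma hom_comp_decomp:
  "f = (\<Sum>j\<in>(\<lambda>m. int (mdegree m)) ` Poly_Mapping.keys f. hom_comp j f)"
  by (intro poly_mapping_eqI) (auto simp: lookup_sum hom_comp.rep_eq when_def in_keys_iff)

text \<open>By additivity \<open>g\<close> may be replaced by its homogeneous components; the one of
  degree \<open>i\<close> is moved to degree \<open>d + i\<close>.\<close>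

lemma hom_comp_mult:
  assumes "f \<in> forms d"
  shows "hom_comp j (f * g) = f * hom_comp (j - d) g"
proof -
  let ?A = "(\<lambda>m. int (mdegree m)) ` Poly_Mapping.keys g"
  have "hom_comp j (f * g) = hom_comp j (\<Sum>i\<in>?A. f * hom_comp i g)"
    by (subst hom_comp_decomp[of g]) (simp add: sum_distrib_left)
  also have "\<dots> = (\<Sum>i\<in>?A. hom_comp j (f * hom_comp i g))"
    by (rule hom_comp_sum)
  also have "\<dots> = (\<Sum>i\<in>?A. if i = j - d then f * hom_comp i g else 0)"
    by (rule sum.cong) (auto simp: hom_comp_of_forms[OF forms_mult[OF assms hom_comp_forms]])
  also have "\<dots> = (\<Sum>i\<in>?A. f * hom_comp (j - d) (hom_comp i g))"
    by (rule sum.cong) (auto simp: hom_comp_of_forms[OF hom_comp_forms])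
  also have "\<dots> = f * hom_comp (j - d) (\<Sum>i\<in>?A. hom_comp i g)"
    by (simp add: sum_distrib_left hom_comp_sum)
  finally show ?thesis by (subst (asm) hom_comp_decomp[of g, symmetric])
qed

text \<open>A map \<open>\<Oplus> S(-b q) \<rightarrow> \<Oplus> S(-a p)\<close> of degree \<open>0\<close>: shifts of the target come first.\<close>
definition graded_mat ::
    "nat \<Rightarrow> (nat \<Rightarrow> int) \<Rightarrow> nat \<Rightarrow> (nat \<Rightarrow> int) \<Rightarrow> ('v, 'k::field) mpoly mat \<Rightarrow> bool" where
  "graded_mat r a c b A \<longleftrightarrow>
     A \<in> carrier_mat r c \<and> (\<forall>p<r. \<forall>q<c. A $$ (p, q) \<in> forms (b q - a p))"

lemma graded_mat_carrier: "graded_mat r a c b A \<Longrightarrow> A \<in> carrier_mat r c"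
  by (simp add: graded_mat_def)

lemma graded_mat_mult:
  assumes "graded_mat r a c b A" "graded_mat c b m d B"
  shows "graded_mat r a m d (A * B)"
  unfolding graded_mat_def
proof (intro conjI allI impI)
  show "A * B \<in> carrier_mat r m"
    using assms by (auto simp: graded_mat_def)
  fix p q assume "p < r" "q < m"
  then have "(A * B) $$ (p, q) = (\<Sum>i\<in>{0..<c}. A $$ (p, i) * B $$ (i, q))"
    using assms by (auto simp: graded_mat_def scalar_prod_def)
  also have "\<dots> \<in> forms (d q - a p)"
  proof (rule forms_sum)
    fix i assume "i \<in> {0..<c}"
    then show "A $$ (p, i) * B $$ (i, q) \<in> forms (d q - a p)"
      using forms_mult[of "A $$ (p, i)" "b i - a p" "B $$ (i, q)" "d q - b i"] assms
        \<open>p < r\<close> \<open>q < m\<close> by (auto simp: graded_mat_def)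
  qed
  finally show "(A * B) $$ (p, q) \<in> forms (d q - a p)" .
qed

lemma graded_mat_diff:
  assumes "graded_mat r a c b A" "graded_mat r a c b B"
  shows "graded_mat r a c b (A - B)"
  using assms by (auto simp: graded_mat_def intro!: forms_diff)

lemma graded_mat_one: "graded_mat r a r a (1\<^sub>m r)"
  by (auto simp: graded_mat_def one_mat_def) (auto simp: forms_def mdegree_def)

text \<open>A map of degree 0 does not mix homogeneous parts. In an element of degree
  \<open>j\<close>, the coefficient of a basis vector of degree \<open>b i\<close> has degree
  \<open>j - b i\<close>, hence the shifts.\<close>

lemma graded_mat_hom_comp:
  assumes D: "graded_mat r a c b D" and y: "y \<in> carrier_vec c" and p: "p < r"
  shows "(D *\<^sub>v vec c (\<lambda>i. hom_comp (j - b i) (y $ i))) $ p = hom_comp (j - a p) ((D *\<^sub>v y) $ p)"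
proof -
  have dim: "dim_row D = r" "dim_col D = c" "dim_vec y = c"
    using D y by (auto simp: graded_mat_def)
  have "(D *\<^sub>v vec c (\<lambda>i. hom_comp (j - b i) (y $ i))) $ p
      = (\<Sum>i\<in>{0..<c}. D $$ (p, i) * hom_comp (j - b i) (y $ i))"
    using p dim by (simp add: scalar_prod_def)
  also have "\<dots> = (\<Sum>i\<in>{0..<c}. hom_comp (j - a p) (D $$ (p, i) * y $ i))"
  proof (rule sum.cong[OF refl])
    fix i assume "i \<in> {0..<c}"
    then have "D $$ (p, i) \<in> forms (b i - a p)" using D p by (auto simp: graded_mat_def)
    from hom_comp_mult[OF this, of "j - a p" "y $ i"]
    show "D $$ (p, i) * hom_comp (j - b i) (y $ i) = hom_comp (j - a p) (D $$ (p, i) * y $ i)"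
      by simp
  qed
  also have "\<dots> = hom_comp (j - a p) ((D *\<^sub>v y) $ p)"
    using p dim by (simp add: scalar_prod_def hom_comp_sum)
  finally show ?thesis .
qed

text \<open>Exactness supplies arbitrary preimages, while comparison maps must be graded; cutting a
  preimage down to degree \<open>j\<close> repairs it.\<close>

lemma graded_mat_homogeneous_preimage:
  assumes D: "graded_mat r a c b D" and y: "y \<in> carrier_vec c"
    and Dy: "\<And>p. p < r \<Longrightarrow> (D *\<^sub>v y) $ p \<in> forms (j - a p)"
  shows "D *\<^sub>v vec c (\<lambda>i. hom_comp (j - b i) (y $ i)) = D *\<^sub>v y"
proof (rule eq_vecI)
  fix p assume "p < dim_vec (D *\<^sub>v y)"
  then have p: "p < r" using graded_mat_carrier[OF D] by simp
  show "(D *\<^sub>v vec c (\<lambda>i. hom_comp (j - b i) (y $ i))) $ p = (D *\<^sub>v y) $ p"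
    using graded_mat_hom_comp[OF D y p, of j] hom_comp_of_forms[OF Dy[OF p]] by simp
qed simp

text \<open>Projectivity of graded free modules in matrix form: each column is lifted separately and
  its preimage made homogeneous.\<close>

lemma graded_mat_lift:
  assumes D: "graded_mat r a c b D" and X: "graded_mat r a m d X"
    and im: "\<And>q. q < m \<Longrightarrow> col X q \<in> (\<lambda>y. D *\<^sub>v y) ` carrier_vec c"
  obtains Y where "graded_mat c b m d Y" "D * Y = X"
proof -
  have "\<forall>q. \<exists>y. q < m \<longrightarrow> y \<in> carrier_vec c \<and> D *\<^sub>v y = col X q"
    using im by fastforce
  then obtain y where y: "\<And>q. q < m \<Longrightarrow> y q \<in> carrier_vec c"
      "\<And>q. q < m \<Longrightarrow> D *\<^sub>v y q = col X q"
    by metis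
  define Y where "Y = mat c m (\<lambda>(i, q). hom_comp (d q - b i) (y q $ i))"
  have Y: "graded_mat c b m d Y"
    by (auto simp: graded_mat_def Y_def)
  have "D * Y = X"
  proof (rule mat_col_eqI)
    show dims: "dim_row (D * Y) = dim_row X" "dim_col (D * Y) = dim_col X"
      using D X Y by (auto simp: graded_mat_def)
    fix q assume "q < dim_col X"
    then have q: "q < m" using X by (auto simp: graded_mat_def)
    have "col (D * Y) q = D *\<^sub>v col Y q"
      using D Y q by (intro col_mult2) (auto simp: graded_mat_def)
    also have "col Y q = vec c (\<lambda>i. hom_comp (d q - b i) (y q $ i))"
      using q by (auto simp: Y_def col_def)
    also have "D *\<^sub>v \<dots> = D *\<^sub>v y q"
      using X q y by (intro graded_mat_homogeneous_preimage[OF D]) (auto simp: graded_mat_def)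
    finally show "col (D * Y) q = col X q" using y q by simp
  qed
  with Y show thesis by (rule that)
qed


section \<open>Exact sequences of graded free modules, lifts and homotopies\<close>

lemma mult_mat_unit_vec:
  fixes A :: "'a::comm_semiring_1 mat"
  shows "q < dim_col A \<Longrightarrow> A *\<^sub>v unit_vec (dim_col A) q = col A q"
  by (rule eq_vecI) (auto simp: scalar_prod_right_unit)

text \<open>Exactness is required only from homological degree 1 on; the module that is resolved is
  the cokernel of \<open>A 0\<close>.\<close>

locale graded_exact_sequence =
  fixes r :: "nat \<Rightarrow> nat" and a :: "nat \<Rightarrow> nat \<Rightarrow> int" and A :: "nat \<Rightarrow> ('v, 'k::field) mpoly mat"
  assumes gr: "graded_mat (r i) (a i) (r (Suc i)) (a (Suc i)) (A i)"
    and exact: "mat_kernel (A i) = (\<lambda>x. A (Suc i) *\<^sub>v x) ` carrier_vec (r (Suc (Suc i)))"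
begin

lemma carrier [simp]: "A i \<in> carrier_mat (r i) (r (Suc i))"
  by (rule graded_mat_carrier[OF gr])

lemma dims [simp]: "dim_row (A i) = r i" "dim_col (A i) = r (Suc i)"
  by (rule carrier_matD[OF carrier])+

lemma A_A: "A i * A (Suc i) = 0\<^sub>m (r i) (r (Suc (Suc i)))"
proof (rule mat_col_eqI)
  fix q assume "q < dim_col (0\<^sub>m (r i) (r (Suc (Suc i))))"
  then have q: "q < r (Suc (Suc i))" by simp
  have "A (Suc i) *\<^sub>v unit_vec (r (Suc (Suc i))) q \<in> mat_kernel (A i)"
    unfolding exact by auto
  then have "col (A (Suc i)) q \<in> mat_kernel (A i)"
    using q mult_mat_unit_vec[of q "A (Suc i)"] by simp
  then have "A i *\<^sub>v col (A (Suc i)) q = 0\<^sub>v (r i)"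
    by (auto dest: mat_kernelD(2)[OF carrier])
  then show "col (A i * A (Suc i)) q = col (0\<^sub>m (r i) (r (Suc (Suc i)))) q"
    using q by (subst col_mult2[OF carrier carrier]) auto
qed auto

lemma lift:
  assumes "graded_mat (r (Suc i)) (a (Suc i)) m d X" "A i * X = 0\<^sub>m (r i) m"
  obtains Y where "graded_mat (r (Suc (Suc i))) (a (Suc (Suc i))) m d Y" "A (Suc i) * Y = X"
proof (rule graded_mat_lift[OF gr assms(1)])
  fix q assume q: "q < m"
  have X: "X \<in> carrier_mat (r (Suc i)) m" by (rule graded_mat_carrier[OF assms(1)])
  have "A i *\<^sub>v col X q = col (A i * X) q"
    using q X by (subst col_mult2[OF carrier X]) auto
  also have "\<dots> = 0\<^sub>v (r i)"
    using q by (simp add: assms(2))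
  finally have "col X q \<in> mat_kernel (A i)"
    using X by (intro mat_kernelI[OF carrier]) (auto intro: col_carrier_vec q)
  then show "col X q \<in> (\<lambda>y. A (Suc i) *\<^sub>v y) ` carrier_vec (r (Suc (Suc i)))"
    by (simp add: exact)
qed (rule that)

text \<open>Assumption \<open>e0\<close> says that the endomorphism \<open>e\<close> induces zero on
  the cokernel of \<open>A 0\<close>. The homotopy is then built degree by degree, each step
  absorbing the error left by the one before.\<close>

lemma null_homotopy:
  assumes e: "\<And>i. graded_mat (r i) (a i) (r i) (a i) (e i)"
    and comm: "\<And>i. e i * A i = A i * e (Suc i)"
    and e0: "\<And>q. q < r 0 \<Longrightarrow> col (e 0) q \<in> (\<lambda>y. A 0 *\<^sub>v y) ` carrier_vec (r (Suc 0))"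
  obtains h where "\<And>i. graded_mat (r (Suc i)) (a (Suc i)) (r i) (a i) (h i)"
    "A 0 * h 0 = e 0" "\<And>i. A (Suc i) * h (Suc i) = e (Suc i) - h i * A i"
proof -
  \<comment> \<open>The equation \<open>A i * h * A i = e i * A i\<close> is what puts the columns
    of \<open>e (Suc i) - h * A i\<close> into the kernel of \<open>A i\<close>, so that the next
    \<open>h\<close> exists.\<close>
  let ?P = "\<lambda>i h. graded_mat (r (Suc i)) (a (Suc i)) (r i) (a i) h \<and>
      A i * h * A i = e i * A i \<and> (i = 0 \<longrightarrow> A 0 * h = e 0)"
  let ?Q = "\<lambda>i h h'. A (Suc i) * h' = e (Suc i) - h * A i"
  have "\<exists>h. \<forall>i. ?P i (h i) \<and> ?Q i (h i) (h (Suc i))"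
  proof (rule dependent_nat_choice)
    obtain h where "graded_mat (r (Suc 0)) (a (Suc 0)) (r 0) (a 0) h" "A 0 * h = e 0"
      using graded_mat_lift[OF gr e e0] by blast
    then show "\<exists>h. ?P 0 h" by auto
  next
    fix h i assume P: "?P i h"
    then have h: "graded_mat (r (Suc i)) (a (Suc i)) (r i) (a i) h"
      and hA: "A i * h * A i = e i * A i" by auto
    note c = graded_mat_carrier[OF h] graded_mat_carrier[OF e[of "Suc i"]]
      graded_mat_carrier[OF e[of i]] carrier[of i] carrier[of "Suc i"]
    have "A i * (e (Suc i) - h * A i) = A i * e (Suc i) - A i * (h * A i)"
      using c by (intro mult_minus_distrib_mat) auto
    also have "A i * (h * A i) = A i * h * A i"
      using c by (intro assoc_mult_mat[symmetric]) auto
    also have "A i * e (Suc i) - A i * h * A i = 0\<^sub>m (r i) (r (Suc i))"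
      unfolding hA comm using c by (intro minus_r_inv_mat mult_carrier_mat) auto
    finally have "A i * (e (Suc i) - h * A i) = 0\<^sub>m (r i) (r (Suc i))" .
    with graded_mat_diff[OF e graded_mat_mult[OF h gr]]
    obtain h' where h': "graded_mat (r (Suc (Suc i))) (a (Suc (Suc i))) (r (Suc i)) (a (Suc i)) h'"
      "A (Suc i) * h' = e (Suc i) - h * A i"
      by (rule lift)
    note c' = c graded_mat_carrier[OF h'(1)]
    have "A (Suc i) * h' * A (Suc i) = e (Suc i) * A (Suc i) - h * A i * A (Suc i)"
      unfolding h'(2) using c' by (intro minus_mult_distrib_mat) auto
    also have "h * A i * A (Suc i) = h * (A i * A (Suc i))"
      using c' by (intro assoc_mult_mat) auto
    also have "\<dots> = 0\<^sub>m (r (Suc i)) (r (Suc (Suc i)))"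
      using c' by (simp add: A_A)
    also have "e (Suc i) * A (Suc i) - \<dots> = e (Suc i) * A (Suc i)"
      using c' by auto
    finally show "\<exists>h'. ?P (Suc i) h' \<and> ?Q i h h'" using h' by auto
  qed
  then obtain h where h: "\<forall>i. ?P i (h i) \<and> ?Q i (h i) (h (Suc i))" ..
  show thesis by (rule that[of h]) (use h in auto)
qed

end

text \<open>By \<open>im\<close>, \<open>f0\<close> induces a map between the cokernels of
  \<open>A 0\<close> and \<open>B 0\<close>; it extends along the sequences because the target is
  exact.\<close>

lemma chain_map_lift:
  assumes F: "graded_exact_sequence r a A" and G: "graded_exact_sequence r' a' B"
    and f0: "graded_mat (r' 0) (a' 0) (r 0) (a 0) f0"
    and im: "\<And>q. q < r (Suc 0) \<Longrightarrow> col (f0 * A 0) q \<in> (\<lambda>y. B 0 *\<^sub>v y) ` carrier_vec (r' (Suc 0))"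
  obtains f where "f 0 = f0" "\<And>i. graded_mat (r' i) (a' i) (r i) (a i) (f i)"
    "\<And>i. f i * A i = B i * f (Suc i)"
proof -
  interpret F: graded_exact_sequence r a A by fact
  interpret G: graded_exact_sequence r' a' B by fact
  \<comment> \<open>The invariant contains one further lift, since dependent choice has to know that
    the map chosen now can be continued.\<close>
  let ?P = "\<lambda>i f. graded_mat (r' i) (a' i) (r i) (a i) f \<and>
      (\<exists>f'. graded_mat (r' (Suc i)) (a' (Suc i)) (r (Suc i)) (a (Suc i)) f' \<and> f * A i = B i * f') \<and>
      (i = 0 \<longrightarrow> f = f0)"
  let ?Q = "\<lambda>i f f'. f * A i = B i * f'"
  have "\<exists>f. \<forall>i. ?P i (f i) \<and> ?Q i (f i) (f (Suc i))"
  proof (rule dependent_nat_choice)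
    obtain f' where "graded_mat (r' (Suc 0)) (a' (Suc 0)) (r (Suc 0)) (a (Suc 0)) f'" "B 0 * f' = f0 * A 0"
      using graded_mat_lift[OF G.gr graded_mat_mult[OF f0 F.gr] im] by blast
    with f0 show "\<exists>f. ?P 0 f" by (auto intro!: exI[of _ f0] exI[of _ f'])
  next
    fix f i assume "?P i f"
    then obtain f' where f: "graded_mat (r' i) (a' i) (r i) (a i) f"
      and f': "graded_mat (r' (Suc i)) (a' (Suc i)) (r (Suc i)) (a (Suc i)) f'" "f * A i = B i * f'"
      by auto
    note c = graded_mat_carrier[OF f] graded_mat_carrier[OF f'(1)] F.carrier[of i] G.carrier[of i]
      F.carrier[of "Suc i"] G.carrier[of "Suc i"]
    have "B i * (f' * A (Suc i)) = B i * f' * A (Suc i)"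
      using c by (intro assoc_mult_mat[symmetric]) auto
    also have "\<dots> = f * (A i * A (Suc i))"
      unfolding f'(2)[symmetric] using c by (intro assoc_mult_mat) auto
    also have "\<dots> = 0\<^sub>m (r' i) (r (Suc (Suc i)))"
      using c by (simp add: F.A_A)
    finally obtain f'' where
      "graded_mat (r' (Suc (Suc i))) (a' (Suc (Suc i))) (r (Suc (Suc i))) (a (Suc (Suc i))) f''"
      "B (Suc i) * f'' = f' * A (Suc i)"
      using G.lift[OF graded_mat_mult[OF f'(1) F.gr]] by blast
    then show "\<exists>f'. ?P (Suc i) f' \<and> ?Q i f f'" using f' by (metis nat.distinct(1))
  qed
  then obtain f where f: "\<forall>i. ?P i (f i) \<and> ?Q i (f i) (f (Suc i))" ..
  show thesis by (rule that[of f]) (use f in auto)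
qed

section \<open>Reduction modulo the variables\<close>

interpretation const_coeff: comm_ring_hom "\<lambda>f :: ('v, 'k::field) mpoly. Poly_Mapping.lookup f 0"
proof
  fix f g :: "('v, 'k) mpoly"
  have "Poly_Mapping.lookup (f * g) 0 =
      (\<Sum>l. Poly_Mapping.lookup f l * (\<Sum>q. Poly_Mapping.lookup g q when 0 = l + q))"
    by (simp add: lookup_mult)
  also have "(\<lambda>l. (\<Sum>q. Poly_Mapping.lookup g q when 0 = l + q)) =
      (\<lambda>l. Poly_Mapping.lookup g 0 when l = (0 :: 'v \<Rightarrow>\<^sub>0 nat))"
  proof
    fix l :: "'v \<Rightarrow>\<^sub>0 nat"
    have "(0 = l + q) \<longleftrightarrow> l = 0 \<and> q = 0" for q
      by (auto simp: poly_mapping_eq_iff fun_eq_iff lookup_add)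
    then have "(\<lambda>q. Poly_Mapping.lookup g q when 0 = l + q) =
        (\<lambda>q. (Poly_Mapping.lookup g q when l = 0) when q = 0)"
      by (auto simp: fun_eq_iff when_def)
    then show "(\<Sum>q. Poly_Mapping.lookup g q when 0 = l + q) = (Poly_Mapping.lookup g 0 when l = 0)"
      by (simp only: Sum_any_when_equal)
  qed
  finally show "Poly_Mapping.lookup (f * g) 0 = Poly_Mapping.lookup f 0 * Poly_Mapping.lookup g 0"
    by (simp add: mult_when)
qed (auto simp: lookup_add lookup_one)

abbreviation const_mat :: "('v, 'k::field) mpoly mat \<Rightarrow> 'k mat" where
  "const_mat \<equiv> map_mat (\<lambda>f. Poly_Mapping.lookup f 0)"

lemma const_mat_add:
  "X \<in> carrier_mat n m \<Longrightarrow> Y \<in> carrier_mat n m \<Longrightarrow> const_mat (X + Y) = const_mat X + const_mat Y"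
  by (intro eq_matI) (auto simp: lookup_add)

text \<open>The counterpart of \<open>chains_k\<close> for data that are not packed into a
  \<open>free_complex\<close>; \<open>cycles\<close> and \<open>boundaries\<close> below stand in
  the same relation to \<open>cycles_k\<close> and \<open>boundaries_k\<close>.\<close>

definition graded_vec :: "nat \<Rightarrow> (nat \<Rightarrow> int) \<Rightarrow> int \<Rightarrow> 'k::field vec set" where
  "graded_vec r a j = {x \<in> carrier_vec r. \<forall>p<r. x $ p \<noteq> 0 \<longrightarrow> a p = j}"

lemma graded_vec_diff: "x \<in> graded_vec r a j \<Longrightarrow> y \<in> graded_vec r a j \<Longrightarrow> x - y \<in> graded_vec r a j"
  by (auto simp: graded_vec_def)

text \<open>A nonzero constant term forces an entry of \<open>X\<close> to have degree 0, so the
  shifts of its row and its column agree.\<close>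

lemma const_mat_graded_vec:
  assumes X: "graded_mat r a c b X" and x: "x \<in> graded_vec c b j"
  shows "const_mat X *\<^sub>v x \<in> graded_vec r a j"
  unfolding graded_vec_def
proof (intro CollectI conjI allI impI)
  show "const_mat X *\<^sub>v x \<in> carrier_vec r" using X x
    by (intro mult_mat_vec_carrier[of _ r c]) (auto simp: graded_mat_def graded_vec_def)
  fix p assume p: "p < r" and nz: "(const_mat X *\<^sub>v x) $ p \<noteq> 0"
  have "(const_mat X *\<^sub>v x) $ p = (\<Sum>q\<in>{0..<c}. Poly_Mapping.lookup (X $$ (p, q)) 0 * x $ q)"
    using X x p by (auto simp: graded_mat_def graded_vec_def scalar_prod_def)
  with nz obtain q where q: "q < c" "Poly_Mapping.lookup (X $$ (p, q)) 0 * x $ q \<noteq> 0"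
    by (metis (no_types, lifting) atLeastLessThan_iff sum.neutral)
  then have "b q = j" using x by (auto simp: graded_vec_def)
  moreover have "b q - a p = 0"
    using q X p forms_const_zero[of "X $$ (p, q)" "b q - a p"] by (auto simp: graded_mat_def)
  ultimately show "a p = j" by simp
qed


context graded_exact_sequence
begin

definition cycles :: "nat \<Rightarrow> int \<Rightarrow> 'k vec set" where
  "cycles i j = {x \<in> graded_vec (r i) (a i) j. \<forall>h. i = Suc h \<longrightarrow> const_mat (A h) *\<^sub>v x = 0\<^sub>v (r h)}"

definition boundaries :: "nat \<Rightarrow> int \<Rightarrow> 'k vec set" where
  "boundaries i j = (\<lambda>x. const_mat (A i) *\<^sub>v x) ` graded_vec (r (Suc i)) (a (Suc i)) j"

lemma const_A_A: "const_mat (A i) * const_mat (A (Suc i)) = 0\<^sub>m (r i) (r (Suc (Suc i)))"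
  by (subst const_coeff.mat_hom_mult[OF carrier carrier, symmetric]) (auto simp: A_A)

lemma boundaries_subset_cycles: "boundaries i j \<subseteq> cycles i j"
proof
  fix y assume "y \<in> boundaries i j"
  then obtain x where x: "x \<in> graded_vec (r (Suc i)) (a (Suc i)) j" and y: "y = const_mat (A i) *\<^sub>v x"
    by (auto simp: boundaries_def)
  have "const_mat (A h) *\<^sub>v y = 0\<^sub>v (r h)" if "i = Suc h" for h
  proof -
    have "const_mat (A h) *\<^sub>v y = (const_mat (A h) * const_mat (A (Suc h))) *\<^sub>v x"
      unfolding y that using x that
      by (intro assoc_mult_mat_vec[symmetric, of _ "r h" "r (Suc h)" _ "r (Suc (Suc h))"])
        (auto simp: graded_vec_def)
    also have "\<dots> = 0\<^sub>v (r h)"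
      unfolding const_A_A using x that by (auto simp: graded_vec_def)
    finally show ?thesis .
  qed
  then show "y \<in> cycles i j"
    using const_mat_graded_vec[OF gr x] by (auto simp: cycles_def y)
qed

end

text \<open>If \<open>f z\<close> is the boundary of \<open>u\<close>, then \<open>z\<close> is the
  boundary of \<open>g u - h z\<close>, where \<open>h\<close> is a homotopy between
  \<open>g f\<close> and the identity. One composite is enough for this direction; exchanging the
  two resolutions gives the other.\<close>

lemma cycles_ne_boundaries_transfer:
  assumes F: "graded_exact_sequence r a A" and G: "graded_exact_sequence r' a' B"
    and f0: "graded_mat (r' 0) (a' 0) (r 0) (a 0) f0"
    and imf: "\<And>q. q < r (Suc 0) \<Longrightarrow> col (f0 * A 0) q \<in> (\<lambda>y. B 0 *\<^sub>v y) ` carrier_vec (r' (Suc 0))"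
    and g0: "graded_mat (r 0) (a 0) (r' 0) (a' 0) g0"
    and img: "\<And>q. q < r' (Suc 0) \<Longrightarrow> col (g0 * B 0) q \<in> (\<lambda>y. A 0 *\<^sub>v y) ` carrier_vec (r (Suc 0))"
    and h0: "\<And>q. q < r 0 \<Longrightarrow> col (g0 * f0 - 1\<^sub>m (r 0)) q \<in> (\<lambda>y. A 0 *\<^sub>v y) ` carrier_vec (r (Suc 0))"
    and ne: "graded_exact_sequence.cycles r a A i j \<noteq> graded_exact_sequence.boundaries r a A i j"
  shows "graded_exact_sequence.cycles r' a' B i j \<noteq> graded_exact_sequence.boundaries r' a' B i j"
proof
  interpret F: graded_exact_sequence r a A by fact
  interpret G: graded_exact_sequence r' a' B by fact
  obtain f where f: "f 0 = f0" "\<And>i. graded_mat (r' i) (a' i) (r i) (a i) (f i)"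
    "\<And>i. f i * A i = B i * f (Suc i)"
    using chain_map_lift[OF F G f0 imf] by blast
  obtain g where g: "g 0 = g0" "\<And>i. graded_mat (r i) (a i) (r' i) (a' i) (g i)"
    "\<And>i. g i * B i = A i * g (Suc i)"
    using chain_map_lift[OF G F g0 img] by blast
  note fc [simp] = graded_mat_carrier[OF f(2)] and gc [simp] = graded_mat_carrier[OF g(2)]
  \<comment> \<open>By \<open>h0\<close> this endomorphism is zero on the cokernel of
    \<open>A 0\<close>, so it is homotopic to zero.\<close>
  define e where "e i = g i * f i - 1\<^sub>m (r i)" for i
  have e: "graded_mat (r i) (a i) (r i) (a i) (e i)" for i
    unfolding e_def by (intro graded_mat_diff graded_mat_mult[OF g(2) f(2)] graded_mat_one)
  note ec [simp] = graded_mat_carrier[OF e]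
  have comm: "e i * A i = A i * e (Suc i)" for i
  proof -
    have "e i * A i = g i * f i * A i - A i"
      unfolding e_def by (subst minus_mult_distrib_mat[of _ "r i" "r i"])
        (auto intro: mult_carrier_mat[OF gc fc] simp: left_mult_one_mat[OF F.carrier])
    also have "g i * f i * A i = g i * (B i * f (Suc i))"
      by (subst assoc_mult_mat[OF gc fc F.carrier]) (simp add: f(3))
    also have "\<dots> = A i * g (Suc i) * f (Suc i)"
      by (subst assoc_mult_mat[OF gc G.carrier fc, symmetric]) (simp add: g(3))
    also have "\<dots> = A i * (g (Suc i) * f (Suc i))"
      by (rule assoc_mult_mat[OF F.carrier gc fc])
    also have "A i * (g (Suc i) * f (Suc i)) - A i = A i * e (Suc i)"
      unfolding e_def by (subst mult_minus_distrib_mat[of _ "r i" "r (Suc i)" _ "r (Suc i)"])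
        (auto intro: mult_carrier_mat[OF gc fc] simp: right_mult_one_mat[OF F.carrier])
    finally show ?thesis .
  qed
  have e0: "col (e 0) q \<in> (\<lambda>y. A 0 *\<^sub>v y) ` carrier_vec (r (Suc 0))" if "q < r 0" for q
    using h0[OF that] by (simp add: e_def f g)
  obtain h where h: "\<And>i. graded_mat (r (Suc i)) (a (Suc i)) (r i) (a i) (h i)"
    "A 0 * h 0 = e 0" "\<And>i. A (Suc i) * h (Suc i) = e (Suc i) - h i * A i"
    using F.null_homotopy[OF e comm e0] by blast
  note hc [simp] = graded_mat_carrier[OF h(1)]
  assume eq: "G.cycles i j = G.boundaries i j"
  have "F.cycles i j \<subseteq> F.boundaries i j"
  proof
    fix z assume z: "z \<in> F.cycles i j"
    then have zg: "z \<in> graded_vec (r i) (a i) j" and z0: "\<And>l. i = Suc l \<Longrightarrow> const_mat (A l) *\<^sub>v z = 0\<^sub>v (r l)"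
      by (auto simp: F.cycles_def)
    have zc [simp]: "z \<in> carrier_vec (r i)" using zg by (simp add: graded_vec_def)
    have "const_mat (f i) *\<^sub>v z \<in> G.cycles i j"
      unfolding G.cycles_def
    proof (intro CollectI conjI allI impI)
      show "const_mat (f i) *\<^sub>v z \<in> graded_vec (r' i) (a' i) j"
        by (rule const_mat_graded_vec[OF f(2) zg])
      fix l assume l: "i = Suc l"
      have "const_mat (B l) *\<^sub>v (const_mat (f i) *\<^sub>v z) = (const_mat (B l) * const_mat (f i)) *\<^sub>v z"
        unfolding l using zc[unfolded l]
          by (intro assoc_mult_mat_vec[symmetric, of _ "r' l" "r' (Suc l)" _ "r (Suc l)"]) auto
      also have "const_mat (B l) * const_mat (f i) = const_mat (f l * A l)"
        unfolding l f(3) by (rule const_coeff.mat_hom_mult[OF G.carrier fc, symmetric])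
      also have "\<dots> = const_mat (f l) * const_mat (A l)"
        by (rule const_coeff.mat_hom_mult[OF fc F.carrier])
      also have "\<dots> *\<^sub>v z = const_mat (f l) *\<^sub>v (const_mat (A l) *\<^sub>v z)"
        using zc[unfolded l] by (intro assoc_mult_mat_vec[of _ "r' l" "r l" _ "r (Suc l)"]) auto
      also have "\<dots> = 0\<^sub>v (r' l)"
        using z0[OF l] carrier_matD(2)[OF fc[of l]] carrier_matD(1)[OF fc[of l]]
        by (auto intro!: eq_vecI simp: scalar_prod_def)
      finally show "const_mat (B l) *\<^sub>v (const_mat (f i) *\<^sub>v z) = 0\<^sub>v (r' l)" .
    qed
    then obtain u where u: "u \<in> graded_vec (r' (Suc i)) (a' (Suc i)) j"
      and fz: "const_mat (f i) *\<^sub>v z = const_mat (B i) *\<^sub>v u"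
      unfolding eq G.boundaries_def by auto
    have uc [simp]: "u \<in> carrier_vec (r' (Suc i))" using u by (simp add: graded_vec_def)
    let ?u = "const_mat (g (Suc i)) *\<^sub>v u" and ?v = "const_mat (h i) *\<^sub>v z"
    have u': "?u \<in> graded_vec (r (Suc i)) (a (Suc i)) j"
      by (rule const_mat_graded_vec[OF g(2) u])
    have v': "?v \<in> graded_vec (r (Suc i)) (a (Suc i)) j"
      by (rule const_mat_graded_vec[OF h(1) zg])
    have gfz: "const_mat (g i * f i) *\<^sub>v z = const_mat (A i) *\<^sub>v ?u"
    proof -
      have "const_mat (g i * f i) *\<^sub>v z = const_mat (g i) *\<^sub>v (const_mat (f i) *\<^sub>v z)"
        unfolding const_coeff.mat_hom_mult[OF gc fc]
        by (rule assoc_mult_mat_vec[of _ "r i" "r' i" _ "r i"]) auto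
      also have "\<dots> = (const_mat (g i) * const_mat (B i)) *\<^sub>v u"
        unfolding fz by (rule assoc_mult_mat_vec[symmetric, of _ "r i" "r' i" _ "r' (Suc i)"]) auto
      also have "const_mat (g i) * const_mat (B i) = const_mat (A i) * const_mat (g (Suc i))"
        by (simp add: const_coeff.mat_hom_mult[OF gc G.carrier, symmetric] g(3)
            const_coeff.mat_hom_mult[OF F.carrier gc, symmetric])
      also have "\<dots> *\<^sub>v u = const_mat (A i) *\<^sub>v ?u"
        by (rule assoc_mult_mat_vec[of _ "r i" "r (Suc i)" _ "r' (Suc i)"]) auto
      finally show ?thesis .
    qed
    \<comment> \<open>The other part of the homotopy formula, \<open>h l * A l\<close>, kills
      \<open>z\<close> because \<open>z\<close> is a cycle; in degree 0 there is no such
      part.\<close>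
    have "const_mat (e i) *\<^sub>v z = const_mat (A i) *\<^sub>v ?v"
    proof (cases i)
      case 0
      have "const_mat (e i) *\<^sub>v z = (const_mat (A i) * const_mat (h i)) *\<^sub>v z"
        using h(2) const_coeff.mat_hom_mult[OF F.carrier hc, of 0] 0 by simp
      also have "\<dots> = const_mat (A i) *\<^sub>v ?v"
        by (rule assoc_mult_mat_vec[of _ "r i" "r (Suc i)" _ "r i"]) auto
      finally show ?thesis .
    next
      case (Suc l)
      have zl: "z \<in> carrier_vec (r (Suc l))" using zc Suc by simp
      have "e (Suc l) = A (Suc l) * h (Suc l) + h l * A l"
        unfolding h(3) using carrier_matD[OF ec[of "Suc l"]] carrier_matD[OF hc[of l]]
        by (auto intro!: eq_matI)
      then have "const_mat (e i) *\<^sub>v z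
          = (const_mat (A i) * const_mat (h i) + const_mat (h l) * const_mat (A l)) *\<^sub>v z"
        unfolding Suc
        by (simp add: const_coeff.mat_hom_mult[OF F.carrier hc, symmetric]
            const_coeff.mat_hom_mult[OF hc F.carrier, symmetric]
            const_mat_add[OF mult_carrier_mat[OF F.carrier hc] mult_carrier_mat[OF hc F.carrier]])
      also have "\<dots> = (const_mat (A i) * const_mat (h i)) *\<^sub>v z + (const_mat (h l) * const_mat (A l)) *\<^sub>v z"
        unfolding Suc using zl
        by (intro add_mult_distrib_mat_vec[of _ "r (Suc l)" "r (Suc l)"] mult_carrier_mat) auto
      also have "(const_mat (h l) * const_mat (A l)) *\<^sub>v z = const_mat (h l) *\<^sub>v (const_mat (A l) *\<^sub>v z)"
        using zl by (intro assoc_mult_mat_vec[of _ "r (Suc l)" "r l" _ "r (Suc l)"]) auto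
      also have "\<dots> = 0\<^sub>v (r (Suc l))"
        using z0[OF Suc] carrier_matD(2)[OF hc[of l]] carrier_matD(1)[OF hc[of l]]
        by (auto intro!: eq_vecI simp: scalar_prod_def)
      also have "(const_mat (A i) * const_mat (h i)) *\<^sub>v z = const_mat (A i) *\<^sub>v ?v"
        by (rule assoc_mult_mat_vec[of _ "r i" "r (Suc i)" _ "r i"]) auto
      finally show ?thesis using Suc carrier_matD[OF hc[of i]] zl
        by (subst (asm) right_zero_vec)
          (auto intro!: mult_mat_vec_carrier[of _ "r (Suc l)" "r (Suc (Suc l))"]
            mult_mat_vec_carrier[of _ "r (Suc (Suc l))" "r (Suc l)"])
    qed
    moreover have "const_mat (e i) *\<^sub>v z = const_mat (g i * f i) *\<^sub>v z - z"
    proof -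
      have "const_mat (e i) = const_mat (g i * f i) - 1\<^sub>m (r i)"
        unfolding e_def using carrier_matD[OF gc[of i]] carrier_matD[OF fc[of i]]
        by (intro eq_matI) (auto simp: lookup_minus lookup_one)
      then have "const_mat (e i) *\<^sub>v z = const_mat (g i * f i) *\<^sub>v z - 1\<^sub>m (r i) *\<^sub>v z"
        using mult_carrier_mat[OF gc fc, of i] by (simp add: minus_mult_distrib_mat_vec[of _ "r i" "r i"])
      then show ?thesis by simp
    qed
    ultimately have ze: "const_mat (A i) *\<^sub>v ?u - z = const_mat (A i) *\<^sub>v ?v"
      by (simp add: gfz)
    have "z = const_mat (A i) *\<^sub>v ?u - const_mat (A i) *\<^sub>v ?v"
      unfolding ze[symmetric] using carrier_vecD[OF zc] by (intro eq_vecI) auto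
    also have "\<dots> = const_mat (A i) *\<^sub>v (?u - ?v)"
      using u' v' by (intro mult_minus_distrib_mat_vec[symmetric, of _ "r i" "r (Suc i)"])
        (auto simp: graded_vec_def)
    finally show "z \<in> F.boundaries i j"
      using graded_vec_diff[OF u' v'] by (auto simp: F.boundaries_def)
  qed
  with F.boundaries_subset_cycles[of i j] ne show False by auto
qed

section \<open>Resolutions of cyclic modules\<close>

lemma class_ideal_simps:
  fixes I :: "'a::comm_ring_1 set"
  assumes "ideal I class_ring"
  shows class_ideal_zero: "0 \<in> I"
    and class_ideal_add: "x \<in> I \<Longrightarrow> y \<in> I \<Longrightarrow> x + y \<in> I"
    and class_ideal_mult: "x \<in> I \<Longrightarrow> c * x \<in> I"
    and class_ideal_uminus: "x \<in> I \<Longrightarrow> - x \<in> I"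
    and class_ideal_diff: "x \<in> I \<Longrightarrow> y \<in> I \<Longrightarrow> x - y \<in> I"
proof -
  interpret ideal I "class_ring :: 'a ring" by fact
  show "0 \<in> I" using additive_subgroup.zero_closed[OF is_additive_subgroup] by simp
  show add: "x + y \<in> I" if "x \<in> I" "y \<in> I" for x y
    using additive_subgroup.a_closed[OF is_additive_subgroup] that by simp
  show mult: "c * x \<in> I" if "x \<in> I" for c x using I_l_closed[of x c] that by simp
  show "- x \<in> I" if "x \<in> I" for x using mult[of x "-1"] that by simp
  then show "x - y \<in> I" if "x \<in> I" "y \<in> I" for x y using add[of x "- y"] that by simp
qed

text \<open>The row \<open>R\<close> lifts the augmentation onto \<open>S/I\<close> to a map into \<open>S\<close>.\<close>
definition presents_cyclic ::
    "('v, 'k::field) mpoly set \<Rightarrow> (nat \<Rightarrow> nat) \<Rightarrow> (nat \<Rightarrow> nat \<Rightarrow> int) \<Rightarrow> (nat \<Rightarrow> ('v, 'k) mpoly mat)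
      \<Rightarrow> ('v, 'k) mpoly mat \<Rightarrow> bool" where
  "presents_cyclic I r a A R \<longleftrightarrow>
     graded_exact_sequence r a A \<and> graded_mat 1 (\<lambda>_. 0) (r 0) (a 0) R \<and>
     {x \<in> carrier_vec (r 0). (R *\<^sub>v x) $ 0 \<in> I} = (\<lambda>x. A 0 *\<^sub>v x) ` carrier_vec (r 1) \<and>
     (\<exists>x\<in>carrier_vec (r 0). (R *\<^sub>v x) $ 0 - 1 \<in> I)"

lemma forms_one: "1 \<in> forms 0"
  by (auto simp: forms_def mdegree_def)

text \<open>As \<open>I\<close> is homogeneous, any preimage of the class of 1 may be replaced by
  its part of degree 0. The comparison maps start from this \<open>u\<close>.\<close>

lemma presents_cyclic_unit:
  assumes P: "presents_cyclic I r a A R" and hom: "\<And>f j. f \<in> I \<Longrightarrow> hom_comp j f \<in> I"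
  obtains u where "graded_mat (r 0) (a 0) 1 (\<lambda>_. 0) u" "(R * u) $$ (0, 0) - 1 \<in> I"
proof -
  have R: "graded_mat 1 (\<lambda>_. 0) (r 0) (a 0) R" using P by (simp add: presents_cyclic_def)
  note Rc = graded_mat_carrier[OF R]
  obtain x where x: "x \<in> carrier_vec (r 0)" "(R *\<^sub>v x) $ 0 - 1 \<in> I"
    using P by (auto simp: presents_cyclic_def)
  define u where "u = mat (r 0) 1 (\<lambda>(i, _). hom_comp (- a 0 i) (x $ i))"
  have "(R * u) $$ (0, 0) = (R *\<^sub>v vec (r 0) (\<lambda>i. hom_comp (0 - a 0 i) (x $ i))) $ 0"
    using Rc by (simp add: u_def scalar_prod_def)
  also have "\<dots> = hom_comp 0 ((R *\<^sub>v x) $ 0)"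
    using graded_mat_hom_comp[OF R x(1), of 0 0] by simp
  finally have "(R * u) $$ (0, 0) - 1 = hom_comp 0 ((R *\<^sub>v x) $ 0 - 1)"
    by (simp add: hom_comp_diff hom_comp_of_forms[OF forms_one])
  with hom[OF x(2)] show thesis
    by (intro that[of u]) (auto simp: graded_mat_def u_def)
qed

text \<open>Turns every condition on comparison maps in degree 0 into a congruence modulo
  \<open>I\<close>, seen after multiplication by \<open>R\<close>.\<close>

lemma presents_cyclic_image:
  assumes P: "presents_cyclic I r a A R" and X: "X \<in> carrier_mat (r 0) m" and q: "q < m"
  shows "col X q \<in> (\<lambda>x. A 0 *\<^sub>v x) ` carrier_vec (r (Suc 0)) \<longleftrightarrow> (R * X) $$ (0, q) \<in> I"
proof -
  have R: "R \<in> carrier_mat 1 (r 0)" using P by (auto simp: presents_cyclic_def graded_mat_def)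
  have "(R * X) $$ (0, q) = (R *\<^sub>v col X q) $ 0"
    using R X q by simp
  moreover have "col X q \<in> carrier_vec (r 0)" using X q by (auto intro: col_carrier_vec)
  ultimately show ?thesis using P by (auto simp: presents_cyclic_def)
qed

text \<open>\<open>u' * R\<close> and \<open>u * R'\<close> both induce the identity of
  \<open>S/I\<close>: each passes to a representative of the class by \<open>R\<close> or
  \<open>R'\<close> and returns over the class of 1 in the other resolution.\<close>

lemma presents_cyclic_transfer:
  assumes I: "ideal I class_ring" and hom: "\<And>f j. f \<in> I \<Longrightarrow> hom_comp j f \<in> I"
    and P: "presents_cyclic I r a A R" and P': "presents_cyclic I r' a' B R'"
    and ne: "graded_exact_sequence.cycles r a A i j \<noteq> graded_exact_sequence.boundaries r a A i j"
  shows "graded_exact_sequence.cycles r' a' B i j \<noteq> graded_exact_sequence.boundaries r' a' B i j"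
proof -
  note Icl = class_ideal_simps[OF I]
  obtain u where u: "graded_mat (r 0) (a 0) 1 (\<lambda>_. 0) u" "(R * u) $$ (0, 0) - 1 \<in> I"
    by (rule presents_cyclic_unit[OF P hom])
  obtain u' where u': "graded_mat (r' 0) (a' 0) 1 (\<lambda>_. 0) u'" "(R' * u') $$ (0, 0) - 1 \<in> I"
    by (rule presents_cyclic_unit[OF P' hom])
  have F: "graded_exact_sequence r a A" and G: "graded_exact_sequence r' a' B"
    and R: "graded_mat 1 (\<lambda>_. 0) (r 0) (a 0) R" and R': "graded_mat 1 (\<lambda>_. 0) (r' 0) (a' 0) R'"
    using P P' by (auto simp: presents_cyclic_def)
  interpret F: graded_exact_sequence r a A by fact
  interpret G: graded_exact_sequence r' a' B by fact
  note c = graded_mat_carrier[OF u(1)] graded_mat_carrier[OF u'(1)] graded_mat_carrier[OF R]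
    graded_mat_carrier[OF R']
  have mult1: "(X * Y) $$ (0, q) = X $$ (0, 0) * Y $$ (0, q)"
    if "X \<in> carrier_mat 1 1" "Y \<in> carrier_mat 1 m" "q < m" for X Y :: "('a, 'b) mpoly mat" and q m
    using that by (simp add: scalar_prod_def)
  \<comment> \<open>The entries of \<open>Q * C 0\<close> lie in \<open>I\<close>, and multiplying
    them by the scalar \<open>Q' * v\<close> keeps them there.\<close>
  have im: "col (v * Q * C 0) q \<in> (\<lambda>y. D 0 *\<^sub>v y) ` carrier_vec (d (Suc 0))"
    if PD: "presents_cyclic I d b D Q'" and PC: "presents_cyclic I e b' C Q"
      and v: "v \<in> carrier_mat (d 0) 1" and q: "q < e (Suc 0)"
    for v Q Q' C D d e b b' q
  proof -
    interpret C: graded_exact_sequence e b' C using PC by (simp add: presents_cyclic_def)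
    have Q: "Q \<in> carrier_mat 1 (e 0)" and Q': "Q' \<in> carrier_mat 1 (d 0)"
      using PC PD by (auto simp: presents_cyclic_def graded_mat_def)
    note cc = Q Q' v C.carrier[of 0]
    have "col (C 0) q \<in> (\<lambda>y. C 0 *\<^sub>v y) ` carrier_vec (e (Suc 0))"
      using q mult_mat_unit_vec[of q "C 0"] by (auto intro!: image_eqI[of _ _ "unit_vec (e (Suc 0)) q"])
    then have QC: "(Q * C 0) $$ (0, q) \<in> I"
      using presents_cyclic_image[OF PC C.carrier q] by blast
    have "Q' * (v * Q * C 0) = Q' * v * (Q * C 0)"
      using cc by (simp add: assoc_mult_mat[of _ "d 0" 1 _ "e 0" _ "e (Suc 0)"]
          assoc_mult_mat[of _ 1 "d 0" _ 1 _ "e (Suc 0)"])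
    then have "(Q' * (v * Q * C 0)) $$ (0, q) = (Q' * v) $$ (0, 0) * (Q * C 0) $$ (0, q)"
      using mult1[OF mult_carrier_mat[OF Q' v] mult_carrier_mat[OF Q C.carrier] q] by simp
    also have "\<dots> \<in> I" by (rule Icl(3)[OF QC])
    finally show ?thesis
      using cc q by (subst presents_cyclic_image[OF PD, of _ "e (Suc 0)"]) auto
  qed
  show ?thesis
  proof (rule cycles_ne_boundaries_transfer[OF F G, where ?f0.0 = "u' * R" and ?g0.0 = "u * R'"])
    show "graded_mat (r' 0) (a' 0) (r 0) (a 0) (u' * R)" by (rule graded_mat_mult[OF u'(1) R])
    show "graded_mat (r 0) (a 0) (r' 0) (a' 0) (u * R')" by (rule graded_mat_mult[OF u(1) R'])
    show "col (u' * R * A 0) q \<in> (\<lambda>y. B 0 *\<^sub>v y) ` carrier_vec (r' (Suc 0))" if "q < r (Suc 0)" for q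
      by (rule im[OF P' P _ that]) (use c in auto)
    show "col (u * R' * B 0) q \<in> (\<lambda>y. A 0 *\<^sub>v y) ` carrier_vec (r (Suc 0))" if "q < r' (Suc 0)" for q
      by (rule im[OF P P' _ that]) (use c in auto)
    show "col (u * R' * (u' * R) - 1\<^sub>m (r 0)) q \<in> (\<lambda>y. A 0 *\<^sub>v y) ` carrier_vec (r (Suc 0))"
      if q: "q < r 0" for q
    proof (subst presents_cyclic_image[OF P _ q])
      let ?x = "(R * u) $$ (0, 0)" and ?y = "(R' * u') $$ (0, 0)" and ?z = "R $$ (0, q)"
      have cc: "R * u \<in> carrier_mat 1 1" "R' * u' \<in> carrier_mat 1 1"
        "u * R' * (u' * R) \<in> carrier_mat (r 0) (r 0)" "R' * (u' * R) \<in> carrier_mat 1 (r 0)"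
        using c by auto
      have "R * (u * R' * (u' * R) - 1\<^sub>m (r 0)) = R * (u * R' * (u' * R)) - R * 1\<^sub>m (r 0)"
        using c cc by (intro mult_minus_distrib_mat) auto
      also have "R * (u * R' * (u' * R)) = R * (u * (R' * (u' * R)))"
        using c by (simp add: assoc_mult_mat[of u "r 0" 1 R' "r' 0" _ "r 0"])
      also have "\<dots> = R * u * (R' * (u' * R))"
        using c cc by (intro assoc_mult_mat[symmetric]) auto
      also have "R' * (u' * R) = R' * u' * R"
        using c by (intro assoc_mult_mat[symmetric]) auto
      finally have "(R * (u * R' * (u' * R) - 1\<^sub>m (r 0))) $$ (0, q)
          = (R * u * (R' * u' * R)) $$ (0, q) - ?z"
        using c cc q by auto
      also have "(R * u * (R' * u' * R)) $$ (0, q) = ?x * (?y * ?z)"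
        by (simp only: mult1[OF cc(1) mult_carrier_mat[OF cc(2) c(3)] q] mult1[OF cc(2) c(3) q])
      \<comment> \<open>Both \<open>?x\<close> and \<open>?y\<close> are 1 modulo \<open>I\<close>,
        so the difference splits into multiples of \<open>?x - 1\<close> and
        \<open>?y - 1\<close>.\<close>
      also have "?x * (?y * ?z) - ?z = (?y * ?z) * (?x - 1) + ?z * (?y - 1)"
        by (simp add: algebra_simps)
      also have "\<dots> \<in> I" by (intro Icl(2) Icl(3) u(2) u'(2))
      finally show "(R * (u * R' * (u' * R) - 1\<^sub>m (r 0))) $$ (0, q) \<in> I" .
    qed (use c in auto)
  qed (rule ne)
qed

section \<open>From resolutions of S/I to matrices and back\<close>

lemma module_regular: "Module.module class_ring (regular_module :: ('a::comm_ring_1, 'a) module)"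
  by (rule module_criteria)
    (auto simp: regular_module_def class_cring.is_cring algebra_simps intro: exI[of _ "- _"])

lemma submodule_regular:
  fixes I :: "'a::comm_ring_1 set"
  assumes "ideal I class_ring"
  shows "LinearCombinations.submodule class_ring I regular_module"
  using module_regular class_ideal_simps[OF assms]
  by (auto simp: LinearCombinations.submodule_def regular_module_def)

lemma regular_coset_eq_iff:
  fixes I :: "'a::comm_ring_1 set"
  assumes "ideal I class_ring"
  shows "I +>\<^bsub>regular_module\<^esub> f = I +>\<^bsub>regular_module\<^esub> g \<longleftrightarrow> f - g \<in> I"
proof -
  note Icl = class_ideal_simps[OF assms]
  have co: "I +>\<^bsub>regular_module\<^esub> f = {x. x - f \<in> I}" for f
    by (auto simp: a_r_coset_def' regular_module_def)
  show ?thesis unfolding co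
  proof
    assume "{x. x - f \<in> I} = {x. x - g \<in> I}"
    moreover have "f \<in> {x. x - f \<in> I}" using Icl(1) by simp
    ultimately show "f - g \<in> I" by auto
  next
    assume fg: "f - g \<in> I"
    have "x - f \<in> I \<longleftrightarrow> x - g \<in> I" for x
      using Icl(2)[OF fg, of "x - f"] Icl(5)[OF _ fg, of "x - g"] by (auto simp: algebra_simps)
    then show "{x. x - f \<in> I} = {x. x - g \<in> I}" by simp
  qed
qed

text \<open>Homogeneous representatives of the classes \<open>aug F\<close> assigns to the basis
  vectors form the row \<open>R\<close>; by linearity \<open>aug F x\<close> is then the class of
  \<open>R\<close> applied to \<open>x\<close>.\<close>

lemma graded_free_resolution_presents:
  assumes I: "ideal I class_ring"
    and res: "graded_free_resolution (cyclic_module I) (cyclic_grading I) F"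
  obtains R where "presents_cyclic I (rk F) (shift F) (bd F) R"
proof -
  let ?c = "\<lambda>f. I +>\<^bsub>regular_module\<^esub> f" and ?r = "rk F 0"
  interpret quotient class_ring regular_module I
    by (simp add: quotient_def module_regular submodule_regular[OF I])
  note Icl = class_ideal_simps[OF I]
  have hom: "aug F \<in> LinearCombinations.module_hom class_ring (module_vec TYPE(('a, 'b) mpoly) ?r) Q"
    using res by (simp add: graded_free_resolution_def cyclic_module_def)
  have UN: "x \<in> carrier regular_module" for x :: "('a, 'b) mpoly"
    by (simp add: regular_module_def)
  have c_add: "?c f \<oplus>\<^bsub>Q\<^esub> ?c g = ?c (f + g)" for f g
    using add_Q[OF UN UN, of f g] by (simp add: regular_module_def)
  have c_smult: "f \<odot>\<^bsub>Q\<^esub> ?c g = ?c (f * g)" for f g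
    using smult_Q[OF _ UN, of f g] by (simp add: regular_module_def)
  have aug_add: "aug F (x + y) = aug F x \<oplus>\<^bsub>Q\<^esub> aug F y" if "x \<in> carrier_vec ?r" "y \<in> carrier_vec ?r" for x y
    using hom that by (auto simp: LinearCombinations.module_hom_def module_vec_simps)
  have aug_smult: "aug F (f \<cdot>\<^sub>v x) = f \<odot>\<^bsub>Q\<^esub> aug F x" if "x \<in> carrier_vec ?r" for f x
    using hom that by (auto simp: LinearCombinations.module_hom_def module_vec_simps)
  \<comment> \<open>\<open>cyclic_grading\<close> forms its cosets in \<open>class_ring\<close>;
    unfolded, they are the cosets of \<open>regular_module\<close>.\<close>
  have "\<forall>p. \<exists>f. p < ?r \<longrightarrow> f \<in> forms (shift F 0 p) \<and> aug F (unit_vec ?r p) = ?c f"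
    using res by (fastforce simp: graded_free_resolution_def cyclic_grading_def a_r_coset_def'
        regular_module_def)
  then obtain f where f: "\<And>p. p < ?r \<Longrightarrow> f p \<in> forms (shift F 0 p)"
    "\<And>p. p < ?r \<Longrightarrow> aug F (unit_vec ?r p) = ?c (f p)" by metis
  define R where "R = mat 1 ?r (\<lambda>(_, p). f p)"
  have Rx: "(R *\<^sub>v x) $ 0 = (\<Sum>p\<in>{0..<?r}. f p * x $ p)" if "x \<in> carrier_vec ?r" for x
    using that by (simp add: R_def scalar_prod_def)
  \<comment> \<open>Linearity of \<open>aug F\<close> is given for two summands and for scalars, so
    a vector is assembled one coordinate at a time.\<close>
  have part: "aug F (vec ?r (\<lambda>i. if i < k then x $ i else 0)) = ?c (\<Sum>p\<in>{0..<k}. f p * x $ p)"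
    if "k \<le> ?r" for x k
    using that
  proof (induction k)
    case 0
    have "aug F (0\<^sub>v ?r) = aug F (0 \<cdot>\<^sub>v 0\<^sub>v ?r)"
      by (intro arg_cong[of _ _ "aug F"] eq_vecI) auto
    also have "\<dots> = 0 \<odot>\<^bsub>Q\<^esub> aug F (0\<^sub>v ?r)" by (rule aug_smult) simp
    also have "\<dots> = ?c 0"
    proof -
      have "aug F (0\<^sub>v ?r) \<in> carrier Q"
        using hom by (auto simp: LinearCombinations.module_hom_def module_vec_simps)
      then obtain g where "aug F (0\<^sub>v ?r) = ?c g" by (auto simp: carrier_Q)
      then show ?thesis by (simp add: c_smult)
    qed
    finally show ?case by (simp add: zero_vec_def)
  next
    case (Suc k)
    have "vec ?r (\<lambda>i. if i < Suc k then x $ i else 0)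
        = vec ?r (\<lambda>i. if i < k then x $ i else 0) + x $ k \<cdot>\<^sub>v unit_vec ?r k"
      using Suc.prems by (intro eq_vecI) (auto simp: less_Suc_eq)
    then have "aug F (vec ?r (\<lambda>i. if i < Suc k then x $ i else 0))
        = aug F (vec ?r (\<lambda>i. if i < k then x $ i else 0)) \<oplus>\<^bsub>Q\<^esub> aug F (x $ k \<cdot>\<^sub>v unit_vec ?r k)"
      by (simp add: aug_add)
    also have "aug F (x $ k \<cdot>\<^sub>v unit_vec ?r k) = ?c (x $ k * f k)"
      using Suc.prems by (simp add: aug_smult f c_smult)
    also have "aug F (vec ?r (\<lambda>i. if i < k then x $ i else 0)) = ?c (\<Sum>p\<in>{0..<k}. f p * x $ p)"
      using Suc by simp
    finally show ?case by (simp add: c_add mult.commute)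
  qed
  have aug: "aug F x = ?c ((R *\<^sub>v x) $ 0)" if x: "x \<in> carrier_vec ?r" for x
  proof -
    have "vec ?r (\<lambda>i. if i < ?r then x $ i else 0) = x" using x by (intro eq_vecI) auto
    with part[OF order.refl, of x] show ?thesis by (simp add: Rx[OF x])
  qed
  have zero: "\<zero>\<^bsub>cyclic_module I\<^esub> = ?c 0"
    using zero_Q by (simp add: cyclic_module_def regular_module_def)
  have "presents_cyclic I (rk F) (shift F) (bd F) R"
    unfolding presents_cyclic_def
  proof (intro conjI)
    show "graded_exact_sequence (rk F) (shift F) (bd F)"
      using res by unfold_locales (auto simp: graded_free_resolution_def graded_mat_def)
    show "graded_mat 1 (\<lambda>_. 0) (rk F 0) (shift F 0) R"
      by (auto simp: graded_mat_def R_def f)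
    have "{x \<in> carrier_vec ?r. (R *\<^sub>v x) $ 0 \<in> I} = {x \<in> carrier_vec ?r. aug F x = \<zero>\<^bsub>cyclic_module I\<^esub>}"
      by (intro Collect_cong conj_cong refl) (simp add: aug zero regular_coset_eq_iff[OF I])
    then show "{x \<in> carrier_vec ?r. (R *\<^sub>v x) $ 0 \<in> I} = (\<lambda>x. bd F 0 *\<^sub>v x) ` carrier_vec (rk F 1)"
      using res by (simp add: graded_free_resolution_def)
    have "?c 1 \<in> aug F ` carrier_vec ?r"
      using res carrier_Q UN[of 1] by (auto simp: graded_free_resolution_def cyclic_module_def)
    then obtain x where "x \<in> carrier_vec ?r" "aug F x = ?c 1" by auto
    then show "\<exists>x\<in>carrier_vec ?r. (R *\<^sub>v x) $ 0 - 1 \<in> I"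
      using aug regular_coset_eq_iff[OF I] by metis
  qed
  then show thesis by (rule that)
qed

text \<open>This supplies the witness by which the \<open>SOME\<close> in \<open>Tor_k\<close>
  really picks a resolution.\<close>

lemma presents_cyclic_resolution:
  assumes I: "ideal I class_ring" and r: "r 0 = 1" "a 0 0 = 0"
    and P: "presents_cyclic I r a A (1\<^sub>m 1)"
  shows "graded_free_resolution (cyclic_module I) (cyclic_grading I)
    \<lparr>rk = r, shift = a, bd = A, aug = \<lambda>x. I +>\<^bsub>regular_module\<^esub> (x $ 0)\<rparr>"
proof -
  interpret quotient class_ring regular_module I
    by (simp add: quotient_def module_regular submodule_regular[OF I])
  interpret graded_exact_sequence r a A using P by (simp add: presents_cyclic_def)
  have hom: "(\<lambda>x. I +>\<^bsub>regular_module\<^esub> (x $ 0))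
      \<in> LinearCombinations.module_hom class_ring (module_vec TYPE(('a, 'b) mpoly) 1) Q"
    using proj_hom by (auto simp: LinearCombinations.module_hom_def module_vec_simps regular_module_def)
  have im: "{x \<in> carrier_vec 1. x $ 0 \<in> I} = (\<lambda>x. A 0 *\<^sub>v x) ` carrier_vec (r 1)"
  proof -
    have "{x \<in> carrier_vec 1. x $ 0 \<in> I} = {x \<in> carrier_vec 1. (1\<^sub>m 1 *\<^sub>v x) $ 0 \<in> I}"
      by (intro Collect_cong conj_cong refl) (simp only: one_mult_mat_vec)
    with P r show ?thesis by (simp only: presents_cyclic_def)
  qed
  have zero: "\<zero>\<^bsub>cyclic_module I\<^esub> = I +>\<^bsub>regular_module\<^esub> 0"
    using zero_Q by (simp add: cyclic_module_def regular_module_def)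
  have surj: "(\<lambda>x. I +>\<^bsub>regular_module\<^esub> (x $ 0)) ` carrier_vec 1 = carrier Q"
    unfolding carrier_Q
  proof (intro equalityI subsetI)
    fix X assume "X \<in> (\<lambda>x. I +>\<^bsub>regular_module\<^esub> x) ` carrier regular_module"
    then obtain x where "X = I +>\<^bsub>regular_module\<^esub> x" by auto
    then show "X \<in> (\<lambda>x. I +>\<^bsub>regular_module\<^esub> (x $ 0)) ` carrier_vec 1"
      by (intro image_eqI[of _ _ "vec 1 (\<lambda>_. x)"]) auto
  qed (auto simp: regular_module_def)
  have gr1: "I +>\<^bsub>regular_module\<^esub> 1 \<in> cyclic_grading I 0"
    using forms_one by (auto simp: cyclic_grading_def a_r_coset_def' regular_module_def intro!: image_eqI[of _ _ 1])
  show ?thesis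
    unfolding graded_free_resolution_def
    using gr exact hom im surj r gr1
    by (auto simp: graded_mat_def cyclic_module_def[symmetric] zero regular_coset_eq_iff[OF I])
qed


section \<open>Betti numbers from a minimal resolution\<close>

lemma graded_vec_submodule:
  "LinearCombinations.submodule class_ring (graded_vec r a j) (module_vec TYPE('k::field) r)"
  using vec_module by (auto simp: LinearCombinations.submodule_def graded_vec_def module_vec_simps)

lemma (in graded_exact_sequence) cycles_submodule:
  "LinearCombinations.submodule class_ring (cycles i j) (module_vec TYPE('k) (r i))"
proof -
  have add: "const_mat (A h) *\<^sub>v (x + y) = const_mat (A h) *\<^sub>v x + const_mat (A h) *\<^sub>v y"
    if "x \<in> carrier_vec (r (Suc h))" "y \<in> carrier_vec (r (Suc h))" for h x y
    using that by (intro mult_add_distrib_mat_vec[of _ "r h" "r (Suc h)"]) auto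
  have smult: "const_mat (A h) *\<^sub>v (c \<cdot>\<^sub>v x) = c \<cdot>\<^sub>v (const_mat (A h) *\<^sub>v x)"
    if "x \<in> carrier_vec (r (Suc h))" for h x c
    using that by (intro mult_mat_vec[of _ "r h" "r (Suc h)"]) auto
  show ?thesis
    using graded_vec_submodule[of "r i" "a i" j]
    by (auto simp: LinearCombinations.submodule_def cycles_def module_vec_simps add smult subset_iff
        intro!: eq_vecI simp: scalar_prod_def)
qed

lemma (in graded_exact_sequence) boundaries_submodule:
  "LinearCombinations.submodule class_ring (boundaries i j) (module_vec TYPE('k) (r i))"
proof -
  let ?g = "graded_vec (r (Suc i)) (a (Suc i)) j" and ?A = "const_mat (A i)"
  have sub: "LinearCombinations.submodule class_ring ?g (module_vec TYPE('k) (r (Suc i)))"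
    by (rule graded_vec_submodule)
  have gc: "x \<in> carrier_vec (r (Suc i))" if "x \<in> ?g" for x
    using that by (simp add: graded_vec_def)
  have Ac: "?A \<in> carrier_mat (r i) (r (Suc i))" by simp
  show ?thesis
    unfolding LinearCombinations.submodule_def module_vec_simps
  proof (intro conjI allI impI)
    show "Module.module class_ring (module_vec TYPE('k) (r i))" by (rule vec_module)
    show "boundaries i j \<subseteq> carrier_vec (r i)"
      by (auto simp: boundaries_def dest!: gc intro: mult_mat_vec_carrier[OF Ac])
    show "0\<^sub>v (r i) \<in> boundaries i j"
    proof -
      have "?A *\<^sub>v 0\<^sub>v (r (Suc i)) = 0\<^sub>v (r i)"
        by (intro eq_vecI) (auto simp: scalar_prod_def)
      then show ?thesis
        using sub by (auto simp: boundaries_def LinearCombinations.submodule_def module_vec_simps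
            intro!: image_eqI[of _ _ "0\<^sub>v (r (Suc i))"])
    qed
  next
    fix v w assume "v \<in> boundaries i j" "w \<in> boundaries i j"
    then obtain x y where xy: "x \<in> ?g" "y \<in> ?g" "v = ?A *\<^sub>v x" "w = ?A *\<^sub>v y"
      by (auto simp: boundaries_def)
    then have "v + w = ?A *\<^sub>v (x + y)"
      by (simp add: mult_add_distrib_mat_vec[OF Ac gc gc])
    then show "v + w \<in> boundaries i j"
      using sub xy by (auto simp: boundaries_def LinearCombinations.submodule_def module_vec_simps)
  next
    fix c v assume "v \<in> boundaries i j"
    then obtain x where x: "x \<in> ?g" "v = ?A *\<^sub>v x" by (auto simp: boundaries_def)
    then have "c \<cdot>\<^sub>v v = ?A *\<^sub>v (c \<cdot>\<^sub>v x)"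
      by (simp add: mult_mat_vec[OF Ac gc])
    then show "c \<cdot>\<^sub>v v \<in> boundaries i j"
      using sub x by (auto simp: boundaries_def LinearCombinations.submodule_def module_vec_simps)
  qed
qed

lemma dim_homology_k_ne_0_iff:
  assumes "graded_exact_sequence (rk F) (shift F) (bd F)"
  shows "vectorspace.dim class_ring (homology_k F i j) \<noteq> 0 \<longleftrightarrow>
    graded_exact_sequence.cycles (rk F) (shift F) (bd F) i j \<noteq>
    graded_exact_sequence.boundaries (rk F) (shift F) (bd F) i j"
proof -
  interpret graded_exact_sequence "rk F" "shift F" "bd F" by fact
  interpret V: vec_space "TYPE('b)" "rk F i" .
  have "cycles_k F i j = cycles i j" "boundaries_k F i j = boundaries i j"
    by (auto simp: cycles_k_def cycles_def boundaries_k_def boundaries_def chains_k_def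
        graded_vec_def bd_k_def)
  then show ?thesis
    using dim_quotient_eq_0_iff[OF vec_vs V.fin_dim cycles_submodule boundaries_submodule
        boundaries_subset_cycles]
    by (simp add: homology_k_def)
qed

text \<open>Comparison moves the question from the chosen resolution to the given one. There
  \<open>minimal\<close> makes every differential vanish over the residue field, so all chains are
  cycles and only zero is a boundary.\<close>

lemma betti_cyclic_ne_0_iff:
  assumes I: "ideal I class_ring" and r: "r 0 = 1" "a 0 0 = 0"
    and P: "presents_cyclic I r a A (1\<^sub>m 1)"
    and minimal: "\<And>i p q. p < r i \<Longrightarrow> q < r (Suc i) \<Longrightarrow> Poly_Mapping.lookup (A i $$ (p, q)) 0 = 0"
  shows "betti (cyclic_module I) (cyclic_grading I) i j \<noteq> 0 \<longleftrightarrow> (\<exists>p<r i. a i p = j)"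
proof -
  define F where "F = (SOME F. graded_free_resolution (cyclic_module I) (cyclic_grading I) F)"
  have "graded_free_resolution (cyclic_module I) (cyclic_grading I) F"
    unfolding F_def by (rule someI, rule presents_cyclic_resolution[OF I r P])
  then obtain R where PF: "presents_cyclic I (rk F) (shift F) (bd F) R"
    by (rule graded_free_resolution_presents[OF I])
  interpret F: graded_exact_sequence "rk F" "shift F" "bd F"
    using PF by (simp add: presents_cyclic_def)
  interpret G: graded_exact_sequence r a A
    using P by (simp add: presents_cyclic_def)
  have im: "{x \<in> carrier_vec 1. x $ 0 \<in> I} = (\<lambda>x. A 0 *\<^sub>v x) ` carrier_vec (r 1)"
  proof -
    have "{x \<in> carrier_vec 1. x $ 0 \<in> I} = {x \<in> carrier_vec 1. (1\<^sub>m 1 *\<^sub>v x) $ 0 \<in> I}"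
      by (intro Collect_cong conj_cong refl) (simp only: one_mult_mat_vec)
    with P r show ?thesis by (simp only: presents_cyclic_def)
  qed
  \<comment> \<open>\<open>I\<close> is homogeneous because it is the image of the graded matrix
    \<open>A 0\<close>.\<close>
  have hom: "hom_comp d f \<in> I" if f: "f \<in> I" for d f
  proof -
    have "vec 1 (\<lambda>_. f) \<in> (\<lambda>x. A 0 *\<^sub>v x) ` carrier_vec (r 1)"
      unfolding im[symmetric] using f by auto
    then obtain y where y: "y \<in> carrier_vec (r (Suc 0))" "vec 1 (\<lambda>_. f) = A 0 *\<^sub>v y" by auto
    have "hom_comp d f = (A 0 *\<^sub>v vec (r (Suc 0)) (\<lambda>i. hom_comp (d - a (Suc 0) i) (y $ i))) $ 0"
      using graded_mat_hom_comp[OF G.gr y(1), of 0 d] r by (simp add: y(2)[symmetric])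
    moreover have "A 0 *\<^sub>v vec (r (Suc 0)) (\<lambda>i. hom_comp (d - a (Suc 0) i) (y $ i))
        \<in> {x \<in> carrier_vec 1. x $ 0 \<in> I}"
      unfolding im by auto
    ultimately show ?thesis by simp
  qed
  have "betti (cyclic_module I) (cyclic_grading I) i j \<noteq> 0 \<longleftrightarrow> F.cycles i j \<noteq> F.boundaries i j"
    unfolding betti_def Tor_k_def F_def[symmetric]
    by (rule dim_homology_k_ne_0_iff) (rule F.graded_exact_sequence_axioms)
  also have "\<dots> \<longleftrightarrow> G.cycles i j \<noteq> G.boundaries i j"
    using presents_cyclic_transfer[OF I hom PF P] presents_cyclic_transfer[OF I hom P PF] by blast
  also have "\<dots> \<longleftrightarrow> (\<exists>p<r i. a i p = j)"
  proof -
    have zero: "const_mat (A l) = 0\<^sub>m (r l) (r (Suc l))" for l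
      using minimal by (intro eq_matI) auto
    have cyc: "G.cycles i j = graded_vec (r i) (a i) j"
      by (auto simp: G.cycles_def zero graded_vec_def)
    have bd: "G.boundaries i j = {0\<^sub>v (r i)}"
    proof -
      have "0\<^sub>v (r (Suc i)) \<in> graded_vec (r (Suc i)) (a (Suc i)) j" by (simp add: graded_vec_def)
      moreover have "const_mat (A i) *\<^sub>v x = 0\<^sub>v (r i)" if "x \<in> graded_vec (r (Suc i)) (a (Suc i)) j" for x
        using that by (intro eq_vecI) (auto simp: zero graded_vec_def scalar_prod_def)
      ultimately show ?thesis unfolding G.boundaries_def by (auto intro!: image_eqI)
    qed
    have "graded_vec (r i) (a i) j = {0\<^sub>v (r i) :: 'b vec} \<longleftrightarrow> \<not> (\<exists>p<r i. a i p = j)"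
    proof
      assume eq: "graded_vec (r i) (a i) j = {0\<^sub>v (r i) :: 'b vec}"
      show "\<not> (\<exists>p<r i. a i p = j)"
      proof
        assume "\<exists>p<r i. a i p = j"
        then obtain p where p: "p < r i" "a i p = j" by blast
        then have "unit_vec (r i) p \<in> (graded_vec (r i) (a i) j :: 'b vec set)"
          by (auto simp: graded_vec_def unit_vec_def)
        then show False using p by (simp add: eq)
      qed
    next
      assume none: "\<not> (\<exists>p<r i. a i p = j)"
      show "graded_vec (r i) (a i) j = {0\<^sub>v (r i) :: 'b vec}"
      proof (intro equalityI subsetI)
        fix x :: "'b vec" assume "x \<in> graded_vec (r i) (a i) j"
        then show "x \<in> {0\<^sub>v (r i)}" using none by (auto simp: graded_vec_def intro!: eq_vecI)
      qed (simp add: graded_vec_def)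
    qed
    then show ?thesis unfolding cyc bd by simp
  qed
  finally show ?thesis .
qed

section \<open>A strand of the Koszul complex\<close>

lemma lookup_single_mult:
  fixes f :: "('v, 'k::field) mpoly"
  shows "Poly_Mapping.lookup (Poly_Mapping.single m a * f) c =
    (if \<forall>v. Poly_Mapping.lookup m v \<le> Poly_Mapping.lookup c v then a * Poly_Mapping.lookup f (c - m) else 0)"
proof -
  let ?P = "\<forall>v. Poly_Mapping.lookup m v \<le> Poly_Mapping.lookup c v"
  have "c = m + q \<longleftrightarrow> ?P \<and> q = c - m" for q
    by (auto simp: poly_mapping_eq_iff fun_eq_iff lookup_add lookup_minus)
  then have "(\<lambda>q. Poly_Mapping.lookup f q when c = m + q) =
      (\<lambda>q. (Poly_Mapping.lookup f q when ?P) when q = c - m)"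
    by (auto simp: fun_eq_iff when_def)
  then have inner: "(\<Sum>q. Poly_Mapping.lookup f q when c = m + q) = (Poly_Mapping.lookup f (c - m) when ?P)"
    by (simp only: Sum_any_when_equal)
  have "Poly_Mapping.lookup (Poly_Mapping.single m a * f) c =
      (\<Sum>l. Poly_Mapping.lookup (Poly_Mapping.single m a) l * (\<Sum>q. Poly_Mapping.lookup f q when c = l + q))"
    by (rule lookup_mult)
  also have "(\<lambda>l. Poly_Mapping.lookup (Poly_Mapping.single m a) l *
        (\<Sum>q. Poly_Mapping.lookup f q when c = l + q)) =
      (\<lambda>l. (a * (\<Sum>q. Poly_Mapping.lookup f q when c = m + q)) when l = m)"
    by (auto simp: fun_eq_iff lookup_single when_def)
  finally show ?thesis by (simp only: Sum_any_when_equal inner) (simp add: when_def)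
qed

text \<open>The pairs \<open>(j, l)\<close> and \<open>(l, j)\<close> cancel one by one. Showing
  that the sum equals its own negative would prove nothing in characteristic 2.\<close>

lemma sum_antisym_pairs:
  fixes g :: "'a \<Rightarrow> 'a \<Rightarrow> 'b::ab_group_add"
  assumes "finite K" "\<And>j l. j \<in> K \<Longrightarrow> l \<in> K \<Longrightarrow> j \<noteq> l \<Longrightarrow> g j l = - g l j"
  shows "(\<Sum>j\<in>K. \<Sum>l\<in>K - {j}. g j l) = 0"
  using assms
proof (induction K rule: finite_induct)
  case (insert a K)
  have "(\<Sum>l\<in>insert a K - {j}. g j l) = g j a + (\<Sum>l\<in>K - {j}. g j l)" if "j \<in> K" for j
  proof -
    have "insert a K - {j} = insert a (K - {j})" using insert.hyps that by auto
    then show ?thesis using insert.hyps by simp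
  qed
  then have "(\<Sum>j\<in>insert a K. \<Sum>l\<in>insert a K - {j}. g j l)
      = (\<Sum>l\<in>K. g a l) + (\<Sum>j\<in>K. g j a + (\<Sum>l\<in>K - {j}. g j l))"
    using insert.hyps by simp
  also have "\<dots> = (\<Sum>l\<in>K. g a l + g l a) + (\<Sum>j\<in>K. \<Sum>l\<in>K - {j}. g j l)"
    by (simp add: sum.distrib add.assoc)
  also have "(\<Sum>l\<in>K. g a l + g l a) = 0"
    using insert.prems insert.hyps by (intro sum.neutral) (metis add.left_inverse insertCI)
  also have "(\<Sum>j\<in>K. \<Sum>l\<in>K - {j}. g j l) = 0"
    by (rule insert.IH) (use insert.prems in blast)
  finally show ?case by simp
qed simp

text \<open>The sign with which \<open>e_j\<close> is removed from the wedge product indexed by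
  \<open>insert j I\<close>; meant for \<open>j\<close> outside \<open>I\<close>.\<close>

definition koszul_sign :: "nat \<Rightarrow> nat set \<Rightarrow> 'a::comm_ring_1" where
  "koszul_sign j I = (-1) ^ card {l \<in> I. l < j}"

lemma koszul_sign_insert:
  assumes "finite I" "l \<notin> I"
  shows "koszul_sign j (insert l I) = (if l < j then - koszul_sign j I else koszul_sign j I)"
proof -
  have "{i \<in> insert l I. i < j} = (if l < j then insert l {i \<in> I. i < j} else {i \<in> I. i < j})"
    by auto
  then show ?thesis using assms by (auto simp: koszul_sign_def)
qed

lemma koszul_sign_anticomm:
  assumes "finite I" "j \<notin> I" "l \<notin> I" "j \<noteq> l"
  shows "koszul_sign j I * koszul_sign l (insert j I) = - (koszul_sign l I * koszul_sign j (insert l I) :: 'a::comm_ring_1)"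
  using assms by (simp add: koszul_sign_insert)

lemma koszul_sign_least: "(\<And>l. l \<in> I \<Longrightarrow> j \<le> l) \<Longrightarrow> koszul_sign j I = 1"
proof -
  assume "\<And>l. l \<in> I \<Longrightarrow> j \<le> l"
  then have "{l \<in> I. l < j} = {}" by force
  then show ?thesis by (simp only: koszul_sign_def card.empty power_0)
qed

lemma lookup_koszul_sign_mult:
  fixes f :: "('v, 'k::field) mpoly"
  shows "Poly_Mapping.lookup (koszul_sign j I * f) c = koszul_sign j I * Poly_Mapping.lookup f c"
proof -
  have "Poly_Mapping.lookup ((-1) ^ k * f) c = (-1) ^ k * Poly_Mapping.lookup f c" for k
    by (induction k) simp_all
  then show ?thesis by (simp add: koszul_sign_def)
qed

lift_definition indicator_exp :: "'v::finite set \<Rightarrow> ('v \<Rightarrow>\<^sub>0 nat)" is "\<lambda>A v. if v \<in> A then 1 else 0"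
  by simp

text \<open>Division by the monomial with exponent \<open>m\<close>, dropping the terms it does not
  divide, followed by a selection among the quotient exponents.\<close>

definition shift_filter ::
    "('v \<Rightarrow>\<^sub>0 nat) \<Rightarrow> (('v \<Rightarrow>\<^sub>0 nat) \<Rightarrow> bool) \<Rightarrow> ('v, 'k::field) mpoly \<Rightarrow> ('v, 'k) mpoly" where
  "shift_filter m P f = Abs_poly_mapping (\<lambda>c. if P c then Poly_Mapping.lookup f (c + m) else 0)"

text \<open>Translation by \<open>m\<close> is injective, so the new support is finite and
  \<open>Abs_poly_mapping\<close> can be inverted.\<close>

lemma lookup_shift_filter:
  "Poly_Mapping.lookup (shift_filter m P f) c = (if P c then Poly_Mapping.lookup f (c + m) else 0)"
proof -
  have "finite ((\<lambda>c. c + m) -` {x. Poly_Mapping.lookup f x \<noteq> 0})"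
    by (intro finite_vimageI) (auto simp: inj_on_def)
  then have "finite {c. (if P c then Poly_Mapping.lookup f (c + m) else 0) \<noteq> 0}"
    by (rule finite_subset[rotated]) (auto split: if_splits)
  then show ?thesis by (simp add: shift_filter_def)
qed

section \<open>Divisibility of monomials by the products y_j\<close>

locale multipartite =
  fixes n s :: nat and V :: "nat \<Rightarrow> 'v::finite set"
  assumes n2: "2 \<le> n" and s1: "1 \<le> s" and nonempty: "i \<in> {1..n} \<Longrightarrow> V i \<noteq> {}"
    and disj: "disjoint_family_on V {1..n}" and union: "(\<Union>i\<in>{1..n}. V i) = UNIV"
begin

abbreviation yexp :: "nat \<Rightarrow> ('v \<Rightarrow>\<^sub>0 nat)" where
  "yexp j \<equiv> indicator_exp (V j)"

definition y :: "nat \<Rightarrow> ('v, 'k::field) mpoly" where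
  "y j = Poly_Mapping.single (yexp j) 1"

definition divides_at :: "nat \<Rightarrow> ('v \<Rightarrow>\<^sub>0 nat) \<Rightarrow> bool" where
  "divides_at j c \<longleftrightarrow> (\<forall>v\<in>V j. 1 \<le> Poly_Mapping.lookup c v)"

lemma lookup_y_mult:
  "Poly_Mapping.lookup (y j * f) c = (if divides_at j c then Poly_Mapping.lookup f (c - yexp j) else 0)"
proof -
  have "(\<forall>v. Poly_Mapping.lookup (yexp j) v \<le> Poly_Mapping.lookup c v) \<longleftrightarrow> divides_at j c"
    by (auto simp: divides_at_def indicator_exp.rep_eq)
  then show ?thesis by (simp add: y_def lookup_single_mult)
qed

lemma divides_at_diff:
  assumes "i \<in> {1..n}" "j \<in> {1..n}" "i \<noteq> j"
  shows "divides_at i (c - yexp j) \<longleftrightarrow> divides_at i c"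
proof -
  have "V i \<inter> V j = {}" using disj assms by (auto simp: disjoint_family_on_def)
  then show ?thesis by (auto simp: divides_at_def lookup_minus indicator_exp.rep_eq)
qed

lemma divides_at_add:
  assumes "i \<in> {1..n}" "j \<in> {1..n}" "i \<noteq> j"
  shows "divides_at i (c + yexp j) \<longleftrightarrow> divides_at i c"
proof -
  have "V i \<inter> V j = {}" using disj assms by (auto simp: disjoint_family_on_def)
  then show ?thesis by (auto simp: divides_at_def lookup_add indicator_exp.rep_eq)
qed

lemma divides_at_add_self: "divides_at j (c + yexp j)"
  by (auto simp: divides_at_def lookup_add indicator_exp.rep_eq)

lemma divides_at_diff_add:
  assumes "divides_at j c"
  shows "c - yexp j + m = c + m - yexp j"
  using assms
  by (intro poly_mapping_eqI) (auto simp: divides_at_def lookup_add lookup_minus indicator_exp.rep_eq)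

text \<open>The indices \<open>j < n\<close> for which \<open>y\<^sub>j T\<^sub>j\<close> divides the monomial \<open>x\<^sup>c T\<^sup>b\<close>.\<close>
definition avail :: "nat multiset \<Rightarrow> ('v \<Rightarrow>\<^sub>0 nat) \<Rightarrow> nat set" where
  "avail b c = {j \<in> {1..<n}. j \<in># b \<and> divides_at j c}"

lemma avail_subset: "avail b c \<subseteq> {1..<n}"
  by (auto simp: avail_def)

lemma finite_avail [simp]: "finite (avail b c)"
  by (rule finite_subset[OF avail_subset]) simp

lemma avail_diff_subset: "avail (b - {#j#}) (c - yexp j) \<subseteq> avail b c"
  by (auto simp: avail_def divides_at_def lookup_minus dest!: in_diffD)

lemma avail_diff:
  "i \<noteq> j \<Longrightarrow> j \<in> {1..n} \<Longrightarrow> i \<in> avail b c \<Longrightarrow> i \<in> avail (b - {#j#}) (c - yexp j)"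
  by (auto simp: avail_def divides_at_diff in_diff_count)

lemma avail_add:
  assumes "j \<in> {1..<n}"
  shows "avail (add_mset j b) (c + yexp j) = insert j (avail b c)"
proof -
  have "i \<in> avail (add_mset j b) (c + yexp j) \<longleftrightarrow> i \<in> insert j (avail b c)" for i
    using assms by (cases "i = j") (auto simp: avail_def divides_at_add divides_at_add_self)
  then show ?thesis by auto
qed

section \<open>A contraction for the leading terms, coefficient by coefficient\<close>

definition leading_d :: "(nat set \<Rightarrow> nat multiset \<Rightarrow> ('v \<Rightarrow>\<^sub>0 nat) \<Rightarrow> 'k::field)
    \<Rightarrow> nat set \<Rightarrow> nat multiset \<Rightarrow> ('v \<Rightarrow>\<^sub>0 nat) \<Rightarrow> 'k" where
  "leading_d x I b c = (\<Sum>j\<in>{1..<n} - I. koszul_sign j I *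
     (if j \<in> avail b c then x (insert j I) (b - {#j#}) (c - yexp j) else 0))"

text \<open>Seen from a source monomial \<open>x^c T^b e_I\<close>: let \<open>m\<close> be the
  least member of \<open>I\<close> and \<open>avail b c\<close> together. If
  \<open>m \<notin> I\<close>, divide by \<open>y_m T_m\<close> and adjoin \<open>e_m\<close>;
  otherwise the image is 0. The body gives the coefficient of a target monomial, so the test is
  expressed there.\<close>

definition contract :: "(nat set \<Rightarrow> nat multiset \<Rightarrow> ('v \<Rightarrow>\<^sub>0 nat) \<Rightarrow> 'k::field)
    \<Rightarrow> nat set \<Rightarrow> nat multiset \<Rightarrow> ('v \<Rightarrow>\<^sub>0 nat) \<Rightarrow> 'k" where
  "contract x I b c =
     (if I \<noteq> {} \<and> I \<subseteq> {1..<n} \<and> (\<forall>j\<in>avail b c. Min I \<le> j)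
      then x (I - {Min I}) (add_mset (Min I) b) (c + yexp (Min I)) else 0)"

text \<open>The least index \<open>m\<close> of \<open>I\<close> and \<open>avail b c\<close>
  decides everything. If \<open>m \<notin> I\<close>, only the term \<open>j = m\<close> survives;
  if \<open>m \<in> I\<close>, removing and restoring \<open>m\<close> gives back \<open>x\<close>,
  and the remaining terms cancel because \<open>m\<close> in front of \<open>j\<close> reverses the
  sign.\<close>

lemma leading_d_contract:
  fixes x :: "nat set \<Rightarrow> nat multiset \<Rightarrow> ('v \<Rightarrow>\<^sub>0 nat) \<Rightarrow> 'k::field"
  assumes I: "I \<subseteq> {1..<n}" and ne: "I \<noteq> {} \<or> avail b c \<noteq> {}"
  shows "leading_d (contract x) I b c + contract (leading_d x) I b c = x I b c"
proof -
  have fI: "finite I" using I by (rule finite_subset) simp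
  define m where "m = Min (I \<union> avail b c)"
  have m: "m \<in> I \<union> avail b c" "\<And>i. i \<in> I \<union> avail b c \<Longrightarrow> m \<le> i"
    unfolding m_def by (rule Min_in) (use fI ne in simp_all)
  have mn: "m \<in> {1..<n}" using m(1) I avail_subset[of b c] by blast
  show ?thesis
  proof (cases "m \<in> I")
    case False
    then have mA: "m \<in> avail b c" using m(1) by auto
    have "contract (leading_d x) I b c = 0"
    proof (cases "I = {}")
      case False
      then have "Min I \<in> I" using fI by simp
      then have "m < Min I" using m(2)[of "Min I"] \<open>m \<notin> I\<close> by (metis Un_iff le_neq_implies_less)
      then have "\<not> (\<forall>j\<in>avail b c. Min I \<le> j)" using mA by (metis not_le)
      then show ?thesis by (auto simp: contract_def)
    qed (simp add: contract_def)
    moreover have "leading_d (contract x) I b c = x I b c"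
    proof -
      have "leading_d (contract x) I b c = (\<Sum>j\<in>{1..<n} - I. if j = m then x I b c else 0)"
        unfolding leading_d_def
      proof (rule sum.cong[OF refl])
        fix j assume j: "j \<in> {1..<n} - I"
        show "koszul_sign j I * (if j \<in> avail b c
              then contract x (insert j I) (b - {#j#}) (c - yexp j) else 0) = (if j = m then x I b c else 0)"
        proof (cases "j = m")
          case True
          have "Min (insert m I) = m" using fI m(2) by (intro Min_eqI) auto
          moreover have "insert m I - {m} = I" using False by auto
          moreover have "m \<in># b" "divides_at m c" using mA by (auto simp: avail_def)
          moreover have "\<forall>j\<in>avail (b - {#m#}) (c - yexp m). m \<le> j"
            using avail_diff_subset[of b m c] m(2) by auto
          moreover have "koszul_sign m I = (1 :: 'k)" using m(2) by (intro koszul_sign_least) auto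
          moreover have "insert m I \<subseteq> {1..<n}" using I mn by auto
          ultimately show ?thesis using True mA
            by (simp add: contract_def divides_at_diff_add)
        next
          case jm: False
          \<comment> \<open>\<open>m\<close> remains available and lies below
            \<open>Min (insert j I)\<close>, so the test in \<open>contract\<close> fails.\<close>
          have "contract x (insert j I) (b - {#j#}) (c - yexp j) = 0" if jA: "j \<in> avail b c"
          proof -
            have "Min (insert j I) \<in> insert j I" using fI by (intro Min_in) auto
            then have "m < Min (insert j I)"
              using m(2)[of "Min (insert j I)"] jA jm False by (metis Un_iff insert_iff le_neq_implies_less)
            moreover have "m \<in> avail (b - {#j#}) (c - yexp j)"
              using jm j mA by (intro avail_diff) auto
            ultimately show ?thesis unfolding contract_def by (metis not_le)
          qed
          then show ?thesis using jm by auto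
        qed
      qed
      also have "\<dots> = x I b c" using mn False by simp
      finally show ?thesis .
    qed
    ultimately show ?thesis by simp
  next
    case True
    have MinI: "Min I = m" using fI m(2) True by (intro Min_eqI) auto
    \<comment> \<open>The term of index \<open>j\<close> common to both composites, with the sign
      computed without \<open>m\<close>; the other composite has \<open>m\<close> still in the index
      set, hence the opposite sign.\<close>
    let ?t = "\<lambda>j. koszul_sign j (I - {m}) * (if j \<in> avail b c
        then x (insert j (I - {m})) (add_mset m b - {#j#}) (c + yexp m - yexp j) else 0)"
    have fin: "finite ({1..<n} - I)" by simp
    have "contract (leading_d x) I b c = leading_d x (I - {m}) (add_mset m b) (c + yexp m)"
      using m(2) True I by (auto simp: contract_def MinI)
    also have "\<dots> = (\<Sum>j\<in>insert m ({1..<n} - I). koszul_sign j (I - {m}) * (if j \<in> insert m (avail b c)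
        then x (insert j (I - {m})) (add_mset m b - {#j#}) (c + yexp m - yexp j) else 0))"
      using mn unfolding leading_d_def avail_add[OF mn] by (intro sum.cong) auto
    also have "\<dots> = koszul_sign m (I - {m}) * x (insert m (I - {m})) b (c + yexp m - yexp m)
        + (\<Sum>j\<in>{1..<n} - I. ?t j)"
      using True by (subst sum.insert[OF fin]) (auto intro!: sum.cong)
    also have "koszul_sign m (I - {m}) = (1 :: 'k)" using m(2) by (intro koszul_sign_least) auto
    finally have 1: "contract (leading_d x) I b c = x I b c + (\<Sum>j\<in>{1..<n} - I. ?t j)"
      using True by (simp add: insert_absorb)
    have "leading_d (contract x) I b c = (\<Sum>j\<in>{1..<n} - I. - ?t j)"
      unfolding leading_d_def
    proof (rule sum.cong[OF refl])
      fix j assume j: "j \<in> {1..<n} - I"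
      show "koszul_sign j I * (if j \<in> avail b c
          then contract x (insert j I) (b - {#j#}) (c - yexp j) else 0) = - ?t j"
      proof (cases "j \<in> avail b c")
        case jA: True
        then have mj: "m < j" using m(2)[of j] j True by (metis DiffD2 Un_iff le_neq_implies_less)
        have jb: "j \<in># b" "divides_at j c" using jA by (auto simp: avail_def)
        have "Min (insert j I) = m" using fI m(2) True mj by (intro Min_eqI) auto
        moreover have "\<forall>j\<in>avail (b - {#j#}) (c - yexp j). m \<le> j"
          using avail_diff_subset[of b j c] m(2) by auto
        moreover have "insert j I - {m} = insert j (I - {m})" using mj by auto
        moreover have "add_mset m (b - {#j#}) = add_mset m b - {#j#}" using jb mj by simp
        moreover have "koszul_sign j I = - (koszul_sign j (I - {m}) :: 'k)"
          using koszul_sign_insert[of "I - {m}" m j] fI True mj by (simp add: insert_absorb)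
        moreover have "insert j I \<subseteq> {1..<n}" using I j by auto
        ultimately show ?thesis using jA jb(2)
          by (simp add: contract_def divides_at_diff_add)
      qed simp
    qed
    then show ?thesis by (simp add: 1 sum_negf)
  qed
qed


text \<open>The chain \<open>X\<close> stands for \<open>\<Sum> X I b T\<^sup>b e\<^sub>I\<close> in the Koszul complex over \<open>S[T\<^sub>1,\<dots>,T\<^sub>n]\<close>, and \<open>theta j\<close>
  is multiplication by \<open>y\<^sub>j T\<^sub>j - y\<^sub>n T\<^sub>n\<close>.\<close>
type_synonym ('w, 'k) chain = "nat set \<Rightarrow> nat multiset \<Rightarrow> ('w, 'k) mpoly"

section \<open>The strand of T-degree s, its differential and homotopy\<close>

definition basis :: "nat \<Rightarrow> (nat set \<times> nat multiset) set" where
  "basis i = {(I, b). I \<subseteq> {1..<n} \<and> card I = i \<and> set_mset b \<subseteq> {1..n} \<and> size b + i = s}"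

text \<open>Chains are total functions, so homological degree and membership in the strand are
  conditions on the support.\<close>

definition supported :: "nat \<Rightarrow> ('v, 'k::field) chain \<Rightarrow> bool" where
  "supported i X \<longleftrightarrow> (\<forall>I b. X I b \<noteq> 0 \<longrightarrow> (I, b) \<in> basis i)"

definition theta :: "nat \<Rightarrow> (nat multiset \<Rightarrow> ('v, 'k::field) mpoly) \<Rightarrow> nat multiset \<Rightarrow> ('v, 'k) mpoly" where
  "theta j f b = (if j \<in># b then y j * f (b - {#j#}) else 0) - (if n \<in># b then y n * f (b - {#n#}) else 0)"

definition d :: "('v, 'k::field) chain \<Rightarrow> ('v, 'k) chain" where
  "d X I b = (\<Sum>j\<in>{1..<n} - I. koszul_sign j I * theta j (X (insert j I)) b)"

definition h :: "('v, 'k::field) chain \<Rightarrow> ('v, 'k) chain" where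
  "h X I b = (if I \<noteq> {} \<and> I \<subseteq> {1..<n}
     then shift_filter (yexp (Min I)) (\<lambda>c. \<forall>j\<in>avail b c. Min I \<le> j) (X (I - {Min I}) (add_mset (Min I) b))
     else 0)"

definition coef :: "('v, 'k::field) chain \<Rightarrow> nat set \<Rightarrow> nat multiset \<Rightarrow> ('v \<Rightarrow>\<^sub>0 nat) \<Rightarrow> 'k" where
  "coef X I b c = Poly_Mapping.lookup (X I b) c"

text \<open>The terms \<open>y_n T_n\<close> of the differential without their minus sign, which
  reappears in \<open>coef_d\<close>.\<close>

definition trailing_d :: "(nat set \<Rightarrow> nat multiset \<Rightarrow> ('v \<Rightarrow>\<^sub>0 nat) \<Rightarrow> 'k::field)
    \<Rightarrow> nat set \<Rightarrow> nat multiset \<Rightarrow> ('v \<Rightarrow>\<^sub>0 nat) \<Rightarrow> 'k" where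
  "trailing_d x I b c = (\<Sum>j\<in>{1..<n} - I. koszul_sign j I *
     (if n \<in># b \<and> divides_at n c then x (insert j I) (b - {#n#}) (c - yexp n) else 0))"

lemma coef_d: "coef (d X) I b c = leading_d (coef X) I b c - trailing_d (coef X) I b c"
  unfolding coef_def d_def leading_d_def trailing_d_def lookup_sum lookup_koszul_sign_mult theta_def
    sum_subtractf[symmetric] right_diff_distrib[symmetric]
  by (intro sum.cong refl arg_cong[of _ _ "\<lambda>x. koszul_sign _ _ * x"])
    (auto simp: lookup_minus lookup_y_mult avail_def)

lemma coef_h: "coef (h X) = contract (coef X)"
  by (auto simp: fun_eq_iff coef_def h_def contract_def lookup_shift_filter)

lemma contract_diff: "contract (\<lambda>I b c. x I b c - z I b c) I b c = contract x I b c - contract z I b c"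
  by (simp add: contract_def)

lemma theta_nonzeroE:
  assumes "theta j f b \<noteq> 0"
  obtains k where "k = j \<or> k = n" "k \<in># b" "f (b - {#k#}) \<noteq> 0"
proof -
  have "(j \<in># b \<and> f (b - {#j#}) \<noteq> 0) \<or> (n \<in># b \<and> f (b - {#n#}) \<noteq> 0)"
    using assms by (auto simp: theta_def split: if_splits)
  then show thesis using that by blast
qed

lemma supported_d:
  assumes X: "supported (Suc i) X"
  shows "supported i (d X)"
  unfolding supported_def
proof (intro allI impI)
  fix I b assume "d X I b \<noteq> 0"
  then obtain j where j: "j \<in> {1..<n} - I" "koszul_sign j I * theta j (X (insert j I)) b \<noteq> 0"
    unfolding d_def by (rule sum.not_neutral_contains_not_neutral)
  from j(2) have "theta j (X (insert j I)) b \<noteq> 0" by auto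
  then obtain k where k: "k = j \<or> k = n" "k \<in># b" "X (insert j I) (b - {#k#}) \<noteq> 0"
    by (rule theta_nonzeroE)
  then have B: "(insert j I, b - {#k#}) \<in> basis (Suc i)" using X by (auto simp: supported_def)
  then have "insert j I \<subseteq> {1..<n}" by (simp add: basis_def)
  then have "finite I" by (meson finite_atLeastLessThan finite_insert finite_subset)
  moreover have "b = add_mset k (b - {#k#})" using k(2) by simp
  then have "set_mset b = insert k (set_mset (b - {#k#}))" "size b = Suc (size (b - {#k#}))"
    by (metis set_mset_add_mset_insert, metis size_add_mset)
  moreover have "k \<in> {1..n}" using k(1) j(1) n2 by auto
  ultimately show "(I, b) \<in> basis i" using B j(1) by (auto simp: basis_def)
qed

lemma supported_h:
  assumes X: "supported i X"
  shows "supported (Suc i) (h X)"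
  unfolding supported_def
proof (intro allI impI)
  fix I b assume nz: "h X I b \<noteq> 0"
  then have I: "I \<noteq> {}" "I \<subseteq> {1..<n}" by (auto simp: h_def split: if_splits)
  have fI: "finite I" using I(2) by (rule finite_subset) simp
  have "X (I - {Min I}) (add_mset (Min I) b) \<noteq> 0"
  proof
    assume "X (I - {Min I}) (add_mset (Min I) b) = 0"
    then have "h X I b = 0" by (intro poly_mapping_eqI) (simp add: h_def lookup_shift_filter)
    with nz show False by simp
  qed
  then have "(I - {Min I}, add_mset (Min I) b) \<in> basis i" using X by (auto simp: supported_def)
  moreover have "Min I \<in> I" using fI I(1) by simp
  then have "card I = Suc (card (I - {Min I}))" by (rule card.remove[OF fI])
  ultimately show "(I, b) \<in> basis (Suc i)" using I by (auto simp: basis_def)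
qed

lemma theta_sum: "theta j (\<lambda>b. \<Sum>l\<in>L. g l * F l b) b = (\<Sum>l\<in>L. g l * theta j (F l) b)"
proof -
  have "theta j (\<lambda>b. \<Sum>l\<in>L. g l * F l b) b
      = (\<Sum>l\<in>L. g l * (if j \<in># b then y j * F l (b - {#j#}) else 0))
        - (\<Sum>l\<in>L. g l * (if n \<in># b then y n * F l (b - {#n#}) else 0))"
    unfolding theta_def by (auto simp: sum_distrib_left mult_ac)
  then show ?thesis by (simp add: theta_def sum_subtractf right_diff_distrib)
qed

lemma theta_commute:
  assumes "j < n" "l < n" "j \<noteq> l"
  shows "theta j (theta l f) b = theta l (theta j f) b"
  using assms
  by (simp add: theta_def algebra_simps diff_union_swap in_diff_count insert_DiffM
      diff_right_commute[of b])

text \<open>\<open>theta j\<close> and \<open>theta l\<close> commute, while the signs of the two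
  orders of removal are opposite; the double sum is therefore antisymmetric.\<close>

lemma d_d:
  assumes I: "I \<subseteq> {1..<n}"
  shows "d (d X) I b = 0"
proof -
  have fI: "finite I" using I by (rule finite_subset) simp
  define g where "g j l = koszul_sign j I * (koszul_sign l (insert j I) * theta j (theta l (X (insert l (insert j I)))) b)"
    for j l
  have "d (d X) I b = (\<Sum>j\<in>{1..<n} - I. \<Sum>l\<in>({1..<n} - I) - {j}. g j l)"
    unfolding d_def[of "d X"] g_def
  proof (rule sum.cong[OF refl])
    fix j assume j: "j \<in> {1..<n} - I"
    have eq: "{1..<n} - insert j I = ({1..<n} - I) - {j}" by auto
    have "d X (insert j I) = (\<lambda>b. \<Sum>l\<in>({1..<n} - I) - {j}. koszul_sign l (insert j I) * theta l (X (insert l (insert j I))) b)"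
      by (rule ext) (simp only: d_def eq)
    then show "koszul_sign j I * theta j (d X (insert j I)) b = (\<Sum>l\<in>({1..<n} - I) - {j}.
        koszul_sign j I * (koszul_sign l (insert j I) * theta j (theta l (X (insert l (insert j I)))) b))"
      by (simp add: theta_sum sum_distrib_left)
  qed
  also have "\<dots> = 0"
  proof (rule sum_antisym_pairs)
    fix j l assume jl: "j \<in> {1..<n} - I" "l \<in> {1..<n} - I" "j \<noteq> l"
    have "g j l = (koszul_sign j I * koszul_sign l (insert j I)) * theta j (theta l (X (insert l (insert j I)))) b"
      by (simp add: g_def mult.assoc)
    also have "\<dots> = - (koszul_sign l I * koszul_sign j (insert l I)) * theta l (theta j (X (insert j (insert l I)))) b"
      using jl fI by (subst koszul_sign_anticomm, simp_all add: insert_commute theta_commute[of j l])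
    finally show "g j l = - g l j" by (simp add: g_def mult.assoc)
  qed simp
  finally show ?thesis .
qed

text \<open>The classes of the monomials \<open>x\<^sup>c T\<^sup>b\<close> of this kind form a basis of the Rees algebra.\<close>
definition standard :: "nat set \<Rightarrow> nat multiset \<Rightarrow> ('v \<Rightarrow>\<^sub>0 nat) \<Rightarrow> bool" where
  "standard I b c \<longleftrightarrow> I = {} \<and> avail b c = {}"

text \<open>The monomial that \<open>contract\<close> reads has one more factor \<open>T_m\<close>
  with \<open>m < n\<close>. This \<open>m\<close> is available there, so the monomial is not
  standard, and its exponent of \<open>T_n\<close> is the same.\<close>

lemma contract_count:
  assumes x: "\<And>I b c. x I b c \<noteq> 0 \<Longrightarrow> \<not> standard I b c \<Longrightarrow> r \<le> count b n"
    and nz: "contract x I b c \<noteq> 0"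
  shows "r \<le> count b n"
proof -
  let ?m = "Min I"
  have I: "I \<noteq> {}" "I \<subseteq> {1..<n}" and nz': "x (I - {?m}) (add_mset ?m b) (c + yexp ?m) \<noteq> 0"
    using nz by (auto simp: contract_def split: if_splits)
  have "finite I" using I(2) by (rule finite_subset) simp
  then have m: "?m \<in> {1..<n}" using I Min_in by blast
  have "r \<le> count (add_mset ?m b) n"
    by (rule x[OF nz']) (use m in \<open>auto simp: standard_def avail_add\<close>)
  then show ?thesis using m by (simp split: if_splits)
qed

text \<open>The monomial that is read has one factor \<open>T_n\<close> less, which raises the bound
  by one. Its index set contains \<open>j\<close>, hence the restriction to nonempty
  \<open>I\<close> in the assumption.\<close>

lemma trailing_d_count:
  assumes x: "\<And>I b c. x I b c \<noteq> 0 \<Longrightarrow> I \<noteq> {} \<Longrightarrow> r \<le> count b n"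
    and nz: "trailing_d x I b c \<noteq> 0"
  shows "Suc r \<le> count b n"
proof -
  obtain j where "koszul_sign j I *
      (if n \<in># b \<and> divides_at n c then x (insert j I) (b - {#n#}) (c - yexp n) else 0) \<noteq> 0"
    using nz unfolding trailing_d_def by (rule sum.not_neutral_contains_not_neutral)
  then have "n \<in># b" "x (insert j I) (b - {#n#}) (c - yexp n) \<noteq> 0" by (auto split: if_splits)
  with x[of "insert j I" "b - {#n#}" "c - yexp n"] show ?thesis
    by (simp add: count_diff) (metis Suc_le_eq Suc_pred count_greater_zero_iff le_imp_less_Suc)
qed


lemma theta_diff: "theta j (\<lambda>b. f b - g b) b = theta j f b - theta j g b"
  by (simp add: theta_def right_diff_distrib)

lemma theta_add: "theta j (\<lambda>b. f b + g b) b = theta j f b + theta j g b"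
  by (simp add: theta_def distrib_left)

lemma d_diff: "d (\<lambda>I b. X I b - Z I b) I b = d X I b - d Z I b"
  by (simp add: d_def theta_diff right_diff_distrib sum_subtractf)

lemma d_add: "d (\<lambda>I b. X I b + Z I b) I b = d X I b + d Z I b"
  by (simp add: d_def theta_add distrib_left sum.distrib)

lemma supported_diff: "supported i X \<Longrightarrow> supported i Z \<Longrightarrow> supported i (\<lambda>I b. X I b - Z I b)"
  unfolding supported_def by (metis diff_self)

lemma supported_add: "supported i X \<Longrightarrow> supported i Z \<Longrightarrow> supported i (\<lambda>I b. X I b + Z I b)"
  unfolding supported_def by (metis add.right_neutral)

section \<open>The augmentation and its injectivity on standard monomials\<close>

definition msets :: "nat \<Rightarrow> nat multiset set" where
  "msets t = {b. set_mset b \<subseteq> {1..n} \<and> size b = t}"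

lemma finite_msets [simp]: "finite (msets t)"
proof -
  have "msets t \<subseteq> mset ` {xs. set xs \<subseteq> {1..n} \<and> length xs = t}"
  proof
    fix b assume b: "b \<in> msets t"
    obtain xs where "b = mset xs" using ex_mset by metis
    with b show "b \<in> mset ` {xs. set xs \<subseteq> {1..n} \<and> length xs = t}" by (auto simp: msets_def)
  qed
  then show ?thesis by (rule finite_subset) (simp add: finite_lists_length_eq)
qed

text \<open>Exponent of the image of \<open>T^b\<close>, where \<open>T_j\<close> goes to the
  product of the variables outside \<open>V j\<close>.\<close>

definition mexp :: "nat multiset \<Rightarrow> ('v \<Rightarrow>\<^sub>0 nat)" where
  "mexp b = (\<Sum>j\<in>#b. indicator_exp (- V j))"

definition mon :: "nat multiset \<Rightarrow> ('v, 'k::field) mpoly" where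
  "mon b = Poly_Mapping.single (mexp b) 1"

text \<open>The variable of a vertex in \<open>V i\<close> divides every generator except the one
  for \<open>i\<close>, so the exponents of the image recover the multiplicities in
  \<open>b\<close>.\<close>

lemma mexp_count:
  assumes "set_mset b \<subseteq> {1..n}" "i \<in> {1..n}" "v \<in> V i"
  shows "Poly_Mapping.lookup (mexp b) v + count b i = size b"
  using assms(1)
proof (induction b)
  case (add j b)
  then have "i \<noteq> j \<Longrightarrow> V i \<inter> V j = {}"
    using disj assms(2) by (intro disjoint_family_onD[of V "{1..n}"]) auto
  then have "v \<in> V j \<longleftrightarrow> i = j" using assms(3) by auto
  then show ?case using add by (simp add: mexp_def lookup_add indicator_exp.rep_eq)
qed (simp add: mexp_def)

text \<open>\<open>y j\<close> completes the generator for \<open>j\<close> to the product of all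
  variables. That the right side is the same for every \<open>j\<close> makes
  \<open>y_j T_j - y_n T_n\<close> a relation.\<close>

lemma y_mult_mon: "y j * mon (add_mset j b) = Poly_Mapping.single (indicator_exp UNIV) 1 * mon b"
proof -
  have "yexp j + indicator_exp (- V j) = indicator_exp UNIV"
    by (intro poly_mapping_eqI) (simp add: lookup_add indicator_exp.rep_eq)
  then show ?thesis
    by (simp add: y_def mon_def mexp_def mult_single add.assoc[symmetric])
qed

definition aug_poly :: "('v, 'k::field) chain \<Rightarrow> ('v, 'k) mpoly" where
  "aug_poly X = (\<Sum>b\<in>msets s. X {} b * mon b)"

lemma sum_msets_remove:
  assumes j: "j \<in> {1..n}"
  shows "(\<Sum>b\<in>msets s. if j \<in># b then g (b - {#j#}) b else 0) = (\<Sum>b\<in>msets (s - 1). g b (add_mset j b))"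
proof -
  have "(\<Sum>b\<in>msets s. if j \<in># b then g (b - {#j#}) b else 0) = (\<Sum>b\<in>{b \<in> msets s. j \<in># b}. g (b - {#j#}) b)"
    by (simp add: sum.inter_filter)
  also have "{b \<in> msets s. j \<in># b} = add_mset j ` msets (s - 1)"
  proof (intro equalityI subsetI)
    fix b assume "b \<in> {b \<in> msets s. j \<in># b}"
    then have "b = add_mset j (b - {#j#})" "b - {#j#} \<in> msets (s - 1)"
      by (auto simp: msets_def size_Diff_singleton dest: in_diffD)
    then show "b \<in> add_mset j ` msets (s - 1)" by blast
  qed (use j s1 in \<open>auto simp: msets_def\<close>)
  also have "(\<Sum>b\<in>add_mset j ` msets (s - 1). g (b - {#j#}) b) = (\<Sum>b\<in>msets (s - 1). g b (add_mset j b))"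
    by (subst sum.reindex) (auto simp: inj_on_def)
  finally show ?thesis .
qed

text \<open>The two halves of \<open>theta\<close> contribute equal sums by
  \<open>y_mult_mon\<close>, once both are indexed by the multiset with the factor taken
  out.\<close>

lemma aug_d: "aug_poly (d X) = 0"
proof -
  have theta0: "(\<Sum>b\<in>msets s. theta j f b * mon b) = 0" if j: "j \<in> {1..n}" for j and f :: "nat multiset \<Rightarrow> ('v, 'k::field) mpoly"
  proof -
    have *: "(\<Sum>b\<in>msets s. if i \<in># b then y i * f (b - {#i#}) * mon b else 0)
        = (\<Sum>b\<in>msets (s - 1). f b * (Poly_Mapping.single (indicator_exp UNIV) 1 * mon b))"
      if "i \<in> {1..n}" for i
      using sum_msets_remove[OF that, of "\<lambda>b b'. y i * f b * mon b'"]
      by (simp only: y_mult_mon[of i, symmetric]) (simp add: mult_ac)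
    have "(\<Sum>b\<in>msets s. theta j f b * mon b) = (\<Sum>b\<in>msets s. if j \<in># b then y j * f (b - {#j#}) * mon b else 0)
        - (\<Sum>b\<in>msets s. if n \<in># b then y n * f (b - {#n#}) * mon b else 0)"
      unfolding sum_subtractf[symmetric] by (intro sum.cong) (auto simp: theta_def left_diff_distrib)
    then show ?thesis using *[OF j] *[of n] n2 by simp
  qed
  have "aug_poly (d X) = (\<Sum>b\<in>msets s. \<Sum>j\<in>{1..<n}. koszul_sign j {} * (theta j (X {j}) b * mon b))"
    by (simp add: aug_poly_def d_def sum_distrib_right mult.assoc)
  also have "\<dots> = (\<Sum>j\<in>{1..<n}. koszul_sign j {} * (\<Sum>b\<in>msets s. theta j (X {j}) b * mon b))"
    by (subst sum.swap) (simp add: sum_distrib_left)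
  also have "\<dots> = 0" by (intro sum.neutral) (simp add: theta0)
  finally show ?thesis .
qed

lemma aug_diff: "aug_poly (\<lambda>I b. X I b - Z I b) = aug_poly X - aug_poly Z"
  by (simp add: aug_poly_def left_diff_distrib sum_subtractf)

text \<open>By \<open>mexp_count\<close>, a surplus of \<open>i\<close> in \<open>b\<close> has to
  be made up by an exponent of at least 1 in \<open>c\<close> at every vertex of \<open>V i\<close>;
  then \<open>i\<close> would be available.\<close>

lemma standard_count_le:
  assumes b: "b \<in> msets s" "b' \<in> msets s" and eq: "c + mexp b = c' + mexp b'"
    and av: "avail b c = {}" and i: "i \<in> {1..<n}"
  shows "count b i \<le> count b' i"
proof (rule ccontr)
  assume "\<not> count b i \<le> count b' i"
  then have lt: "count b' i < count b i" by simp
  have "1 \<le> Poly_Mapping.lookup c v" if v: "v \<in> V i" for v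
  proof -
    have "Poly_Mapping.lookup c v + Poly_Mapping.lookup (mexp b) v
        = Poly_Mapping.lookup c' v + Poly_Mapping.lookup (mexp b') v"
      using arg_cong[OF eq, of "\<lambda>e. Poly_Mapping.lookup e v"] by (simp add: lookup_add)
    with mexp_count[of b i v] mexp_count[of b' i v] b i v lt show ?thesis by (auto simp: msets_def)
  qed
  then have "i \<in> avail b c"
    using lt i by (auto simp: avail_def divides_at_def simp flip: count_greater_zero_iff)
  with av show False by simp
qed

text \<open>The multiplicities below \<open>n\<close> agree by \<open>standard_count_le\<close> used
  both ways; that of \<open>n\<close> follows from the common size.\<close>

lemma standard_unique:
  assumes b: "b \<in> msets s" "b' \<in> msets s" and eq: "c + mexp b = c' + mexp b'"
    and av: "avail b c = {}" "avail b' c' = {}"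
  shows "b = b'"
proof -
  have lt: "count b i = count b' i" if "i \<in> {1..<n}" for i
    using standard_count_le[OF b eq av(1) that] standard_count_le[OF b(2,1) eq[symmetric] av(2) that] by simp
  have size: "size z = (\<Sum>i\<in>{1..<n}. count z i) + count z n" if z: "z \<in> msets s" for z
  proof -
    have "size z = (\<Sum>i\<in>{1..n}. count z i)"
      unfolding size_multiset_overloaded_eq using z
      by (intro sum.mono_neutral_left) (auto simp: msets_def not_in_iff)
    moreover have "{1..n} = insert n {1..<n}" using n2 by auto
    ultimately show ?thesis by simp
  qed
  have "(\<Sum>i\<in>{1..<n}. count b i) = (\<Sum>i\<in>{1..<n}. count b' i)" by (rule sum.cong) (auto simp: lt)
  moreover have "size b = size b'" using b by (simp add: msets_def)
  ultimately have n: "count b n = count b' n" using size[OF b(1)] size[OF b(2)] by simp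
  show ?thesis
  proof (rule multiset_eqI)
    fix i
    consider "i \<in> {1..<n}" | "i = n" | "i \<notin> {1..n}" by force
    then show "count b i = count b' i"
    proof cases
      case 3
      then have "i \<notin># b" "i \<notin># b'" using b by (auto simp: msets_def)
      then show ?thesis by (simp add: not_in_iff)
    qed (use lt n in auto)
  qed
qed

text \<open>Distinct standard monomials have distinct images, so nothing can cancel in
  \<open>aug_poly X\<close>.\<close>

lemma aug_inj_standard:
  assumes X: "supported 0 X" and std: "\<And>I b c. coef X I b c \<noteq> 0 \<Longrightarrow> standard I b c"
    and aug: "aug_poly X = 0"
  shows "X I b = 0"
proof (rule ccontr)
  assume "X I b \<noteq> 0"
  then obtain c where nz: "coef X I b c \<noteq> 0" and B: "(I, b) \<in> basis 0"
    using X unfolding coef_def supported_def by (metis lookup_zero poly_mapping_eqI)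
  have av: "I = {}" "avail b c = {}" using std[OF nz] by (auto simp: standard_def)
  have b: "b \<in> msets s" using B by (auto simp: basis_def msets_def)
  let ?e = "c + mexp b"
  \<comment> \<open>Among all terms of \<open>X\<close>, only the one at \<open>b\<close> and
    \<open>c\<close> can contribute to the exponent \<open>?e\<close>.\<close>
  have coeff_at: "Poly_Mapping.lookup (X {} b' * mon b') ?e = (if b' = b then coef X {} b c else 0)"
    if b': "b' \<in> msets s" for b'
  proof -
    let ?P = "\<forall>v. Poly_Mapping.lookup (mexp b') v \<le> Poly_Mapping.lookup ?e v"
    have l: "Poly_Mapping.lookup (X {} b' * mon b') ?e = (if ?P then coef X {} b' (?e - mexp b') else 0)"
      unfolding mon_def mult.commute[of "X {} b'"] lookup_single_mult by (simp add: coef_def)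
    show ?thesis
    proof (cases "b' = b")
      case True
      then show ?thesis using l unfolding True by (simp add: lookup_add)
    next
      case False
      have "coef X {} b' (?e - mexp b') = 0" if P: ?P
      proof (rule ccontr)
        assume "coef X {} b' (?e - mexp b') \<noteq> 0"
        then have av': "avail b' (?e - mexp b') = {}" using std by (auto simp: standard_def)
        have "?e - mexp b' + mexp b' = c + mexp b"
          using P by (intro poly_mapping_eqI) (simp add: lookup_add lookup_minus)
        from standard_unique[OF b' b this av' av(2)] False show False by simp
      qed
      then show ?thesis using False by (simp add: l)
    qed
  qed
  have "Poly_Mapping.lookup (aug_poly X) ?e = (\<Sum>b'\<in>msets s. if b' = b then coef X {} b c else 0)"
    unfolding aug_poly_def lookup_sum by (intro sum.cong refl coeff_at)
  also have "\<dots> = coef X I b c" using b av by simp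
  finally show False using nz aug by simp
qed

section \<open>Exactness of the strand\<close>

lemma d_zero: "d (\<lambda>_ _. 0) I b = 0"
  by (simp add: d_def theta_def)

text \<open>Subtracting \<open>d (h X)\<close> moves the nonstandard terms of a cycle to larger exponents of \<open>T\<^sub>n\<close>.\<close>
lemma exact_filtered:
  fixes X :: "('v, 'k::field) chain"
  assumes "supported i X" "\<And>I b. I \<subseteq> {1..<n} \<Longrightarrow> d X I b = 0" "i = 0 \<Longrightarrow> aug_poly X = 0"
    and "\<And>I b c. coef X I b c \<noteq> 0 \<Longrightarrow> \<not> standard I b c \<Longrightarrow> Suc s - k \<le> count b n"
  shows "\<exists>Y. supported (Suc i) Y \<and> (\<forall>I b. I \<subseteq> {1..<n} \<longrightarrow> X I b = d Y I b)"
  using assms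
proof (induction k arbitrary: X)
  case 0
  \<comment> \<open>The bound on the exponent of \<open>T_n\<close> is now \<open>Suc s\<close>,
    more than the size of any \<open>b\<close> in the strand, so only standard terms are
    left.\<close>
  have std: "standard I b c" if nz: "coef X I b c \<noteq> 0" for I b c
  proof (rule ccontr)
    assume "\<not> standard I b c"
    then have "Suc s \<le> count b n" using "0.prems"(4)[OF nz] by simp
    moreover have "X I b \<noteq> 0" using nz by (auto simp: coef_def)
    then have "(I, b) \<in> basis i" using "0.prems"(1) unfolding supported_def by blast
    then have "size b \<le> s" by (auto simp: basis_def)
    ultimately show False using count_le_size[of b n] by simp
  qed
  have "X I b = 0" for I b
  proof (cases "i = 0")
    case True
    then show ?thesis using aug_inj_standard[OF _ std] "0.prems"(1,3) by simp
  next
    case False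
    show ?thesis
    proof (rule ccontr)
      assume nz: "X I b \<noteq> 0"
      then obtain c where "coef X I b c \<noteq> 0"
        unfolding coef_def by (metis lookup_zero poly_mapping_eqI)
      then have "I = {}" using std by (auto simp: standard_def)
      moreover have "(I, b) \<in> basis i" using nz "0.prems"(1) unfolding supported_def by blast
      ultimately show False using False by (auto simp: basis_def)
    qed
  qed
  then show ?case by (intro exI[of _ "\<lambda>_ _. 0"]) (simp add: d_zero supported_def)
next
  case (Suc k)
  note sup = Suc.prems(1) and cyc = Suc.prems(2)
  let ?r = "Suc s - Suc k" and ?x = "coef X"
  \<comment> \<open>Off the standard terms, \<open>X'\<close> is the sum of the two composites of
    \<open>contract\<close> and \<open>trailing_d\<close> applied to \<open>X\<close>, and these
    raise the exponent of \<open>T_n\<close>.\<close>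
  define X' where "X' = (\<lambda>I b. X I b - d (h X) I b)"
  have sup': "supported i X'"
    unfolding X'_def by (intro supported_diff sup supported_d supported_h)
  have cyc': "d X' I b = 0" if "I \<subseteq> {1..<n}" for I b
    unfolding X'_def d_diff using cyc[OF that] d_d[OF that] by simp
  have aug': "aug_poly X' = 0" if "i = 0"
    unfolding X'_def aug_diff using Suc.prems(3)[OF that] by (simp add: aug_d)
  have trailing_count: "Suc ?r \<le> count b n" if "trailing_d ?x I b c \<noteq> 0" for I b c
    by (rule trailing_d_count[OF _ that]) (rule Suc.prems(4), auto simp: standard_def)
  have fil': "Suc s - k \<le> count b n" if nz: "coef X' I b c \<noteq> 0" and ns: "\<not> standard I b c" for I b c
  proof -
    have "X' I b \<noteq> 0" using nz by (auto simp: coef_def)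
    then have I: "I \<subseteq> {1..<n}" using sup' by (auto simp: supported_def basis_def)
    \<comment> \<open>\<open>X\<close> is a cycle, so its leading and trailing differentials agree
      wherever \<open>contract\<close> reads them.\<close>
    have "contract (leading_d ?x) I b c - contract (trailing_d ?x) I b c = contract (coef (d X)) I b c"
      unfolding contract_diff[symmetric] coef_d ..
    also have "\<dots> = 0"
    proof -
      have "I - {Min I} \<subseteq> {1..<n}" using I by auto
      then show ?thesis using cyc by (simp add: contract_def coef_def)
    qed
    finally have e1: "contract (leading_d ?x) I b c = contract (trailing_d ?x) I b c" by simp
    have e2: "leading_d (contract ?x) I b c + contract (leading_d ?x) I b c = ?x I b c"
      using ns by (intro leading_d_contract[OF I]) (auto simp: standard_def)
    have e3: "coef X' I b c = ?x I b c - (leading_d (contract ?x) I b c - trailing_d (contract ?x) I b c)"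
      unfolding coef_h[symmetric] coef_d[symmetric] by (simp add: X'_def coef_def lookup_minus)
    have "contract (trailing_d ?x) I b c + trailing_d (contract ?x) I b c = coef X' I b c"
      unfolding e3 e2[symmetric] e1 by simp
    with nz have "contract (trailing_d ?x) I b c \<noteq> 0 \<or> trailing_d (contract ?x) I b c \<noteq> 0" by auto
    then have "Suc ?r \<le> count b n"
    proof
      assume "contract (trailing_d ?x) I b c \<noteq> 0"
      then show ?thesis by (rule contract_count[rotated]) (rule trailing_count)
    next
      assume "trailing_d (contract ?x) I b c \<noteq> 0"
      then show ?thesis
        by (rule trailing_d_count[rotated]) (rule contract_count[OF Suc.prems(4)])
    qed
    then show ?thesis by simp
  qed
  have "\<exists>Y. supported (Suc i) Y \<and> (\<forall>I b. I \<subseteq> {1..<n} \<longrightarrow> X' I b = d Y I b)"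
    by (rule Suc.IH; (rule sup' | (rule cyc'; assumption) | (rule aug'; assumption) | (rule fil'; assumption)))
  then obtain Y where Y: "supported (Suc i) Y" "\<And>I b. I \<subseteq> {1..<n} \<Longrightarrow> X' I b = d Y I b"
    by blast
  show ?case
  proof (intro exI conjI allI impI)
    show "supported (Suc i) (\<lambda>I b. Y I b + h X I b)"
      by (intro supported_add Y supported_h sup)
    show "X I b = d (\<lambda>I b. Y I b + h X I b) I b" if "I \<subseteq> {1..<n}" for I b
      unfolding d_add Y(2)[OF that, symmetric] by (simp add: X'_def)
  qed
qed

lemma exact:
  fixes X :: "('v, 'k::field) chain"
  assumes "supported i X" "\<And>I b. I \<subseteq> {1..<n} \<Longrightarrow> d X I b = 0" "i = 0 \<Longrightarrow> aug_poly X = 0"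
  obtains Y where "supported (Suc i) Y" "\<And>I b. I \<subseteq> {1..<n} \<Longrightarrow> X I b = d Y I b"
proof -
  have "\<exists>Y. supported (Suc i) Y \<and> (\<forall>I b. I \<subseteq> {1..<n} \<longrightarrow> X I b = d Y I b)"
    \<comment> \<open>For \<open>k = Suc s\<close> the bound \<open>Suc s - k\<close> is 0, so the
      filtration starts with all chains.\<close>
    by (rule exact_filtered[where k = "Suc s"]) (simp_all add: assms)
  then show thesis using that by blast
qed

end


section \<open>The cover ideal and its powers\<close>

lemma mdegree_indicator_exp: "mdegree (indicator_exp A) = card A"
proof -
  have "mdegree (indicator_exp A) = (\<Sum>v\<in>UNIV. Poly_Mapping.lookup (indicator_exp A) v)"
    by (rule mdegree_eq_sum) auto
  then show ?thesis by (simp add: indicator_exp.rep_eq sum.If_cases)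
qed

lemma prod_var: "(\<Prod>v\<in>C. var v) = (Poly_Mapping.single (indicator_exp C) 1 :: ('v::finite, 'k::field) mpoly)"
proof (induction C rule: finite_induct[OF finite])
  case 1
  have "indicator_exp {} = (0 :: 'v \<Rightarrow>\<^sub>0 nat)" by (intro poly_mapping_eqI) (simp add: indicator_exp.rep_eq)
  then show ?case by (simp add: single_one)
next
  case (2 v C)
  have "Poly_Mapping.single v 1 + indicator_exp C = indicator_exp (insert v C)"
    using 2 by (intro poly_mapping_eqI) (auto simp: lookup_add indicator_exp.rep_eq lookup_single when_def)
  then show ?case using 2 by (simp add: var_def mult_single)
qed

context multipartite
begin

text \<open>A vertex of \<open>V i\<close> left out of a cover forces every vertex outside
  \<open>V i\<close> into it. So the covers are the sets containing the complement of a part, and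
  complements of distinct nonempty parts are incomparable.\<close>

lemma minimal_cover_set_iff:
  assumes E: "complete_multipartite n V E"
  shows "minimal_cover_set E C \<longleftrightarrow> (\<exists>j\<in>{1..n}. C = - V j)"
proof -
  have E_eq: "E = {{u, v} |u v. \<exists>i\<in>{1..n}. \<exists>j\<in>{1..n}. i \<noteq> j \<and> u \<in> V i \<and> v \<in> V j}"
    using E unfolding complete_multipartite_def by blast
  have part: "\<exists>i\<in>{1..n}. v \<in> V i" for v using union by blast
  have uniq: "i = j" if "i \<in> {1..n}" "j \<in> {1..n}" "v \<in> V i" "v \<in> V j" for i j v
    using disjoint_family_onD[OF disj, of i j] that by blast
  have cover: "cover_set E C \<longleftrightarrow> (\<exists>i\<in>{1..n}. - V i \<subseteq> C)" for C
  proof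
    assume C: "cover_set E C"
    show "\<exists>i\<in>{1..n}. - V i \<subseteq> C"
    proof (cases "C = UNIV")
      case True
      then show ?thesis using n2 by (intro bexI[of _ 1]) auto
    next
      case False
      then obtain u where u: "u \<notin> C" by auto
      obtain i where i: "i \<in> {1..n}" "u \<in> V i" using part by blast
      have "v \<in> C" if v: "v \<notin> V i" for v
      proof -
        obtain j where j: "j \<in> {1..n}" "v \<in> V j" using part by blast
        have "i \<noteq> j" using v j by auto
        with i j have "{u, v} \<in> E"
          unfolding E_eq by (intro CollectI exI[of _ u] exI[of _ v] conjI refl bexI[of _ i] bexI[of _ j]) simp_all
        then have "{u, v} \<inter> C \<noteq> {}" using C unfolding cover_set_def by blast
        with u show "v \<in> C" by auto
      qed
      with i show ?thesis by blast
    qed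
  next
    assume "\<exists>i\<in>{1..n}. - V i \<subseteq> C"
    then obtain i where i: "i \<in> {1..n}" "- V i \<subseteq> C" by blast
    show "cover_set E C"
      unfolding cover_set_def
    proof
      fix e assume "e \<in> E"
      then obtain u v a b where e: "e = {u, v}" "a \<in> {1..n}" "b \<in> {1..n}" "a \<noteq> b" "u \<in> V a" "v \<in> V b"
        unfolding E_eq by blast
      then have "u \<notin> V i \<or> v \<notin> V i" using uniq i(1) by metis
      then show "e \<inter> C \<noteq> {}" using i(2) e(1) by blast
    qed
  qed
  show ?thesis
  proof
    assume C: "minimal_cover_set E C"
    then obtain i where i: "i \<in> {1..n}" "- V i \<subseteq> C" by (auto simp: minimal_cover_set_def cover)
    have "v \<notin> V i" if "v \<in> C" for v
    proof
      assume "v \<in> V i"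
      then have "cover_set E (C - {v})" using i cover by blast
      with C that show False by (simp add: minimal_cover_set_def)
    qed
    with i show "\<exists>j\<in>{1..n}. C = - V j" by blast
  next
    assume "\<exists>j\<in>{1..n}. C = - V j"
    then obtain j where j: "j \<in> {1..n}" "C = - V j" by blast
    have "\<not> cover_set E (C - {v})" if "v \<in> C" for v
    proof
      assume "cover_set E (C - {v})"
      then obtain k where k: "k \<in> {1..n}" "- V k \<subseteq> C - {v}" unfolding cover by blast
      then have "V j \<subseteq> V k" "v \<in> V k" using j by auto
      moreover have "k = j" using nonempty[OF j(1)] \<open>V j \<subseteq> V k\<close> uniq[OF k(1) j(1)] by blast
      ultimately show False using that j by simp
    qed
    then show "minimal_cover_set E C" unfolding minimal_cover_set_def cover using j by blast
  qed
qed

text \<open>Written with one coefficient per multiset, in the shape of \<open>aug_poly\<close>, so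
  that for \<open>t = s\<close> it is visibly the image of the augmentation.\<close>

definition span_mon :: "nat \<Rightarrow> ('v, 'k::field) mpoly set" where
  "span_mon t = range (\<lambda>f. \<Sum>b\<in>msets t. f b * mon b)"

lemma span_mon_zero: "0 \<in> span_mon t"
  unfolding span_mon_def by (intro range_eqI[of _ _ "\<lambda>_. 0"]) simp

lemma span_mon_add: "x \<in> span_mon t \<Longrightarrow> z \<in> span_mon t \<Longrightarrow> x + z \<in> span_mon t"
proof -
  assume "x \<in> span_mon t" "z \<in> span_mon t"
  then obtain f g where "x = (\<Sum>b\<in>msets t. f b * mon b)" "z = (\<Sum>b\<in>msets t. g b * mon b)"
    by (auto simp: span_mon_def)
  then have "x + z = (\<Sum>b\<in>msets t. (f b + g b) * mon b)"
    by (simp add: distrib_right sum.distrib)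
  then show ?thesis unfolding span_mon_def by (intro range_eqI[of _ _ "\<lambda>b. f b + g b"]) simp
qed

lemma span_mon_mult: "x \<in> span_mon t \<Longrightarrow> c * x \<in> span_mon t"
proof -
  assume "x \<in> span_mon t"
  then obtain f where "x = (\<Sum>b\<in>msets t. f b * mon b)" by (auto simp: span_mon_def)
  then have "c * x = (\<Sum>b\<in>msets t. (c * f b) * mon b)"
    by (simp add: sum_distrib_left mult.assoc)
  then show ?thesis unfolding span_mon_def by (intro range_eqI[of _ _ "\<lambda>b. c * f b"]) simp
qed

lemma span_mon_mult_right: "x \<in> span_mon t \<Longrightarrow> x * c \<in> span_mon t"
  using span_mon_mult[of x t c] by (simp add: mult.commute)

lemma span_mon_sum: "(\<And>i. i \<in> A \<Longrightarrow> f i \<in> span_mon t) \<Longrightarrow> sum f A \<in> span_mon t"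
  by (induction A rule: infinite_finite_induct) (auto intro: span_mon_add span_mon_zero)

lemma mon_in_span: "b \<in> msets t \<Longrightarrow> mon b \<in> span_mon t"
  unfolding span_mon_def
  by (intro range_eqI[of _ _ "\<lambda>b'. if b' = b then 1 else 0"]) (simp add: if_distrib[of "\<lambda>x. x * _"] cong: if_cong)

lemma ideal_span_mon: "ideal (span_mon t) (class_ring :: ('v, 'k::field) mpoly ring)"
proof (rule idealI)
  show "ring (class_ring :: ('v, 'k) mpoly ring)" by (rule class_ring.ring_axioms)
  show "subgroup (span_mon t) (add_monoid (class_ring :: ('v, 'k) mpoly ring))"
  proof (rule group.subgroupI)
    show "group (add_monoid (class_ring :: ('v, 'k) mpoly ring))"
      using class_ring.add.group_axioms by simp
    show "span_mon t \<noteq> {}" using span_mon_zero by auto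
    fix x :: "('v, 'k) mpoly" assume x: "x \<in> span_mon t"
    have "a_inv (class_ring :: ('v, 'k) mpoly ring) x = - x"
      by (simp only: class_ring_simps)
    then show "inv\<^bsub>add_monoid class_ring\<^esub> x \<in> span_mon t"
      using span_mon_mult[OF x, of "-1"] by (simp add: a_inv_def)
  qed (auto intro: span_mon_add)
qed (auto intro: span_mon_mult span_mon_mult_right)

lemma mon_add: "mon (b + b') = mon b * mon b'"
  by (simp add: mon_def mexp_def mult_single)

lemma msets_Suc: "b \<in> msets (Suc t) \<longleftrightarrow> (\<exists>j\<in>{1..n}. \<exists>b'\<in>msets t. b = add_mset j b')"
proof
  assume b: "b \<in> msets (Suc t)"
  then obtain j b' where "b = add_mset j b'"
    by (metis (mono_tags, lifting) mem_Collect_eq msets_def size_eq_Suc_imp_eq_union)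
  with b show "\<exists>j\<in>{1..n}. \<exists>b'\<in>msets t. b = add_mset j b'"
    by (intro bexI[of _ j] bexI[of _ b']) (auto simp: msets_def)
next
  assume "\<exists>j\<in>{1..n}. \<exists>b'\<in>msets t. b = add_mset j b'"
  then obtain j b' where "j \<in> {1..n}" "b' \<in> msets t" "b = add_mset j b'" by blast
  then show "b \<in> msets (Suc t)" by (auto simp: msets_def)
qed

lemma cover_ideal_eq:
  assumes E: "complete_multipartite n V E"
  shows "(cover_ideal E :: ('v, 'k::field) mpoly set) = span_mon 1"
proof -
  have gen: "{\<Prod>v\<in>C. var v |C. minimal_cover_set E C} = ((\<lambda>j. mon {#j#}) ` {1..n} :: ('v, 'k) mpoly set)"
    unfolding minimal_cover_set_iff[OF E] prod_var by (auto simp: mon_def mexp_def)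
  let ?R = "class_ring :: ('v, 'k) mpoly ring"
  define I where "I = Idl\<^bsub>?R\<^esub> ((\<lambda>j. mon {#j#}) ` {1..n})"
  have id: "ideal I ?R"
    unfolding I_def by (rule ring.genideal_ideal[OF class_ring.ring_axioms]) simp
  have sub: "(\<lambda>j. mon {#j#}) ` {1..n} \<subseteq> I"
    unfolding I_def by (rule ring.genideal_self[OF class_ring.ring_axioms]) simp
  note cl = class_ideal_simps[OF id]
  have sumcl: "(\<Sum>b\<in>A. f b) \<in> I"
    if "\<And>b. b \<in> A \<Longrightarrow> f b \<in> I" for f and A :: "nat multiset set"
    using that by (induction A rule: infinite_finite_induct) (auto intro: cl(1,2))
  show ?thesis
    unfolding cover_ideal_def gen I_def[symmetric]
  proof
    show "I \<subseteq> span_mon 1"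
      unfolding I_def by (rule ring.genideal_minimal[OF class_ring.ring_axioms ideal_span_mon]) (auto intro!: mon_in_span simp: msets_def)
    show "span_mon 1 \<subseteq> I"
    proof
      fix x assume "x \<in> (span_mon 1 :: ('v, 'k) mpoly set)"
      then obtain f where x: "x = (\<Sum>b\<in>msets 1. f b * mon b)" by (auto simp: span_mon_def)
      show "x \<in> I"
        unfolding x
      proof (rule sumcl)
        fix b assume "b \<in> msets 1"
        then obtain j where "j \<in> {1..n}" "b = {#j#}"
          using size_1_singleton_mset[of b] by (auto simp: msets_def)
        then show "f b * mon b \<in> I" using sub by (intro cl(3)) auto
      qed
    qed
  qed
qed

text \<open>Products of generators add the multisets, and conversely one member can be split off.
  For \<open>t = 0\<close> the empty multiset contributes 1, so the span is the whole ring.\<close>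

lemma ideal_power_span_mon: "ideal_power (span_mon 1) t = (span_mon t :: ('v, 'k::field) mpoly set)"
proof (induction t)
  case 0
  have "msets 0 = {{#}}" by (auto simp: msets_def)
  then have "(span_mon 0 :: ('v, 'k) mpoly set) = UNIV"
    by (auto simp: span_mon_def mon_def mexp_def single_one intro!: range_eqI[of _ _ "\<lambda>_. _"])
  then show ?case by (simp add: ideal_power_def nat_pow_def ideals_set_def)
next
  case (Suc t)
  let ?R = "class_ring :: ('v, 'k) mpoly ring"
  have "ideal_power (span_mon 1) (Suc t) = ideal_prod ?R (span_mon t) (span_mon 1)"
    using Suc.IH by (simp add: ideal_power_def nat_pow_def ideals_set_def)
  also have "\<dots> = span_mon (Suc t)"
  proof
    show "ideal_prod ?R (span_mon t) (span_mon 1) \<subseteq> span_mon (Suc t)"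
    proof
      fix x assume "x \<in> ideal_prod ?R (span_mon t) (span_mon 1)"
      then show "x \<in> span_mon (Suc t)"
      proof induction
        case (prod i j)
        then obtain f g where ij: "i = (\<Sum>b\<in>msets t. f b * mon b)" "j = (\<Sum>b\<in>msets 1. g b * mon b)"
          by (auto simp: span_mon_def)
        have "i * j = (\<Sum>b\<in>msets t. \<Sum>b'\<in>msets 1. f b * mon b * (g b' * mon b'))"
          unfolding ij by (rule sum_product)
        also have "\<dots> = (\<Sum>b\<in>msets t. \<Sum>b'\<in>msets 1. f b * g b' * mon (b + b'))"
          by (simp add: mon_add mult_ac)
        also have "\<dots> \<in> span_mon (Suc t)"
          by (intro span_mon_sum span_mon_mult mon_in_span) (auto simp: msets_def)
        finally show ?case by simp
      qed (simp add: span_mon_add)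
    qed
    show "span_mon (Suc t) \<subseteq> ideal_prod ?R (span_mon t) (span_mon 1)"
    proof
      fix x assume "x \<in> (span_mon (Suc t) :: ('v, 'k) mpoly set)"
      then obtain f where x: "x = (\<Sum>b\<in>msets (Suc t). f b * mon b)" by (auto simp: span_mon_def)
      have sumcl: "(\<Sum>b\<in>A. g b) \<in> ideal_prod ?R (span_mon t) (span_mon 1)"
        if "\<And>b. b \<in> A \<Longrightarrow> g b \<in> ideal_prod ?R (span_mon t) (span_mon 1)" for g and A :: "nat multiset set"
        using that
      proof (induction A rule: infinite_finite_induct)
        case (insert a A)
        then show ?case
          using ideal_prod.sum[of "g a" ?R "span_mon t" "span_mon 1" "\<Sum>b\<in>A. g b"] by simp
      qed (use ideal_prod.prod[OF span_mon_zero span_mon_zero, of ?R] in simp_all)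
      show "x \<in> ideal_prod ?R (span_mon t) (span_mon 1)"
        unfolding x
      proof (rule sumcl)
        fix b assume "b \<in> msets (Suc t)"
        then obtain j b' where b: "j \<in> {1..n}" "b' \<in> msets t" "b = add_mset j b'"
          unfolding msets_Suc by blast
        have "f b * mon b = (f b * mon b') * mon {#j#}"
          by (simp add: b mult.assoc mon_add[of b' "{#j#}", simplified])
        moreover have "mon {#j#} \<in> (span_mon 1 :: ('v, 'k) mpoly set)"
          using b by (intro mon_in_span) (simp add: msets_def)
        moreover have "f b * mon b' \<in> span_mon t"
          by (intro span_mon_mult mon_in_span b)
        ultimately show "f b * mon b \<in> ideal_prod ?R (span_mon t) (span_mon 1)"
          using ideal_prod.prod[of "f b * mon b'" "span_mon t" "mon {#j#}" "span_mon 1" ?R] by simp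
      qed
    qed
  qed
  finally show ?case .
qed

end

section \<open>The resolution of a power of the cover ideal\<close>

context multipartite
begin

text \<open>Matrices are indexed by natural numbers; any numbering of the finite basis will
  do.\<close>

definition enum :: "nat \<Rightarrow> nat \<Rightarrow> nat set \<times> nat multiset" where
  "enum i = (SOME f. bij_betw f {0..<card (basis i)} (basis i))"

lemma finite_basis [simp]: "finite (basis i)"
proof (rule finite_subset)
  show "basis i \<subseteq> Pow {1..<n} \<times> msets (s - i)" by (auto simp: basis_def msets_def)
qed simp

lemma bij_enum: "bij_betw (enum i) {0..<card (basis i)} (basis i)"
  unfolding enum_def by (rule someI_ex[OF ex_bij_betw_nat_finite]) simp

lemma enum_in: "p < card (basis i) \<Longrightarrow> enum i p \<in> basis i"
  using bij_betwE[OF bij_enum] by auto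

lemma enum_surj: "z \<in> basis i \<Longrightarrow> \<exists>p<card (basis i). enum i p = z"
  using bij_betw_imp_surj_on[OF bij_enum[of i]] by (metis atLeastLessThan_iff imageE)

definition vec_of :: "nat \<Rightarrow> ('v, 'k::field) chain \<Rightarrow> ('v, 'k) mpoly vec" where
  "vec_of i X = vec (card (basis i)) (\<lambda>p. X (fst (enum i p)) (snd (enum i p)))"

lemma vec_of_carrier [simp]: "vec_of i X \<in> carrier_vec (card (basis i))"
  by (simp add: vec_of_def)

lemma vec_of_surj:
  assumes x: "x \<in> carrier_vec (card (basis i))"
  obtains X where "supported i X" "vec_of i X = x"
proof -
  define X where "X I b = (if (I, b) \<in> basis i
    then x $ (inv_into {0..<card (basis i)} (enum i) (I, b)) else 0)" for I b
  have "vec_of i X = x"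
  proof (rule eq_vecI)
    fix p assume "p < dim_vec x"
    then have p: "p < card (basis i)" using x by simp
    then have "inv_into {0..<card (basis i)} (enum i) (enum i p) = p"
      using bij_enum[of i] by (intro inv_into_f_f) (auto simp: bij_betw_def)
    then show "vec_of i X $ p = x $ p"
      using p enum_in[OF p] by (simp add: vec_of_def X_def)
  qed (use x in \<open>simp add: vec_of_def\<close>)
  moreover have "supported i X" by (simp add: supported_def X_def)
  ultimately show thesis by (rule that[rotated])
qed

lemma vec_of_cong: "(\<And>I b. (I, b) \<in> basis i \<Longrightarrow> X I b = Z I b) \<Longrightarrow> vec_of i X = vec_of i Z"
  unfolding vec_of_def by (intro eq_vecI) (auto dest!: enum_in simp: surj_pair)

lemma vec_of_eq_0_iff: "vec_of i X = 0\<^sub>v (card (basis i)) \<longleftrightarrow> (\<forall>I b. (I, b) \<in> basis i \<longrightarrow> X I b = 0)"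
proof
  assume eq: "vec_of i X = 0\<^sub>v (card (basis i))"
  show "\<forall>I b. (I, b) \<in> basis i \<longrightarrow> X I b = 0"
  proof (intro allI impI)
    fix I b assume "(I, b) \<in> basis i"
    then obtain p where "p < card (basis i)" "enum i p = (I, b)" using enum_surj by blast
    then show "X I b = 0" using arg_cong[OF eq, of "\<lambda>v. v $ p"] by (simp add: vec_of_def)
  qed
next
  assume "\<forall>I b. (I, b) \<in> basis i \<longrightarrow> X I b = 0"
  then show "vec_of i X = 0\<^sub>v (card (basis i))"
    by (intro eq_vecI) (auto simp: vec_of_def dest!: enum_in)
qed

text \<open>The coefficient with which \<open>d X\<close> at \<open>z\<close> involves
  \<open>X\<close> at \<open>z'\<close>. As a sum over \<open>j\<close> it matches \<open>d\<close>
  after an exchange of sums.\<close>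

definition entry :: "nat set \<times> nat multiset \<Rightarrow> nat set \<times> nat multiset \<Rightarrow> ('v, 'k::field) mpoly" where
  "entry z z' = (\<Sum>j\<in>{1..<n} - fst z. koszul_sign j (fst z) *
     ((if z' = (insert j (fst z), snd z - {#j#}) \<and> j \<in># snd z then y j else 0)
      - (if z' = (insert j (fst z), snd z - {#n#}) \<and> n \<in># snd z then y n else 0)))"

lemma sum_entry:
  assumes X: "supported i X"
  shows "(\<Sum>z'\<in>basis i. entry (I, b) z' * X (fst z') (snd z')) = d X I b"
proof -
  \<comment> \<open>If \<open>z0\<close> is outside the basis, the left side has no term for it and
    the right side is 0 because \<open>X\<close> is supported on the basis.\<close>
  have delta: "(\<Sum>z'\<in>basis i. (if z' = z0 \<and> P then a else 0) * X (fst z') (snd z'))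
      = (if P then a * X (fst z0) (snd z0) else 0)" for z0 P a
  proof -
    have "(\<Sum>z'\<in>basis i. (if z' = z0 \<and> P then a else 0) * X (fst z') (snd z'))
        = (\<Sum>z'\<in>basis i. if z' = z0 then (if P then a * X (fst z0) (snd z0) else 0) else 0)"
      by (intro sum.cong) auto
    also have "\<dots> = (if z0 \<in> basis i then (if P then a * X (fst z0) (snd z0) else 0) else 0)"
      by simp
    also have "\<dots> = (if P then a * X (fst z0) (snd z0) else 0)"
    proof -
      have "X (fst z0) (snd z0) = 0" if "z0 \<notin> basis i"
        using X that unfolding supported_def by (metis prod.collapse)
      then show ?thesis by simp
    qed
    finally show ?thesis .
  qed
  have "(\<Sum>z'\<in>basis i. entry (I, b) z' * X (fst z') (snd z'))
      = (\<Sum>z'\<in>basis i. \<Sum>j\<in>{1..<n} - I. koszul_sign j I *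
          ((if z' = (insert j I, b - {#j#}) \<and> j \<in># b then y j else 0) * X (fst z') (snd z')
           - (if z' = (insert j I, b - {#n#}) \<and> n \<in># b then y n else 0) * X (fst z') (snd z')))"
    unfolding entry_def fst_conv snd_conv sum_distrib_right
    by (intro sum.cong refl) (simp only: mult.assoc left_diff_distrib)
  also have "\<dots> = (\<Sum>j\<in>{1..<n} - I. koszul_sign j I * theta j (X (insert j I)) b)"
    by (subst sum.swap) (simp only: sum_distrib_left[symmetric] sum_subtractf delta theta_def fst_conv snd_conv)
  finally show ?thesis by (simp add: d_def)
qed

section \<open>The resolution as a sequence of graded matrices\<close>

definition res_rank :: "nat \<Rightarrow> nat" where
  "res_rank i = (case i of 0 \<Rightarrow> 1 | Suc i' \<Rightarrow> card (basis i'))"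

text \<open>Each \<open>e_j\<close> has degree \<open>card UNIV\<close>, because
  \<open>y_j T_j\<close> and \<open>y_n T_n\<close> both map to the product of all
  variables.\<close>

definition basis_degree :: "nat set \<times> nat multiset \<Rightarrow> int" where
  "basis_degree z = int (mdegree (mexp (snd z))) + int (card (fst z)) * int (card (UNIV :: 'v set))"

definition res_shift :: "nat \<Rightarrow> nat \<Rightarrow> int" where
  "res_shift i p = (case i of 0 \<Rightarrow> 0 | Suc i' \<Rightarrow> basis_degree (enum i' p))"

text \<open>The strand resolves the power of the ideal. For the quotient it is shifted by one, with
  the row of monomial generators as first differential.\<close>

definition res_bd :: "nat \<Rightarrow> ('v, 'k::field) mpoly mat" where
  "res_bd i = (case i of
     0 \<Rightarrow> mat 1 (card (basis 0)) (\<lambda>(_, q). mon (snd (enum 0 q)))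
   | Suc i' \<Rightarrow> mat (card (basis i')) (card (basis (Suc i'))) (\<lambda>(p, q). entry (enum i' p) (enum (Suc i') q)))"

lemma res_simps [simp]:
  "res_rank 0 = 1" "res_rank (Suc i) = card (basis i)"
  "res_shift 0 p = 0" "res_shift (Suc i) p = basis_degree (enum i p)"
  by (simp_all add: res_rank_def res_shift_def)

lemma res_bd_carrier: "res_bd i \<in> carrier_mat (res_rank i) (res_rank (Suc i))"
  by (cases i) (simp_all add: res_bd_def)

lemma res_bd_Suc_mult:
  assumes X: "supported (Suc i) X"
  shows "res_bd (Suc i) *\<^sub>v vec_of (Suc i) X = vec_of i (d X)"
proof (rule eq_vecI)
  fix p assume "p < dim_vec (vec_of i (d X))"
  then have p: "p < card (basis i)" by (simp add: vec_of_def)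
  let ?e = "enum (Suc i)"
  have "(res_bd (Suc i) *\<^sub>v vec_of (Suc i) X) $ p
      = (\<Sum>q\<in>{0..<card (basis (Suc i))}. entry (enum i p) (?e q) * X (fst (?e q)) (snd (?e q)))"
    using p by (simp add: res_bd_def vec_of_def scalar_prod_def)
  also have "\<dots> = (\<Sum>z'\<in>basis (Suc i). entry (enum i p) z' * X (fst z') (snd z'))"
    by (rule sum.reindex_bij_betw[OF bij_enum])
  also have "\<dots> = d X (fst (enum i p)) (snd (enum i p))"
    using sum_entry[OF X, of "fst (enum i p)" "snd (enum i p)"] by simp
  finally show "(res_bd (Suc i) *\<^sub>v vec_of (Suc i) X) $ p = vec_of i (d X) $ p"
    using p by (simp add: vec_of_def)
qed (simp add: res_bd_def vec_of_def)

lemma basis_0: "basis 0 = Pair {} ` msets s"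
  by (auto simp: basis_def msets_def dest: finite_subset)

lemma res_bd_0_mult: "res_bd 0 *\<^sub>v vec_of 0 X = vec 1 (\<lambda>_. aug_poly X)"
proof (rule eq_vecI)
  fix p assume "p < dim_vec (vec 1 (\<lambda>_. aug_poly X))"
  then have p: "p = 0" by simp
  have "(res_bd 0 *\<^sub>v vec_of 0 X) $ 0
      = (\<Sum>q\<in>{0..<card (basis 0)}. mon (snd (enum 0 q)) * X (fst (enum 0 q)) (snd (enum 0 q)))"
    by (simp add: res_bd_def vec_of_def scalar_prod_def)
  also have "\<dots> = (\<Sum>z\<in>basis 0. mon (snd z) * X (fst z) (snd z))"
    by (rule sum.reindex_bij_betw[OF bij_enum])
  also have "\<dots> = aug_poly X"
    unfolding basis_0 by (subst sum.reindex) (auto simp: inj_on_def aug_poly_def mult.commute)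
  finally show "(res_bd 0 *\<^sub>v vec_of 0 X) $ p = vec 1 (\<lambda>_. aug_poly X) $ p" by (simp add: p)
qed (simp add: res_bd_def)

lemma y_forms: "y j \<in> forms (int (card (V j)))"
  by (auto simp: y_def forms_def mdegree_indicator_exp)

text \<open>Removing \<open>k\<close> from \<open>b\<close> costs the size of the complement of
  \<open>V k\<close>, and the new \<open>e_j\<close> adds \<open>card UNIV\<close>. What remains is
  the degree of \<open>y k\<close>.\<close>

lemma basis_degree_remove:
  assumes "k \<in># b" "j \<notin> I" "finite I"
  shows "basis_degree (insert j I, b - {#k#}) - basis_degree (I, b) = int (card (V k))"
proof -
  have "mexp b = indicator_exp (- V k) + mexp (b - {#k#})"
    using assms(1) by (metis insert_DiffM mexp_def sum_mset.insert image_mset_add_mset)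
  then have "mdegree (mexp b) = card (- V k) + mdegree (mexp (b - {#k#}))"
    by (simp add: mdegree_add mdegree_indicator_exp)
  moreover have "card (- V k) + card (V k) = card (UNIV :: 'v set)"
    by (metis add.commute card_Un_disjoint Compl_disjoint Compl_partition finite)
  ultimately show ?thesis using assms(2,3) by (simp add: basis_degree_def distrib_right)
qed

lemma forms_koszul_sign_mult: "f \<in> forms j \<Longrightarrow> koszul_sign i I * f \<in> forms j"
  by (auto simp: forms_def in_keys_iff lookup_koszul_sign_mult)

lemma entry_forms:
  assumes z: "z \<in> basis i"
  shows "entry z z' \<in> forms (basis_degree z' - basis_degree z)"
proof -
  obtain I b where z_eq: "z = (I, b)" by fastforce
  have fI: "finite I" using z by (auto simp: z_eq basis_def dest: finite_subset)
  have *: "(if z' = (insert j I, b - {#k#}) \<and> k \<in># b then y k else 0)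
      \<in> forms (basis_degree z' - basis_degree (I, b))"
    if "j \<notin> I" for j k
    using basis_degree_remove[OF _ that fI, of k b] y_forms[of k] by auto
  show ?thesis
    unfolding entry_def z_eq fst_conv snd_conv
    by (intro forms_sum forms_koszul_sign_mult forms_diff *) auto
qed

lemma res_bd_graded: "graded_mat (res_rank i) (res_shift i) (res_rank (Suc i)) (res_shift (Suc i)) (res_bd i)"
  unfolding graded_mat_def
proof (intro conjI allI impI res_bd_carrier)
  fix p q assume pq: "p < res_rank i" "q < res_rank (Suc i)"
  show "res_bd i $$ (p, q) \<in> forms (res_shift (Suc i) q - res_shift i p)"
  proof (cases i)
    case 0
    then have "enum 0 q \<in> basis 0" using pq by (intro enum_in) simp
    then have "fst (enum 0 q) = {}" unfolding basis_0 by auto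
    then show ?thesis using pq 0
      by (auto simp: res_bd_def basis_degree_def mon_def forms_def)
  next
    case (Suc i')
    then show ?thesis using pq entry_forms[OF enum_in[of p i'], of "enum i q"] by (simp add: res_bd_def)
  qed
qed

lemma res_exact:
  "mat_kernel (res_bd i :: ('v, 'k::field) mpoly mat)
    = (\<lambda>x. res_bd (Suc i) *\<^sub>v x) ` carrier_vec (res_rank (Suc (Suc i)))"
proof (intro equalityI subsetI)
  fix x :: "('v, 'k) mpoly vec" assume x: "x \<in> mat_kernel (res_bd i)"
  then have xc: "x \<in> carrier_vec (card (basis i))" and x0: "res_bd i *\<^sub>v x = 0\<^sub>v (res_rank i)"
    using mat_kernelD[OF res_bd_carrier[of i]] by auto
  obtain X where X: "supported i X" "vec_of i X = x" by (rule vec_of_surj[OF xc])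
  have cyc: "d X I b = 0" if I: "I \<subseteq> {1..<n}" for I b
  proof (cases i)
    case 0
    \<comment> \<open>In degree 0 the basis has empty index sets only, so \<open>X\<close> vanishes
      wherever \<open>d\<close> reads it.\<close>
    have "X (insert j I) b' = 0" for j b'
    proof (rule ccontr)
      assume "X (insert j I) b' \<noteq> 0"
      then have "(insert j I, b') \<in> basis 0" using X(1) 0 unfolding supported_def by blast
      then show False using finite_subset[OF I] by (simp add: basis_def)
    qed
    then show ?thesis by (simp add: d_def theta_def)
  next
    case (Suc i')
    then have "vec_of i' (d X) = 0\<^sub>v (card (basis i'))"
      using x0 X res_bd_Suc_mult[of i' X] by simp
    moreover have "supported i' (d X)" using X(1) Suc by (intro supported_d) simp
    ultimately show ?thesis unfolding vec_of_eq_0_iff supported_def by blast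
  qed
  have aug: "aug_poly X = 0" if "i = 0"
  proof -
    have "vec 1 (\<lambda>_. aug_poly X) = 0\<^sub>v 1" using x0 X(2) res_bd_0_mult[of X] that by simp
    from arg_cong[OF this, of "\<lambda>v. v $ 0"] show ?thesis by simp
  qed
  obtain Y where Y: "supported (Suc i) Y" "\<And>I b. I \<subseteq> {1..<n} \<Longrightarrow> X I b = d Y I b"
    using exact[OF X(1)] cyc aug by metis
  have "x = vec_of i (d Y)"
    unfolding X(2)[symmetric] by (rule vec_of_cong) (auto simp: Y(2) basis_def)
  also have "\<dots> = res_bd (Suc i) *\<^sub>v vec_of (Suc i) Y"
    by (rule res_bd_Suc_mult[OF Y(1), symmetric])
  finally show "x \<in> (\<lambda>x. res_bd (Suc i) *\<^sub>v x) ` carrier_vec (res_rank (Suc (Suc i)))" by auto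
next
  fix x :: "('v, 'k) mpoly vec"
  assume "x \<in> (\<lambda>x. res_bd (Suc i) *\<^sub>v x) ` carrier_vec (res_rank (Suc (Suc i)))"
  then obtain z where z: "z \<in> carrier_vec (card (basis (Suc i)))" "x = res_bd (Suc i) *\<^sub>v z" by auto
  obtain Y where Y: "supported (Suc i) Y" "vec_of (Suc i) Y = z" by (rule vec_of_surj[OF z(1)])
  have x: "x = vec_of i (d Y)" using res_bd_Suc_mult[OF Y(1)] Y(2) z(2) by simp
  have "res_bd i *\<^sub>v x = 0\<^sub>v (res_rank i)"
  proof (cases i)
    case 0
    then show ?thesis unfolding x using res_bd_0_mult[of "d Y"] by (auto simp: aug_d)
  next
    case (Suc i')
    have "res_bd i *\<^sub>v x = vec_of i' (d (d Y))"
      unfolding x Suc using supported_d[OF Y(1)] by (intro res_bd_Suc_mult) (simp add: Suc)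
    also have "\<dots> = 0\<^sub>v (card (basis i'))"
      unfolding vec_of_eq_0_iff by (auto simp: basis_def d_d)
    finally show ?thesis by (simp add: Suc)
  qed
  then show "x \<in> mat_kernel (res_bd i)"
    unfolding x by (intro mat_kernelI[OF res_bd_carrier]) simp_all
qed

lemma res_presents:
  "presents_cyclic (span_mon s) res_rank res_shift res_bd (1\<^sub>m 1 :: ('v, 'k::field) mpoly mat)"
  unfolding presents_cyclic_def
proof (intro conjI)
  show "graded_exact_sequence res_rank res_shift (res_bd :: nat \<Rightarrow> ('v, 'k) mpoly mat)"
    by unfold_locales (rule res_bd_graded, rule res_exact)
  show "graded_mat 1 (\<lambda>_. 0) (res_rank 0) (res_shift 0) (1\<^sub>m 1 :: ('v, 'k) mpoly mat)"
    using graded_mat_one[of 1 "\<lambda>_. 0"] by (simp add: graded_mat_def)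
  have "{x \<in> carrier_vec 1. x $ 0 \<in> (span_mon s :: ('v, 'k) mpoly set)}
      = (\<lambda>x. res_bd 0 *\<^sub>v x) ` carrier_vec (card (basis 0))"
  proof (intro equalityI subsetI)
    fix x :: "('v, 'k) mpoly vec" assume x: "x \<in> {x \<in> carrier_vec 1. x $ 0 \<in> span_mon s}"
    then obtain f where f: "x $ 0 = (\<Sum>b\<in>msets s. f b * mon b)" by (auto simp: span_mon_def)
    have "res_bd 0 *\<^sub>v vec_of 0 (\<lambda>_. f) = x"
      unfolding res_bd_0_mult using x by (intro eq_vecI) (auto simp: aug_poly_def f)
    then show "x \<in> (\<lambda>x. res_bd 0 *\<^sub>v x) ` carrier_vec (card (basis 0))"
      using vec_of_carrier by blast
  next
    fix x :: "('v, 'k) mpoly vec" assume "x \<in> (\<lambda>x. res_bd 0 *\<^sub>v x) ` carrier_vec (card (basis 0))"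
    then obtain z where z: "z \<in> carrier_vec (card (basis 0))" "x = res_bd 0 *\<^sub>v z" by auto
    obtain X where "vec_of 0 X = z" using vec_of_surj[OF z(1)] by blast
    then have "x = vec 1 (\<lambda>_. aug_poly X)" using z(2) res_bd_0_mult by metis
    then show "x \<in> {x \<in> carrier_vec 1. x $ 0 \<in> span_mon s}"
      by (auto simp: aug_poly_def span_mon_def)
  qed
  moreover have "{x \<in> carrier_vec 1. (1\<^sub>m 1 *\<^sub>v x) $ 0 \<in> (span_mon s :: ('v, 'k) mpoly set)}
      = {x \<in> carrier_vec 1. x $ 0 \<in> span_mon s}"
    by (intro Collect_cong conj_cong refl) (simp only: one_mult_mat_vec)
  ultimately show "{x \<in> carrier_vec (res_rank 0). (1\<^sub>m 1 *\<^sub>v x) $ 0 \<in> (span_mon s :: ('v, 'k) mpoly set)}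
      = (\<lambda>x. res_bd 0 *\<^sub>v x) ` carrier_vec (res_rank 1)"
    by (simp only: res_simps One_nat_def)
  show "\<exists>x\<in>carrier_vec (res_rank 0). (1\<^sub>m 1 *\<^sub>v x) $ 0 - 1 \<in> (span_mon s :: ('v, 'k) mpoly set)"
    using span_mon_zero by (intro bexI[of _ "vec 1 (\<lambda>_. 1)"]) (simp_all add: scalar_prod_def)
qed

section \<open>Degrees, minimality and the maximum\<close>

lemma card_V: "j \<in> {1..n} \<Longrightarrow> 1 \<le> card (V j)"
  using nonempty[of j] by (simp add: Suc_le_eq card_gt_0_iff)

lemma sum_card_V: "(\<Sum>j\<in>{1..n}. card (V j)) = card (UNIV :: 'v set)"
  using card_UN_disjoint'[OF disj] union by simp

text \<open>There is a second part and it is nonempty. This makes the generators nonconstant and the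
  regularity nonnegative.\<close>

lemma card_V_less: "j \<in> {1..n} \<Longrightarrow> card (V j) < card (UNIV :: 'v set)"
proof -
  assume j: "j \<in> {1..n}"
  obtain k where k: "k \<in> {1..n}" "k \<noteq> j"
    using n2 by (metis atLeastAtMost_iff le_refl less_eq_Suc_le numeral_2_eq_2 one_le_numeral
        order_trans Suc_n_not_le_n One_nat_def)
  have "card (V j) + card (V k) \<le> card (UNIV :: 'v set)"
    unfolding sum_card_V[symmetric]
    using sum_mono2[of "{1..n}" "{j, k}" "\<lambda>j. card (V j)"] j k by simp
  with card_V[OF k(1)] show ?thesis by linarith
qed

lemma mdegree_mexp:
  "set_mset b \<subseteq> {1..n} \<Longrightarrow> int (mdegree (mexp b)) = int (size b) * int (card (UNIV :: 'v set)) - (\<Sum>j\<in>#b. int (card (V j)))"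
proof (induction b)
  case empty
  then show ?case by (simp add: mexp_def mdegree_def)
next
  case (add j b)
  have "card (- V j) + card (V j) = card (UNIV :: 'v set)"
    by (metis add.commute card_Un_disjoint Compl_disjoint Compl_partition finite)
  moreover have "mdegree (mexp (add_mset j b)) = card (- V j) + mdegree (mexp b)"
    by (simp add: mexp_def mdegree_add mdegree_indicator_exp)
  ultimately show ?case using add by (simp add: algebra_simps)
qed

lemma y_const: "j \<in> {1..n} \<Longrightarrow> Poly_Mapping.lookup (y j) 0 = 0"
  using nonempty[of j] by (intro forms_const_zero[OF y_forms]) simp

lemma entry_const: "Poly_Mapping.lookup (entry z z' :: ('v, 'k::field) mpoly) 0 = 0"
  unfolding entry_def lookup_sum lookup_koszul_sign_mult
proof (rule sum.neutral, rule ballI)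
  fix j assume "j \<in> {1..<n} - fst z"
  then have "Poly_Mapping.lookup (y j :: ('v, 'k) mpoly) 0 = 0" "Poly_Mapping.lookup (y n :: ('v, 'k) mpoly) 0 = 0"
    using n2 by (auto intro: y_const)
  then have e: "Poly_Mapping.lookup (if P then y j else 0 :: ('v, 'k) mpoly) 0 = 0"
    "Poly_Mapping.lookup (if P then y n else 0 :: ('v, 'k) mpoly) 0 = 0" for P
    by (cases P, simp_all)+
  show "koszul_sign j (fst z) * Poly_Mapping.lookup
      ((if z' = (insert j (fst z), snd z - {#j#}) \<and> j \<in># snd z then y j else 0 :: ('v, 'k) mpoly)
       - (if z' = (insert j (fst z), snd z - {#n#}) \<and> n \<in># snd z then y n else 0)) 0 = 0"
    by (simp only: lookup_minus e diff_self mult_zero_right)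
qed

text \<open>The first differential consists of products of \<open>s \<ge> 1\<close> generators, each
  nonconstant since no part is everything; later entries are built from the \<open>y j\<close>,
  nonconstant since no part is empty.\<close>

lemma res_minimal:
  assumes p: "p < res_rank i" and q: "q < res_rank (Suc i)"
  shows "Poly_Mapping.lookup (res_bd i $$ (p, q)) 0 = 0"
proof (cases i)
  case 0
  then have b: "enum 0 q \<in> basis 0" using q by (intro enum_in) simp
  then obtain b where b: "enum 0 q = ({}, b)" "b \<in> msets s" unfolding basis_0 by auto
  obtain j b' where j: "b = add_mset j b'" using b(2) s1 by (cases b) (auto simp: msets_def)
  then have "card (V j) < card (UNIV :: 'v set)" using b by (intro card_V_less) (auto simp: msets_def)
  then have "V j \<noteq> UNIV" by auto
  then obtain v where "v \<notin> V j" by auto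
  then have "Poly_Mapping.lookup (mexp b) v \<noteq> 0"
    by (simp add: j mexp_def lookup_add indicator_exp.rep_eq)
  then have "mexp b \<noteq> 0" by auto
  then show ?thesis using p q 0 by (simp add: res_bd_def b mon_def lookup_single)
next
  case (Suc i')
  then show ?thesis using p q by (simp add: res_bd_def entry_const)
qed

lemma betti_ne_0_iff:
  assumes E: "complete_multipartite n V E"
  defines "I \<equiv> ideal_power (cover_ideal E) s :: ('v, 'k::field) mpoly set"
  shows "betti (cyclic_module I) (cyclic_grading I) i j \<noteq> 0 \<longleftrightarrow>
    (i = 0 \<and> j = 0) \<or> (\<exists>i' z. i = Suc i' \<and> z \<in> basis i' \<and> basis_degree z = j)"
proof -
  have "I = span_mon s" unfolding I_def cover_ideal_eq[OF E] by (rule ideal_power_span_mon)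
  then have "betti (cyclic_module I) (cyclic_grading I) i j \<noteq> 0 \<longleftrightarrow> (\<exists>p<res_rank i. res_shift i p = j)"
    using betti_cyclic_ne_0_iff[OF ideal_span_mon _ _ res_presents res_minimal] by simp
  also have "\<dots> \<longleftrightarrow> (i = 0 \<and> j = 0) \<or> (\<exists>i' z. i = Suc i' \<and> z \<in> basis i' \<and> basis_degree z = j)"
  proof (cases i)
    case (Suc i')
    have "(\<exists>p<card (basis i'). basis_degree (enum i' p) = j) \<longleftrightarrow> (\<exists>z\<in>basis i'. basis_degree z = j)"
      using enum_in[of _ i'] enum_surj[of _ i'] by blast
    then show ?thesis unfolding Suc Bex_def by (simp only: res_simps) simp
  qed auto
  finally show ?thesis .
qed

lemma regularity_cover_ideal_power:
  assumes E: "complete_multipartite n V E" and w1: "\<And>j. j \<in> {1..n} \<Longrightarrow> card (V 1) \<le> card (V j)"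
  defines "I \<equiv> ideal_power (cover_ideal E) s :: ('v, 'k::field) mpoly set"
    and "t \<equiv> min s (n - 1)"
  shows "regularity (cyclic_module I) (cyclic_grading I)
    = int s * int (card (UNIV :: 'v set)) - int (s - t) * int (card (V 1)) - int t - 1"
proof -
  let ?W = "int (card (UNIV :: 'v set))" and ?w = "int (card (V 1))"
  \<comment> \<open>The largest degree minus homological degree at level \<open>i\<close>. The final
    1 comes from \<open>basis i\<close> sitting in homological degree \<open>Suc i\<close>.\<close>
  let ?f = "\<lambda>i. int s * ?W - int (s - i) * ?w - int i - 1"
  have w: "1 \<le> ?w" using card_V[of 1] n2 by simp
  have deg: "basis_degree (K, b) = int s * ?W - (\<Sum>j\<in>#b. int (card (V j)))"
    if "(K, b) \<in> basis i" for K b i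
  proof -
    have "int s = int (size b) + int i" using that by (auto simp: basis_def)
    then show ?thesis using that mdegree_mexp[of b]
      by (simp add: basis_degree_def basis_def algebra_simps)
  qed
  have lower: "int (s - i) * ?w \<le> (\<Sum>j\<in>#b. int (card (V j)))" if "(K, b) \<in> basis i" for K b i
  proof -
    have "int (size b) * ?w \<le> (\<Sum>j\<in>#b. int (card (V j)))" if "set_mset b \<subseteq> {1..n}" for b
      using that
    proof (induction b)
      case (add j b)
      then show ?case using w1[of j] by (simp add: distrib_right)
    qed simp
    moreover have "s - i = size b" "set_mset b \<subseteq> {1..n}" using that by (auto simp: basis_def)
    ultimately show ?thesis by simp
  qed
  \<comment> \<open>\<open>K\<close> consists of indices below \<open>n\<close>, and
    \<open>size b + i = s\<close>; these two constraints give the two arguments of the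
    minimum.\<close>
  have it: "i \<le> t" if "(K, b) \<in> basis i" for K b i
    using that card_mono[of "{1..<n}" K] by (auto simp: basis_def t_def)
  \<comment> \<open>One more index changes the value by \<open>?w - 1\<close>, which is not
    negative.\<close>
  have mono: "?f i \<le> ?f i'" if "i \<le> i'" "i' \<le> s" for i i'
  proof -
    have "(int i' - int i) * 1 \<le> (int i' - int i) * ?w" using that w by (intro mult_left_mono) auto
    then show ?thesis using that by (simp add: algebra_simps of_nat_diff)
  qed
  \<comment> \<open>Degrees are largest when every factor is \<open>T_1\<close>, as
    \<open>V 1\<close> is a smallest part; \<open>{1..<Suc i}\<close> is one choice of
    \<open>i\<close> indices below \<open>n\<close>.\<close>
  have witness: "({1..<Suc i}, replicate_mset (s - i) 1) \<in> basis i"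
    and wit_deg: "basis_degree ({1..<Suc i}, replicate_mset (s - i) 1) - int (Suc i) = ?f i" if "i \<le> t" for i
  proof -
    show *: "({1..<Suc i}, replicate_mset (s - i) 1) \<in> basis i"
      using that n2 by (auto simp: basis_def t_def split: if_splits)
    show "basis_degree ({1..<Suc i}, replicate_mset (s - i) 1) - int (Suc i) = ?f i"
      using deg[OF *] by simp
  qed
  let ?M = "{j - int i |i j. betti (cyclic_module I) (cyclic_grading I) i j \<noteq> 0}"
  have M: "?M = insert 0 (\<Union>i. (\<lambda>z. basis_degree z - int (Suc i)) ` basis i)"
  proof (intro equalityI subsetI)
    fix m assume "m \<in> ?M"
    then obtain i j where m: "m = j - int i" and "betti (cyclic_module I) (cyclic_grading I) i j \<noteq> 0"
      by blast
    then consider "i = 0" "j = 0" | i' z where "i = Suc i'" "z \<in> basis i'" "basis_degree z = j"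
      unfolding I_def betti_ne_0_iff[OF E] by blast
    then show "m \<in> insert 0 (\<Union>i. (\<lambda>z. basis_degree z - int (Suc i)) ` basis i)"
    proof cases
      case (2 i' z)
      then show ?thesis unfolding m by (intro insertI2 UN_I[of i']) (auto intro: image_eqI[of _ _ z])
    qed (simp add: m)
  next
    fix m assume "m \<in> insert 0 (\<Union>i. (\<lambda>z. basis_degree z - int (Suc i)) ` basis i)"
    then consider "m = 0" | i z where "z \<in> basis i" "m = basis_degree z - int (Suc i)" by blast
    then show "m \<in> ?M"
    proof cases
      case 1
      then show ?thesis unfolding I_def betti_ne_0_iff[OF E]
        by (intro CollectI exI[of _ "0::nat"] exI[of _ "0::int"]) simp
    next
      case (2 i z)
      then show ?thesis unfolding I_def betti_ne_0_iff[OF E]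
        by (intro CollectI exI[of _ "Suc i"] exI[of _ "basis_degree z"]) blast
    qed
  qed
  have basis_empty: "basis i = {}" if "t < i" for i
    using it that by (metis equals0I leD surj_pair)
  have "(\<Union>i. (\<lambda>z. basis_degree z - int (Suc i)) ` basis i)
      \<subseteq> (\<Union>i\<in>{..t}. (\<lambda>z. basis_degree z - int (Suc i)) ` basis i)"
    using basis_empty by (fastforce simp: not_less[symmetric])
  then have fin: "finite ?M" unfolding M finite_insert by (rule finite_subset) simp
  have "Max ?M = ?f t"
  proof (rule Max_eqI[OF fin])
    show "?f t \<in> ?M"
      unfolding M using witness[of t] wit_deg[of t] by (intro insertI2 UN_I[of t]) (auto intro!: image_eqI)
  next
    fix m assume "m \<in> ?M"
    then consider "m = 0" | i K b where "(K, b) \<in> basis i" "m = basis_degree (K, b) - int (Suc i)"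
      unfolding M by auto
    then show "m \<le> ?f t"
    proof cases
      case 1
      \<comment> \<open>The summand \<open>S\<close> in homological degree 0 contributes 0 to the
        set; it stays below \<open>?f 0\<close> because \<open>V 1\<close> is not everything and
        \<open>s\<close> is positive.\<close>
      have "int s * (?W - ?w) \<ge> 1 * 1"
        using card_V_less[of 1] n2 s1 by (intro mult_mono) auto
      then have "0 \<le> ?f 0" by (simp add: algebra_simps)
      also have "\<dots> \<le> ?f t" by (rule mono) (auto simp: t_def)
      finally show ?thesis using 1 by simp
    next
      case (2 i K b)
      have "m \<le> ?f i" using 2 deg[OF 2(1)] lower[OF 2(1)] by simp
      also have "\<dots> \<le> ?f t" using it[OF 2(1)] by (intro mono) (auto simp: t_def)
      finally show ?thesis .
    qed
  qed
  then show ?thesis by (simp add: regularity_def)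
qed

end

section \<open>The formula in the two ranges of s\<close>

theorem corollary5p4:
  fixes n s :: nat
    and w :: "nat \<Rightarrow> nat"
    and V :: "nat \<Rightarrow> 'v::finite set"
    and E :: "'v set set"
    and J :: "('v, 'k::field) mpoly set"
  assumes "n \<ge> 2"
    and "complete_multipartite n V E"
    and "\<And>i. 1 \<le> i \<Longrightarrow> i \<le> n \<Longrightarrow> card (V i) = w i \<and> w i \<ge> 1"
    and "\<And>i. 1 \<le> i \<Longrightarrow> i < n \<Longrightarrow> w i \<le> w (i + 1)"
    and "J = cover_ideal E"
    and "s \<ge> 1"
  shows "regularity (cyclic_module (ideal_power J s)) (cyclic_grading (ideal_power J s)) =
    (if s < n - 1
     then int s * (\<Sum>l=1..n. int (w l)) - (int s + 1)
     else int s * (\<Sum>l=1..n. int (w l)) - int (w 1) * (int s - int n + 1) - int n)"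
proof -
  interpret multipartite n s V
    using assms(1,2,6) by unfold_locales (auto simp: complete_multipartite_def)
  \<comment> \<open>The hypothesis compares neighbours only; induction makes \<open>V 1\<close> a
    smallest part.\<close>
  have w1: "w 1 \<le> w j" if "1 \<le> j" "j \<le> n" for j
    using that
  proof (induction j rule: dec_induct)
    case (step j)
    then show ?case using assms(4)[of j] by simp
  qed simp
  have "(\<Sum>l=1..n. int (w l)) = int (\<Sum>l\<in>{1..n}. card (V l))"
    using assms(3) by simp
  then have W: "(\<Sum>l=1..n. int (w l)) = int (card (UNIV :: 'v set))" by (simp only: sum_card_V)
  have reg: "regularity (cyclic_module (ideal_power J s)) (cyclic_grading (ideal_power J s))
      = int s * int (card (UNIV :: 'v set)) - int (s - min s (n - 1)) * int (w 1) - int (min s (n - 1)) - 1"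
    unfolding assms(5)
    using regularity_cover_ideal_power[OF assms(2), where 'k = 'k] assms(1,3) w1 by simp
  show ?thesis
  proof (cases "s < n - 1")
    case True
    \<comment> \<open>Here the minimum is \<open>s\<close>: no factor \<open>T\<close> remains, and
      \<open>w 1\<close> drops out.\<close>
    then show ?thesis unfolding reg W by simp
  next
    case False
    \<comment> \<open>The minimum is \<open>n - 1 \<le> s\<close>, so the natural-number differences
      may be taken over the integers, and \<open>- (n - 1) - 1\<close> is the final
      \<open>- n\<close>.\<close>
    then have "min s (n - 1) = n - 1" "int (s - (n - 1)) = int s - int n + 1" "int (n - 1) = int n - 1"
      using assms(1) by (auto simp: of_nat_diff)
    then show ?thesis unfolding reg W using False by simp
  qed
qed

end
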